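(* Let $p$ be a prime number and let $g:B\rightarrow C$ be a faithfully flat reduced homomorphism between Noetherian $\mathbb{F}_p$-algebras. If $C$ is $F$-finite, then $B$ is $F$-finite.
   Context: All rings are commutative with identity. A homomorphism $g:B\to C$ between Noetherian rings is called reduced if it is flat with geometrically reduced fibers, i.e. $g$ is flat and for every prime ideal $P$ of $B$ with residue field $\kappa(P)$, the $\kappa(P)$-algebra $C\otimes_B\kappa(P)$ is geometrically reduced. An $\mathbb{F}_p$-algebra $A$ is $F$-finite if the Frobenius map $F_A:A\to A$, $a\mapsto a^p$, is finite, i.e. $A$ is a finitely generated module over itself via $F_A$. *)

theory Defs
  imports "HOL-Algebra.Exact_Sequence" "HOL-Algebra.Free_Abelian_Groups"
    "HOL-Algebra.Ring_Divisibility" "HOL-Algebra.Module" "HOL-Algebra.IntRing"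
    "HOL-Computational_Algebra.Primes"
begin

section \<open>Modules\<close>

definition additive_group :: "('a, 'm) ring_scheme \<Rightarrow> 'a monoid"
  where "additive_group M = \<lparr>carrier = carrier M, monoid.mult = add M, one = ring.zero M\<rparr>"

definition module_homs :: "('r, 'a) ring_scheme \<Rightarrow> ('r, 'm) module \<Rightarrow> ('r, 'n) module \<Rightarrow> ('m \<Rightarrow> 'n) set"
  where "module_homs R M N =
    {f \<in> hom (additive_group M) (additive_group N).
       \<forall>r \<in> carrier R. \<forall>x \<in> carrier M. f (r \<odot>\<^bsub>M\<^esub> x) = r \<odot>\<^bsub>N\<^esub> f x}"

definition restrict_scalars :: "('r \<Rightarrow> 'a) \<Rightarrow> 'a ring \<Rightarrow> ('r, 'a) module"
  where "restrict_scalars f A =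
    \<lparr>carrier = carrier A, monoid.mult = monoid.mult A, one = one A, ring.zero = ring.zero A, add = add A,
     smult = (\<lambda>r a. f r \<otimes>\<^bsub>A\<^esub> a)\<rparr>"

definition finitely_generated_module :: "('r, 'a) ring_scheme \<Rightarrow> ('r, 'm) module \<Rightarrow> bool"
  where "finitely_generated_module R M \<longleftrightarrow>
    (\<exists>S \<subseteq> carrier M. finite S \<and>
       (\<forall>x \<in> carrier M. \<exists>c \<in> S \<rightarrow> carrier R. x = (\<Oplus>\<^bsub>M\<^esub>s\<in>S. c s \<odot>\<^bsub>M\<^esub> s)))"


section \<open>Tensor products\<close>

definition tensor_relations ::
    "('r, 'a) ring_scheme \<Rightarrow> ('r, 'm) module \<Rightarrow> ('r, 'n) module \<Rightarrow> ('m \<times> 'n \<Rightarrow>\<^sub>0 int) set"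
  where "tensor_relations R M N =
      {frag_of (x \<oplus>\<^bsub>M\<^esub> x', y) - frag_of (x, y) - frag_of (x', y) | x x' y.
         x \<in> carrier M \<and> x' \<in> carrier M \<and> y \<in> carrier N}
    \<union> {frag_of (x, y \<oplus>\<^bsub>N\<^esub> y') - frag_of (x, y) - frag_of (x, y') | x y y'.
         x \<in> carrier M \<and> y \<in> carrier N \<and> y' \<in> carrier N}
    \<union> {frag_of (r \<odot>\<^bsub>M\<^esub> x, y) - frag_of (x, r \<odot>\<^bsub>N\<^esub> y) | r x y.
         r \<in> carrier R \<and> x \<in> carrier M \<and> y \<in> carrier N}"

definition tensor_subgroup ::
    "('r, 'a) ring_scheme \<Rightarrow> ('r, 'm) module \<Rightarrow> ('r, 'n) module \<Rightarrow> ('m \<times> 'n \<Rightarrow>\<^sub>0 int) set"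
  where "tensor_subgroup R M N =
    generate (free_Abelian_group (carrier M \<times> carrier N)) (tensor_relations R M N)"

text \<open>The underlying abelian group of the tensor product of two modules, which is all that is
  needed to speak about exactness.\<close>

definition tensor_group ::
    "('r, 'a) ring_scheme \<Rightarrow> ('r, 'm) module \<Rightarrow> ('r, 'n) module \<Rightarrow> ('m \<times> 'n \<Rightarrow>\<^sub>0 int) set monoid"
  where "tensor_group R M N =
    free_Abelian_group (carrier M \<times> carrier N) Mod tensor_subgroup R M N"

text \<open>The map from \<open>M \<otimes> N\<close> to \<open>M \<otimes> N'\<close> induced by a linear map \<open>f\<close> from \<open>N\<close> to \<open>N'\<close>. All the
  cosets in the union coincide.\<close>

definition tensor_map ::
    "('r, 'a) ring_scheme \<Rightarrow> ('r, 'm) module \<Rightarrow> ('r, 'n') module \<Rightarrow> ('n \<Rightarrow> 'n') \<Rightarrow>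
     ('m \<times> 'n \<Rightarrow>\<^sub>0 int) set \<Rightarrow> ('m \<times> 'n' \<Rightarrow>\<^sub>0 int) set"
  where "tensor_map R M N' f X =
    (\<Union>z \<in> X. tensor_subgroup R M N' #>\<^bsub>free_Abelian_group (carrier M \<times> carrier N')\<^esub>
               frag_extend (\<lambda>(x, y). frag_of (x, f y)) z)"

text \<open>The monoid ring over the integers of the multiplicative monoid of \<open>A \<times> A'\<close>. Its additive group
  is the free abelian group on \<open>A \<times> A'\<close>, so the tensor product of two algebras is a quotient ring
  of it.\<close>

definition pair_ring :: "'a ring \<Rightarrow> 'b ring \<Rightarrow> ('a \<times> 'b \<Rightarrow>\<^sub>0 int) ring"
  where "pair_ring A A' =
    \<lparr>carrier = {z. Poly_Mapping.keys z \<subseteq> carrier A \<times> carrier A'},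
     monoid.mult = (\<lambda>z w. frag_extend (\<lambda>(a, b).
               frag_extend (\<lambda>(c, d). frag_of (a \<otimes>\<^bsub>A\<^esub> c, b \<otimes>\<^bsub>A'\<^esub> d)) w) z),
     one = frag_of (\<one>\<^bsub>A\<^esub>, \<one>\<^bsub>A'\<^esub>),
     ring.zero = 0,
     add = (+)\<rparr>"

definition algebra_tensor_ideal ::
    "'r ring \<Rightarrow> 'a ring \<Rightarrow> ('r \<Rightarrow> 'a) \<Rightarrow> 'b ring \<Rightarrow> ('r \<Rightarrow> 'b) \<Rightarrow> ('a \<times> 'b \<Rightarrow>\<^sub>0 int) set"
  where "algebra_tensor_ideal R A f A' f' =
    genideal (pair_ring A A')
      (tensor_relations R (restrict_scalars f A) (restrict_scalars f' A'))"

text \<open>The tensor product over \<open>R\<close> of the \<open>R\<close>-algebras given by \<open>f : R \<rightarrow> A\<close> and \<open>f' : R \<rightarrow> A'\<close>.\<close>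

definition algebra_tensor ::
    "'r ring \<Rightarrow> 'a ring \<Rightarrow> ('r \<Rightarrow> 'a) \<Rightarrow> 'b ring \<Rightarrow> ('r \<Rightarrow> 'b) \<Rightarrow> ('a \<times> 'b \<Rightarrow>\<^sub>0 int) set ring"
  where "algebra_tensor R A f A' f' = pair_ring A A' Quot algebra_tensor_ideal R A f A' f'"

definition algebra_tensor_right ::
    "'r ring \<Rightarrow> 'a ring \<Rightarrow> ('r \<Rightarrow> 'a) \<Rightarrow> 'b ring \<Rightarrow> ('r \<Rightarrow> 'b) \<Rightarrow> 'b \<Rightarrow> ('a \<times> 'b \<Rightarrow>\<^sub>0 int) set"
  where "algebra_tensor_right R A f A' f' b =
    algebra_tensor_ideal R A f A' f' +>\<^bsub>pair_ring A A'\<^esub> frag_of (\<one>\<^bsub>A\<^esub>, b)"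


section \<open>Flatness\<close>

text \<open>A module is flat if tensoring with it preserves exactness of sequences
  \<open>N1 \<rightarrow> N2 \<rightarrow> N3\<close>, and faithfully flat if it also reflects exactness.

  HOL cannot quantify over the types of the \<open>N\<close>'s inside a definition, so they are taken with
  carriers in the type \<open>'r list\<close>. This type is infinite and at least as large as \<open>R\<close>, hence it
  contains a copy of every countably generated \<open>R\<close>-module and of every \<open>R\<close>-module whose
  cardinality is at most that of \<open>'r list\<close>. An element of a tensor product and a witness of its
  vanishing involve only finitely many module elements; so exactness for all modules, of whatever
  size, reduces to modules of this kind by passing to submodules.\<close>

definition flat_module :: "'r ring \<Rightarrow> ('r, 'm) module \<Rightarrow> bool"
  where "flat_module R M \<longleftrightarrow>
    (\<forall>(N1 :: ('r, 'r list) module) (N2 :: ('r, 'r list) module) (N3 :: ('r, 'r list) module).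
     \<forall>f \<in> module_homs R N1 N2. \<forall>g \<in> module_homs R N2 N3.
       module R N1 \<longrightarrow> module R N2 \<longrightarrow> module R N3 \<longrightarrow>
       exact_seq ([additive_group N3, additive_group N2, additive_group N1], [g, f]) \<longrightarrow>
       exact_seq ([tensor_group R M N3, tensor_group R M N2, tensor_group R M N1],
                  [tensor_map R M N3 g, tensor_map R M N2 f]))"

definition faithfully_flat_module :: "'r ring \<Rightarrow> ('r, 'm) module \<Rightarrow> bool"
  where "faithfully_flat_module R M \<longleftrightarrow>
    (\<forall>(N1 :: ('r, 'r list) module) (N2 :: ('r, 'r list) module) (N3 :: ('r, 'r list) module).
     \<forall>f \<in> module_homs R N1 N2. \<forall>g \<in> module_homs R N2 N3.
       module R N1 \<longrightarrow> module R N2 \<longrightarrow> module R N3 \<longrightarrow>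
       (exact_seq ([additive_group N3, additive_group N2, additive_group N1], [g, f]) \<longleftrightarrow>
        exact_seq ([tensor_group R M N3, tensor_group R M N2, tensor_group R M N1],
                   [tensor_map R M N3 g, tensor_map R M N2 f])))"

definition flat_hom :: "'b ring \<Rightarrow> 'c ring \<Rightarrow> ('b \<Rightarrow> 'c) \<Rightarrow> bool"
  where "flat_hom B C g \<longleftrightarrow> g \<in> ring_hom B C \<and> flat_module B (restrict_scalars g C)"

definition faithfully_flat_hom :: "'b ring \<Rightarrow> 'c ring \<Rightarrow> ('b \<Rightarrow> 'c) \<Rightarrow> bool"
  where "faithfully_flat_hom B C g \<longleftrightarrow>
    g \<in> ring_hom B C \<and> faithfully_flat_module B (restrict_scalars g C)"


section \<open>Residue fields\<close>

definition fraction_rel :: "'a ring \<Rightarrow> (('a \<times> 'a) \<times> ('a \<times> 'a)) set"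
  where "fraction_rel D =
    {((a, b), (c, d)). a \<in> carrier D \<and> b \<in> carrier D - {\<zero>\<^bsub>D\<^esub>} \<and>
                       c \<in> carrier D \<and> d \<in> carrier D - {\<zero>\<^bsub>D\<^esub>} \<and>
                       a \<otimes>\<^bsub>D\<^esub> d = c \<otimes>\<^bsub>D\<^esub> b}"

text \<open>The field of fractions of a domain \<open>D\<close>.\<close>

definition fraction_field :: "'a ring \<Rightarrow> ('a \<times> 'a) set ring"
  where "fraction_field D =
    \<lparr>carrier = (carrier D \<times> (carrier D - {\<zero>\<^bsub>D\<^esub>})) // fraction_rel D,
     monoid.mult = (\<lambda>X Y. \<Union>(a, b) \<in> X. \<Union>(c, d) \<in> Y.
               fraction_rel D `` {(a \<otimes>\<^bsub>D\<^esub> c, b \<otimes>\<^bsub>D\<^esub> d)}),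
     one = fraction_rel D `` {(\<one>\<^bsub>D\<^esub>, \<one>\<^bsub>D\<^esub>)},
     ring.zero = fraction_rel D `` {(\<zero>\<^bsub>D\<^esub>, \<one>\<^bsub>D\<^esub>)},
     add = (\<lambda>X Y. \<Union>(a, b) \<in> X. \<Union>(c, d) \<in> Y.
               fraction_rel D `` {(a \<otimes>\<^bsub>D\<^esub> d \<oplus>\<^bsub>D\<^esub> c \<otimes>\<^bsub>D\<^esub> b, b \<otimes>\<^bsub>D\<^esub> d)})\<rparr>"

definition residue_field :: "'b ring \<Rightarrow> 'b set \<Rightarrow> ('b set \<times> 'b set) set ring"
  where "residue_field B P = fraction_field (B Quot P)"

definition residue_map :: "'b ring \<Rightarrow> 'b set \<Rightarrow> 'b \<Rightarrow> ('b set \<times> 'b set) set"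
  where "residue_map B P b = fraction_rel (B Quot P) `` {(P +>\<^bsub>B\<^esub> b, \<one>\<^bsub>B Quot P\<^esub>)}"


section \<open>Reduced homomorphisms\<close>

definition reduced_ring :: "'a ring \<Rightarrow> bool"
  where "reduced_ring A \<longleftrightarrow>
    (\<forall>x \<in> carrier A. \<forall>n :: nat. x [^]\<^bsub>A\<^esub> n = \<zero>\<^bsub>A\<^esub> \<longrightarrow> x = \<zero>\<^bsub>A\<^esub>)"

text \<open>The algebra given by \<open>h : k \<rightarrow> A\<close> over a field \<open>k\<close> is geometrically reduced if
  \<open>A \<otimes> K\<close> is reduced for every field extension \<open>K\<close> of \<open>k\<close>.

  The extensions range over those with carrier in \<open>'k list\<close>. Up to isomorphism, these include all
  algebraic extensions and all finitely generated ones. Since \<open>A \<otimes> K\<close> is the union of its subrings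
  \<open>A \<otimes> L\<close> with \<open>L\<close> finitely generated over \<open>k\<close>, nothing is lost by this restriction.\<close>

definition geometrically_reduced :: "'k ring \<Rightarrow> 'a ring \<Rightarrow> ('k \<Rightarrow> 'a) \<Rightarrow> bool"
  where "geometrically_reduced k A h \<longleftrightarrow>
    (\<forall>(K :: 'k list ring) e. field K \<longrightarrow> e \<in> ring_hom k K \<longrightarrow>
       reduced_ring (algebra_tensor k A h K e))"

definition reduced_hom :: "'b ring \<Rightarrow> 'c ring \<Rightarrow> ('b \<Rightarrow> 'c) \<Rightarrow> bool"
  where "reduced_hom B C g \<longleftrightarrow> flat_hom B C g \<and>
    (\<forall>P. primeideal P B \<longrightarrow>
       geometrically_reduced (residue_field B P)
         (algebra_tensor B C g (residue_field B P) (residue_map B P))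
         (algebra_tensor_right B C g (residue_field B P) (residue_map B P)))"


section \<open>Algebras over the prime field and F-finiteness\<close>

text \<open>A ring admits at most one homomorphism from the prime field, so being an algebra over it is a
  property, and all homomorphisms between such rings are algebra homomorphisms.\<close>

definition Fp_algebra :: "nat \<Rightarrow> 'a ring \<Rightarrow> bool"
  where "Fp_algebra p A \<longleftrightarrow> cring A \<and> (\<exists>\<phi>. \<phi> \<in> ring_hom (ZFact (int p)) A)"

definition frobenius :: "nat \<Rightarrow> 'a ring \<Rightarrow> 'a \<Rightarrow> 'a"
  where "frobenius p A a = a [^]\<^bsub>A\<^esub> p"

definition F_finite :: "nat \<Rightarrow> 'a ring \<Rightarrow> bool"
  where "F_finite p A \<longleftrightarrow> finitely_generated_module A (restrict_scalars (frobenius p A) A)"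

end

theory Submission
  imports Defs "HOL-Algebra.Weak_Morphisms"
begin

text \<open>Write \<open>F\<^sub>*B\<close> for \<open>B\<close> with \<open>B\<close> acting through \<open>p\<close>-th powers. The theorem rests on the relative Frobenius
  of \<open>g\<close>, the additive map from \<open>C \<otimes> F\<^sub>*B\<close> to \<open>C\<close> that sends \<open>c \<otimes> b\<close> to \<open>c\<^sup>p g(b)\<close>. It is injective
  (\<open>relative_frobenius_injective\<close>), and this lets finite generation descend. Indeed, \<open>C\<close> is a
  finitely generated module over the Noetherian ring \<open>C\<close> through Frobenius, so the submodule spanned
  by \<open>g(B)\<close> is already spanned by \<open>g(S)\<close> for a finite \<open>S \<subseteq> B\<close>. If \<open>N\<close> is the submodule of \<open>F\<^sub>*B\<close>
  spanned by \<open>S\<close>, then every \<open>c \<otimes> b\<close> has the same image in \<open>C\<close> as some element coming from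
  \<open>C \<otimes> N\<close>, hence is equal to it. So \<open>C \<otimes> N\<close> maps onto \<open>C \<otimes> F\<^sub>*B\<close>, and faithful flatness gives
  \<open>N = F\<^sub>*B\<close>.

  Injectivity is proved modulo every ideal \<open>I\<close> of \<open>B\<close>: an element of \<open>C \<otimes> F\<^sub>*B\<close> with image in \<open>IC\<close>
  comes from \<open>C \<otimes> I\<close>. For a prime \<open>P\<close> with residue field \<open>\<kappa>\<close> (\<open>relative_frobenius_fiber_kernel\<close>),
  map \<open>c \<otimes> b\<close> to the tensor of \<open>c \<otimes> 1\<close> and \<open>b\<^sup>1\<^sup>/\<^sup>p\<close> in \<open>(C \<otimes> \<kappa>) \<otimes> \<kappa>\<^sup>1\<^sup>/\<^sup>p\<close>. The \<open>p\<close>-th power of the result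
  is the image of \<open>c\<^sup>p g(b)\<close>. So an element with image in \<open>PC\<close> becomes nilpotent, and it becomes zero
  because the fibre is geometrically reduced. As \<open>(C \<otimes> \<kappa>) \<otimes> \<kappa>\<^sup>1\<^sup>/\<^sup>p\<close> is \<open>C \<otimes> F\<^sub>*\<kappa>\<close> and \<open>P\<close> is the
  kernel of \<open>B \<rightarrow> \<kappa>\<close>, flatness returns the element to \<open>C \<otimes> P\<close>. For a general \<open>I\<close>, choose \<open>a\<close> outside
  \<open>I\<close> such that \<open>(I : a)\<close> is prime. The claims for \<open>(I : a)\<close> and for \<open>I + aB\<close> imply that for \<open>I\<close>
  (\<open>injective_modulo_extension\<close>), because flatness makes colon ideals commute with extension
  (\<open>flat_colon\<close>); Noetherian induction does the rest.

  Elements of tensor products are formal integer combinations of pairs, taken modulo the subgroup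
  spanned by the defining relations. The claim that a combination comes from \<open>M \<otimes> H\<close> is the
  predicate \<open>tensor_image\<close>; it replaces exactness of sequences of quotient groups.\<close>

section \<open>The Frobenius map in characteristic p\<close>

lemma ring_hom_minus:
  assumes "ring R" "ring S" "h \<in> ring_hom R S" "x \<in> carrier R" "y \<in> carrier R"
  shows "h (x \<ominus>\<^bsub>R\<^esub> y) = h x \<ominus>\<^bsub>S\<^esub> h y"
proof -
  interpret ring_hom_ring R S h using assms by (intro ring_hom_ringI2)
  show ?thesis using assms by (simp add: a_minus_def)
qed

lemma ring_hom_nat_pow:
  assumes "ring R" "ring S" "h \<in> ring_hom R S" "x \<in> carrier R"
  shows "h (x [^]\<^bsub>R\<^esub> (n::nat)) = h x [^]\<^bsub>S\<^esub> n"
proof -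
  interpret R: ring R by fact
  interpret S: ring S by fact
  show ?thesis
    by (induction n) (use assms in \<open>auto simp: ring_hom_one ring_hom_mult\<close>)
qed

lemma (in cring) binomial_expansion:
  assumes x: "x \<in> carrier R" and y: "y \<in> carrier R"
  shows "(x \<oplus> y) [^] (n::nat) = (\<Oplus>k\<in>{..n}. [(n choose k)] \<cdot> (x [^] k \<otimes> y [^] (n - k)))"
proof (induction n)
  case 0
  then show ?case using x y by (simp add: add.nat_pow_eone)
next
  case (Suc n)
  \<comment> \<open>The products of the expansion for \<open>n\<close> with \<open>y\<close> and with \<open>x\<close>. A zero term extends
    either sum to the range from 0 to \<open>Suc n\<close>, so that they add up termwise by Pascal's rule.\<close>
  define F where "F k = [(n choose k)] \<cdot> (x [^] k \<otimes> y [^] (Suc n - k))" for k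
  define G where "G k = (case k of 0 \<Rightarrow> \<zero> | Suc j \<Rightarrow> [(n choose j)] \<cdot> (x [^] k \<otimes> y [^] (n - j)))" for k
  have Fc: "F k \<in> carrier R" and Gc: "G k \<in> carrier R" for k
    using x y by (auto simp: F_def G_def split: nat.split)
  have "(x \<oplus> y) [^] Suc n = (x \<oplus> y) \<otimes> (\<Oplus>k\<in>{..n}. [(n choose k)] \<cdot> (x [^] k \<otimes> y [^] (n - k)))"
    using Suc x y by (simp add: m_comm)
  also have "\<dots> = (\<Oplus>k\<in>{..n}. x \<otimes> ([(n choose k)] \<cdot> (x [^] k \<otimes> y [^] (n - k))))
      \<oplus> (\<Oplus>k\<in>{..n}. y \<otimes> ([(n choose k)] \<cdot> (x [^] k \<otimes> y [^] (n - k))))"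
    using x y by (simp add: l_distr finsum_rdistr)
  also have "(\<Oplus>k\<in>{..n}. x \<otimes> ([(n choose k)] \<cdot> (x [^] k \<otimes> y [^] (n - k)))) = (\<Oplus>k\<in>{..Suc n}. G k)"
  proof -
    have "(\<Oplus>k\<in>{..Suc n}. G k) = (\<Oplus>k\<in>{..n}. G (Suc k)) \<oplus> G 0"
      using Gc by (intro finsum_Suc2) auto
    also have "\<dots> = (\<Oplus>k\<in>{..n}. G (Suc k))"
    proof -
      have "G 0 = \<zero>" by (simp add: G_def)
      then show ?thesis using Gc by (simp add: Pi_def)
    qed
    also have "\<dots> = (\<Oplus>k\<in>{..n}. x \<otimes> ([(n choose k)] \<cdot> (x [^] k \<otimes> y [^] (n - k))))"
      using x y by (intro finsum_cong') (auto simp: G_def add_pow_rdistr m_assoc m_comm m_lcomm)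
    finally show ?thesis ..
  qed
  also have "(\<Oplus>k\<in>{..n}. y \<otimes> ([(n choose k)] \<cdot> (x [^] k \<otimes> y [^] (n - k)))) = (\<Oplus>k\<in>{..Suc n}. F k)"
  proof -
    have "(\<Oplus>k\<in>{..Suc n}. F k) = F (Suc n) \<oplus> (\<Oplus>k\<in>{..n}. F k)"
      using Fc by (intro finsum_Suc) auto
    also have "\<dots> = (\<Oplus>k\<in>{..n}. F k)"
      using Fc x y by (simp add: F_def binomial_eq_0)
    also have "\<dots> = (\<Oplus>k\<in>{..n}. y \<otimes> ([(n choose k)] \<cdot> (x [^] k \<otimes> y [^] (n - k))))"
      using x y by (intro finsum_cong') (auto simp: F_def add_pow_rdistr m_assoc m_comm m_lcomm Suc_diff_le)
    finally show ?thesis ..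
  qed
  also have "(\<Oplus>k\<in>{..Suc n}. G k) \<oplus> (\<Oplus>k\<in>{..Suc n}. F k) = (\<Oplus>k\<in>{..Suc n}. G k \<oplus> F k)"
    using Fc Gc by (subst finsum_addf) auto
  also have "\<dots> = (\<Oplus>k\<in>{..Suc n}. [(Suc n choose k)] \<cdot> (x [^] k \<otimes> y [^] (Suc n - k)))"
  proof (intro finsum_cong' refl)
    fix k assume k: "k \<in> {..Suc n}"
    show "G k \<oplus> F k = [(Suc n choose k)] \<cdot> (x [^] k \<otimes> y [^] (Suc n - k))"
      using x y by (cases k) (auto simp: F_def G_def add.nat_pow_mult)
  qed (use x y in auto)
  finally show ?case .
qed

text \<open>For \<open>0 < k < p\<close> the binomial coefficient is a multiple of \<open>p\<close>, so only the outer terms survive.\<close>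

lemma (in cring) power_char_add:
  assumes p: "Factorial_Ring.prime (p::nat)" and char: "[p] \<cdot> \<one> = \<zero>"
    and x: "x \<in> carrier R" and y: "y \<in> carrier R"
  shows "(x \<oplus> y) [^] p = x [^] p \<oplus> y [^] p"
proof -
  let ?F = "\<lambda>k. [(p choose k)] \<cdot> (x [^] k \<otimes> y [^] (p - k))"
  have char_mult: "[(m * p)] \<cdot> u = \<zero>" if u: "u \<in> carrier R" for m u
  proof -
    have "[p] \<cdot> u = [p] \<cdot> \<one> \<otimes> u" using u by (simp add: add_pow_ldistr)
    also have "\<dots> = \<zero>" using u char by simp
    finally show ?thesis using u by (metis add.nat_pow_one add.nat_pow_pow mult.commute)
  qed
  have "p > 0" using p prime_gt_0_nat by blast
  have "(x \<oplus> y) [^] p = (\<Oplus>k\<in>{..p}. ?F k)" by (rule binomial_expansion[OF x y])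
  also have "\<dots> = (\<Oplus>k\<in>{0,p}. ?F k)"
  proof (rule add.finprod_mono_neutral_cong_right)
    show "?F k = \<zero>" if k: "k \<in> {..p} - {0,p}" for k
    proof -
      have "p dvd (p choose k)" by (rule dvd_choose_prime) (use k p in auto)
      then obtain m where "(p choose k) = m * p" by (metis dvd_def mult.commute)
      then show ?thesis using x y by (simp add: char_mult)
    qed
  qed (use x y in auto)
  also have "\<dots> = x [^] p \<oplus> y [^] p"
    using x y \<open>p > 0\<close> by (simp add: a_comm add.nat_pow_eone)
  finally show ?thesis .
qed

lemma frobenius_ring_hom:
  assumes "cring A" and "Factorial_Ring.prime p" and "[p] \<cdot>\<^bsub>A\<^esub> \<one>\<^bsub>A\<^esub> = \<zero>\<^bsub>A\<^esub>"
  shows "frobenius p A \<in> ring_hom A A"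
proof -
  interpret cring A by fact
  show ?thesis
    by (rule ring_hom_memI)
       (use assms in \<open>auto simp: frobenius_def power_char_add nat_pow_distrib\<close>)
qed

lemma ring_hom_add_pow:
  assumes "ring R" and "ring S" and "h \<in> ring_hom R S" and x: "x \<in> carrier R"
  shows "h ([(n::nat)] \<cdot>\<^bsub>R\<^esub> x) = [n] \<cdot>\<^bsub>S\<^esub> h x"
proof -
  interpret ring_hom_ring R S h using assms by (intro ring_hom_ringI2)
  interpret add: group_hom "add_monoid R" "add_monoid S" h by (rule a_group_hom)
  show ?thesis using add.hom_nat_pow[of x n] x by (simp add: add_pow_def)
qed

lemma ring_hom_char:
  assumes "ring R" and "ring S" and "h \<in> ring_hom R S"
    and "[(p::nat)] \<cdot>\<^bsub>R\<^esub> \<one>\<^bsub>R\<^esub> = \<zero>\<^bsub>R\<^esub>"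
  shows "[p] \<cdot>\<^bsub>S\<^esub> \<one>\<^bsub>S\<^esub> = \<zero>\<^bsub>S\<^esub>"
  using ring_hom_add_pow[OF assms(1-3), of "\<one>\<^bsub>R\<^esub>" p] assms
  by (simp add: ring.ring_simprules ring_hom_one ring_hom_zero)

text \<open>The relation \<open>p \<cdot> 1 = 0\<close> holds in the prime field, and the structure map carries it to \<open>A\<close>.\<close>

lemma Fp_algebra_char:
  assumes "Fp_algebra p A"
  shows "cring A" and "[p] \<cdot>\<^bsub>A\<^esub> \<one>\<^bsub>A\<^esub> = \<zero>\<^bsub>A\<^esub>"
proof -
  show A: "cring A" using assms by (simp add: Fp_algebra_def)
  obtain \<phi> where \<phi>: "\<phi> \<in> ring_hom (ZFact (int p)) A"
    using assms by (auto simp: Fp_algebra_def)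
  let ?J = "Idl\<^bsub>\<Z>\<^esub> {int p}"
  have J: "ideal ?J \<Z>" by (rule int.genideal_ideal) simp
  have Z: "cring (ZFact (int p))" by (rule ZFact_is_cring)
  have hom: "(+>\<^bsub>\<Z>\<^esub>) ?J \<in> ring_hom \<Z> (ZFact (int p))"
    unfolding ZFact_def by (rule ideal.rcos_ring_hom[OF J])
  have pow: "[n] \<cdot>\<^bsub>\<Z>\<^esub> (1::int) = int n" for n :: nat
    by (induction n) (auto simp: add_pow_def nat_pow_def)
  have "[p] \<cdot>\<^bsub>ZFact (int p)\<^esub> \<one>\<^bsub>ZFact (int p)\<^esub> = ?J +>\<^bsub>\<Z>\<^esub> int p"
    using ring_hom_add_pow[OF int.ring_axioms cring.axioms(1)[OF Z] hom, of 1 p] pow[of p]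
      ring_hom_one[OF hom] by simp
  also have "\<dots> = \<zero>\<^bsub>ZFact (int p)\<^esub>"
    unfolding ZFact_def FactRing_def
    by (simp add: abelian_subgroup.a_rcos_const[OF abelian_subgroupI3[OF ideal.axioms(1)[OF J] int.is_abelian_group]]
        int.genideal_self')
  finally show "[p] \<cdot>\<^bsub>A\<^esub> \<one>\<^bsub>A\<^esub> = \<zero>\<^bsub>A\<^esub>"
    using A Z \<phi> by (intro ring_hom_char[of "ZFact (int p)" A \<phi>]) (auto simp: cring.axioms)
qed

section \<open>Residue fields\<close>

context
  fixes R :: "'a ring" (structure)
  assumes R: "domain R"
begin

interpretation domain R by (rule R)

abbreviation frac :: "'a \<Rightarrow> 'a \<Rightarrow> ('a \<times> 'a) set"
  where "frac a b \<equiv> fraction_rel R `` {(a, b)}"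

lemma fraction_rel_equiv: "equiv (carrier R \<times> (carrier R - {\<zero>})) (fraction_rel R)"
proof (rule equivI)
  show "refl_on (carrier R \<times> (carrier R - {\<zero>})) (fraction_rel R)"
    by (auto simp: refl_on_def fraction_rel_def)
  show "sym (fraction_rel R)"
    by (auto simp: sym_def fraction_rel_def)
  show "trans (fraction_rel R)"
  proof (rule transI, clarify)
    fix a b c d e f
    assume ab: "((a, b), (c, d)) \<in> fraction_rel R" and cd: "((c, d), (e, f)) \<in> fraction_rel R"
    have cl: "a \<in> carrier R" "b \<in> carrier R" "c \<in> carrier R" "d \<in> carrier R" "d \<noteq> \<zero>"
      "e \<in> carrier R" "f \<in> carrier R"
      using ab cd by (auto simp: fraction_rel_def)
    have "d \<otimes> (a \<otimes> f) = (a \<otimes> d) \<otimes> f" using cl by (simp add: m_ac)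
    also have "\<dots> = (c \<otimes> f) \<otimes> b" using ab cl by (simp add: fraction_rel_def m_ac)
    also have "\<dots> = d \<otimes> (e \<otimes> b)" using cd cl by (simp add: fraction_rel_def m_ac)
    finally have "a \<otimes> f = e \<otimes> b" using cl by (simp add: m_lcancel)
    then show "((a, b), (e, f)) \<in> fraction_rel R" using ab cd by (auto simp: fraction_rel_def)
  qed
qed (auto simp: fraction_rel_def)

lemma frac_eq_iff:
  assumes "a \<in> carrier R" "b \<in> carrier R - {\<zero>}" "c \<in> carrier R" "d \<in> carrier R - {\<zero>}"
  shows "frac a b = frac c d \<longleftrightarrow> a \<otimes> d = c \<otimes> b"
  using eq_equiv_class_iff[OF fraction_rel_equiv, of "(a, b)" "(c, d)"] assms
  by (auto simp: fraction_rel_def)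

lemma carrier_fraction_field:
  "carrier (fraction_field R) = {frac a b | a b. a \<in> carrier R \<and> b \<in> carrier R - {\<zero>}}"
  by (auto simp: fraction_field_def quotient_def)

lemma fraction_fieldE:
  assumes "X \<in> carrier (fraction_field R)"
  obtains a b where "a \<in> carrier R" "b \<in> carrier R - {\<zero>}" "X = frac a b"
  using assms by (auto simp: carrier_fraction_field)

lemma frac_mult:
  assumes "a \<in> carrier R" "b \<in> carrier R - {\<zero>}" "c \<in> carrier R" "d \<in> carrier R - {\<zero>}"
  shows "frac a b \<otimes>\<^bsub>fraction_field R\<^esub> frac c d = frac (a \<otimes> c) (b \<otimes> d)"
proof -
  have "frac (a' \<otimes> c') (b' \<otimes> d') = frac (a \<otimes> c) (b \<otimes> d)"
    if "(a', b') \<in> frac a b" "(c', d') \<in> frac c d" for a' b' c' d'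
  proof -
    have *: "a' \<in> carrier R" "b' \<in> carrier R - {\<zero>}" "c' \<in> carrier R" "d' \<in> carrier R - {\<zero>}"
      "a \<otimes> b' = a' \<otimes> b" "c \<otimes> d' = c' \<otimes> d"
      using that by (auto simp: fraction_rel_def)
    have "(a' \<otimes> c') \<otimes> (b \<otimes> d) = (a' \<otimes> b) \<otimes> (c' \<otimes> d)" using assms * by (simp add: m_ac)
    also have "\<dots> = (a \<otimes> c) \<otimes> (b' \<otimes> d')" using assms * by (simp add: m_ac flip: *(5,6))
    finally show ?thesis using assms * by (subst frac_eq_iff) (auto simp: integral_iff)
  qed
  moreover have "(a, b) \<in> frac a b" "(c, d) \<in> frac c d"
    using assms by (auto simp: fraction_rel_def)
  ultimately show ?thesis
    unfolding fraction_field_def monoid.simps ring.simps by fastforce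
qed

lemma frac_add:
  assumes "a \<in> carrier R" "b \<in> carrier R - {\<zero>}" "c \<in> carrier R" "d \<in> carrier R - {\<zero>}"
  shows "frac a b \<oplus>\<^bsub>fraction_field R\<^esub> frac c d = frac (a \<otimes> d \<oplus> c \<otimes> b) (b \<otimes> d)"
proof -
  have "frac (a' \<otimes> d' \<oplus> c' \<otimes> b') (b' \<otimes> d') = frac (a \<otimes> d \<oplus> c \<otimes> b) (b \<otimes> d)"
    if "(a', b') \<in> frac a b" "(c', d') \<in> frac c d" for a' b' c' d'
  proof -
    have *: "a' \<in> carrier R" "b' \<in> carrier R - {\<zero>}" "c' \<in> carrier R" "d' \<in> carrier R - {\<zero>}"
      "a \<otimes> b' = a' \<otimes> b" "c \<otimes> d' = c' \<otimes> d"
      using that by (auto simp: fraction_rel_def)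
    have "(a' \<otimes> d' \<oplus> c' \<otimes> b') \<otimes> (b \<otimes> d) = (a' \<otimes> b) \<otimes> (d' \<otimes> d) \<oplus> (c' \<otimes> d) \<otimes> (b' \<otimes> b)"
      using assms *(1-4) by (simp add: m_ac l_distr r_distr)
    also have "\<dots> = (a \<otimes> b') \<otimes> (d' \<otimes> d) \<oplus> (c \<otimes> d') \<otimes> (b' \<otimes> b)" by (simp add: *)
    also have "\<dots> = (a \<otimes> d \<oplus> c \<otimes> b) \<otimes> (b' \<otimes> d')"
      using assms *(1-4) by (simp add: m_ac l_distr r_distr)
    finally show ?thesis using assms * by (subst frac_eq_iff) (auto simp: integral_iff)
  qed
  moreover have "(a, b) \<in> frac a b" "(c, d) \<in> frac c d"
    using assms by (auto simp: fraction_rel_def)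
  ultimately show ?thesis
    unfolding fraction_field_def monoid.simps ring.simps by fastforce
qed

lemma fraction_field_one: "\<one>\<^bsub>fraction_field R\<^esub> = frac \<one> \<one>"
  and fraction_field_zero: "\<zero>\<^bsub>fraction_field R\<^esub> = frac \<zero> \<one>"
  by (simp_all add: fraction_field_def)

lemma frac_closed:
  "\<lbrakk>a \<in> carrier R; b \<in> carrier R - {\<zero>}\<rbrakk> \<Longrightarrow> frac a b \<in> carrier (fraction_field R)"
  by (auto simp: carrier_fraction_field)

lemma fraction_field_is_field: "field (fraction_field R)"
proof -
  let ?K = "fraction_field R"
  note ops = frac_mult frac_add fraction_field_one fraction_field_zero frac_eq_iff frac_closed integral_iff
  have "abelian_group ?K"
  proof (rule abelian_groupI)
    fix x assume "x \<in> carrier ?K"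
    then obtain a b where x: "a \<in> carrier R" "b \<in> carrier R - {\<zero>}" "x = frac a b"
      by (rule fraction_fieldE)
    show "\<exists>y\<in>carrier ?K. y \<oplus>\<^bsub>?K\<^esub> x = \<zero>\<^bsub>?K\<^esub>"
      by (rule bexI[of _ "frac (\<ominus> a) b"]) (use x in \<open>auto simp: ops l_minus l_neg\<close>)
    show "\<zero>\<^bsub>?K\<^esub> \<oplus>\<^bsub>?K\<^esub> x = x" using x by (auto simp: ops)
    fix y assume "y \<in> carrier ?K"
    then obtain c d where y: "c \<in> carrier R" "d \<in> carrier R - {\<zero>}" "y = frac c d"
      by (rule fraction_fieldE)
    show "x \<oplus>\<^bsub>?K\<^esub> y \<in> carrier ?K" using x y by (auto simp: ops)
    show "x \<oplus>\<^bsub>?K\<^esub> y = y \<oplus>\<^bsub>?K\<^esub> x" using x y by (auto simp: ops m_ac a_ac)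
    fix z assume "z \<in> carrier ?K"
    then obtain e f where z: "e \<in> carrier R" "f \<in> carrier R - {\<zero>}" "z = frac e f"
      by (rule fraction_fieldE)
    show "x \<oplus>\<^bsub>?K\<^esub> y \<oplus>\<^bsub>?K\<^esub> z = x \<oplus>\<^bsub>?K\<^esub> (y \<oplus>\<^bsub>?K\<^esub> z)"
      using x y z by (auto simp: ops m_ac a_ac l_distr r_distr)
  qed (auto simp: ops)
  moreover have "Group.comm_monoid ?K"
  proof (rule comm_monoidI)
    fix x assume "x \<in> carrier ?K"
    then obtain a b where x: "a \<in> carrier R" "b \<in> carrier R - {\<zero>}" "x = frac a b"
      by (rule fraction_fieldE)
    show "\<one>\<^bsub>?K\<^esub> \<otimes>\<^bsub>?K\<^esub> x = x" using x by (auto simp: ops)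
    fix y assume "y \<in> carrier ?K"
    then obtain c d where y: "c \<in> carrier R" "d \<in> carrier R - {\<zero>}" "y = frac c d"
      by (rule fraction_fieldE)
    show "x \<otimes>\<^bsub>?K\<^esub> y \<in> carrier ?K" using x y by (auto simp: ops)
    show "x \<otimes>\<^bsub>?K\<^esub> y = y \<otimes>\<^bsub>?K\<^esub> x" using x y by (auto simp: ops m_ac)
    fix z assume "z \<in> carrier ?K"
    then obtain e f where z: "e \<in> carrier R" "f \<in> carrier R - {\<zero>}" "z = frac e f"
      by (rule fraction_fieldE)
    show "x \<otimes>\<^bsub>?K\<^esub> y \<otimes>\<^bsub>?K\<^esub> z = x \<otimes>\<^bsub>?K\<^esub> (y \<otimes>\<^bsub>?K\<^esub> z)"
      using x y z by (auto simp: ops m_ac)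
  qed (auto simp: ops)
  ultimately have K: "cring ?K"
  proof (rule cringI)
    fix x y z assume "x \<in> carrier ?K" "y \<in> carrier ?K" "z \<in> carrier ?K"
    then obtain a b c d e f where "a \<in> carrier R" "b \<in> carrier R - {\<zero>}" "x = frac a b"
      "c \<in> carrier R" "d \<in> carrier R - {\<zero>}" "y = frac c d"
      "e \<in> carrier R" "f \<in> carrier R - {\<zero>}" "z = frac e f"
      by (metis fraction_fieldE)
    then show "(x \<oplus>\<^bsub>?K\<^esub> y) \<otimes>\<^bsub>?K\<^esub> z = x \<otimes>\<^bsub>?K\<^esub> z \<oplus>\<^bsub>?K\<^esub> y \<otimes>\<^bsub>?K\<^esub> z"
      by (auto simp: ops m_ac a_ac l_distr r_distr)
  qed
  show ?thesis
  proof (rule cring.cring_fieldI2[OF K])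
    show "\<zero>\<^bsub>?K\<^esub> \<noteq> \<one>\<^bsub>?K\<^esub>" by (auto simp: ops)
    fix x assume "x \<in> carrier ?K" and "x \<noteq> \<zero>\<^bsub>?K\<^esub>"
    obtain a b where x: "a \<in> carrier R" "b \<in> carrier R - {\<zero>}" "x = frac a b"
      using \<open>x \<in> carrier ?K\<close> by (rule fraction_fieldE)
    have "a \<noteq> \<zero>" using \<open>x \<noteq> \<zero>\<^bsub>?K\<^esub>\<close> x by (simp add: ops)
    show "\<exists>y\<in>carrier ?K. x \<otimes>\<^bsub>?K\<^esub> y = \<one>\<^bsub>?K\<^esub>"
      by (rule bexI[of _ "frac b a"]) (use x \<open>a \<noteq> \<zero>\<close> in \<open>auto simp: ops m_ac\<close>)
  qed
qed

lemma frac_one_ring_hom: "(\<lambda>a. frac a \<one>) \<in> ring_hom R (fraction_field R)"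
  by (rule ring_hom_memI)
     (auto simp: frac_mult frac_add fraction_field_one frac_closed)

end

context
  fixes B :: "'b ring" and P
  assumes P: "primeideal P B"
begin

interpretation primeideal P B by (rule P)
interpretation Q: domain "B Quot P" by (rule quotient_is_domain)

lemma residue_field_is_field: "field (residue_field B P)"
  unfolding residue_field_def by (rule fraction_field_is_field[OF Q.domain_axioms])

lemma residue_map_ring_hom: "residue_map B P \<in> ring_hom B (residue_field B P)"
proof -
  have "(\<lambda>a. fraction_rel (B Quot P) `` {(a, \<one>\<^bsub>B Quot P\<^esub>)}) \<circ> (+>\<^bsub>B\<^esub>) P \<in> ring_hom B (residue_field B P)"
    unfolding residue_field_def by (rule ring_hom_trans[OF rcos_ring_hom frac_one_ring_hom[OF Q.domain_axioms]])
  then show ?thesis by (simp add: residue_map_def[abs_def] comp_def)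
qed

lemma residue_map_eq_zero_iff:
  assumes "b \<in> carrier B"
  shows "residue_map B P b = \<zero>\<^bsub>residue_field B P\<^esub> \<longleftrightarrow> b \<in> P"
proof -
  have "P +>\<^bsub>B\<^esub> b \<in> carrier (B Quot P)" using assms by (auto simp: FactRing_def A_RCOSETS_def')
  then have "residue_map B P b = \<zero>\<^bsub>residue_field B P\<^esub> \<longleftrightarrow> P +>\<^bsub>B\<^esub> b = \<zero>\<^bsub>B Quot P\<^esub>"
    by (simp add: residue_map_def residue_field_def fraction_field_zero[OF Q.domain_axioms] frac_eq_iff[OF Q.domain_axioms])
  also have "\<dots> \<longleftrightarrow> b \<in> P"
    using assms by (auto simp: FactRing_def a_rcos_const intro: rcos_const_imp_mem)
  finally show ?thesis .
qed

text \<open>A fraction of residue classes is determined by a list of two representatives. So the residue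
  field embeds into the type over which flatness of a \<open>B\<close>-module quantifies.\<close>

lemma residue_field_inj_list: "\<exists>\<iota> :: _ \<Rightarrow> 'b list. inj_on \<iota> (carrier (residue_field B P))"
proof -
  define f :: "'b list \<Rightarrow> ('b set \<times> 'b set) set"
    where "f l = fraction_rel (B Quot P) `` {(P +>\<^bsub>B\<^esub> hd l, P +>\<^bsub>B\<^esub> last l)}" for l
  have "carrier (residue_field B P) \<subseteq> range f"
  proof
    fix X assume "X \<in> carrier (residue_field B P)"
    then obtain u v where "u \<in> carrier (B Quot P)" "v \<in> carrier (B Quot P)"
      and X: "X = fraction_rel (B Quot P) `` {(u, v)}"
      unfolding residue_field_def by (blast elim: fraction_fieldE[OF Q.domain_axioms])
    then obtain a b where "u = P +>\<^bsub>B\<^esub> a" "v = P +>\<^bsub>B\<^esub> b"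
      by (auto simp: FactRing_def A_RCOSETS_def')
    with X have "X = f [a, b]" by (simp add: f_def)
    then show "X \<in> range f" by blast
  qed
  then show ?thesis by (meson inj_on_inv_into)
qed

end

section \<open>Scalars and additive relations of tensor products\<close>

lemma module_homs_iff:
  "f \<in> module_homs R M N \<longleftrightarrow>
     (\<forall>x\<in>carrier M. f x \<in> carrier N) \<and>
     (\<forall>x\<in>carrier M. \<forall>y\<in>carrier M. f (x \<oplus>\<^bsub>M\<^esub> y) = f x \<oplus>\<^bsub>N\<^esub> f y) \<and>
     (\<forall>r\<in>carrier R. \<forall>x\<in>carrier M. f (r \<odot>\<^bsub>M\<^esub> x) = r \<odot>\<^bsub>N\<^esub> f x)"
  by (auto simp: module_homs_def hom_def additive_group_def Pi_def)

lemma module_homs_comp: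
  "\<lbrakk>f \<in> module_homs R L M; g \<in> module_homs R M N\<rbrakk> \<Longrightarrow> g \<circ> f \<in> module_homs R L N"
  by (simp add: module_homs_iff)

lemma additive_group_group:
  assumes "abelian_group M"
  shows "group (additive_group M)"
proof -
  interpret abelian_group M by fact
  show ?thesis
    by (rule groupI) (auto simp: additive_group_def a_assoc intro: add.l_inv_ex)
qed

lemma module_homs_group_hom:
  assumes "module R M" and "module R N" and "f \<in> module_homs R M N"
  shows "group_hom (additive_group M) (additive_group N) f"
proof -
  interpret M: module R M by fact
  interpret N: module R N by fact
  show ?thesis
    using assms(3) additive_group_group[OF M.abelian_group_axioms] additive_group_group[OF N.abelian_group_axioms]
    by (simp add: group_hom_def group_hom_axioms_def module_homs_def)
qed

lemma module_homs_zero: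
  assumes "module R M" and "module R N" and "f \<in> module_homs R M N"
  shows "f \<zero>\<^bsub>M\<^esub> = \<zero>\<^bsub>N\<^esub>"
  using group_hom.hom_one[OF module_homs_group_hom[OF assms]] by (simp add: additive_group_def)

lemma restrict_scalars_simps:
  "carrier (restrict_scalars g D) = carrier D" "add (restrict_scalars g D) = add D"
  "zero (restrict_scalars g D) = zero D" "smult (restrict_scalars g D) r x = g r \<otimes>\<^bsub>D\<^esub> x"
  by (simp_all add: restrict_scalars_def)

lemma module_restrict_scalars:
  assumes "cring R" and "cring A" and f: "f \<in> ring_hom R A"
  shows "module R (restrict_scalars f A)"
proof -
  interpret R: cring R by fact
  interpret A: cring A by fact
  have "abelian_group (restrict_scalars f A)"
    by (rule abelian_groupI) (auto simp: restrict_scalars_def A.a_ac intro: A.add.l_inv_ex)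
  then show ?thesis
    using assms(1) ring_hom_closed[OF f] ring_hom_add[OF f] ring_hom_mult[OF f] ring_hom_one[OF f]
    by (auto intro!: moduleI simp: restrict_scalars_def A.l_distr A.r_distr A.m_assoc)
qed

text \<open>The map \<open>id \<otimes> f\<close> on formal sums of pure tensors.\<close>

definition push :: "('n \<Rightarrow> 'n') \<Rightarrow> ('m \<times> 'n \<Rightarrow>\<^sub>0 int) \<Rightarrow> ('m \<times> 'n' \<Rightarrow>\<^sub>0 int)"
  where "push f = frag_extend (\<lambda>(x, y). frag_of (x, f y))"

lemma push_simps [simp]:
  "push f 0 = 0" "push f (frag_of (x, y)) = frag_of (x, f y)"
  "push f (z + w) = push f z + push f w" "push f (z - w) = push f z - push f w"
  by (simp_all add: push_def frag_extend_add frag_extend_diff)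

lemma keys_push: "Poly_Mapping.keys z \<subseteq> X \<times> Y \<Longrightarrow> f ` Y \<subseteq> Y' \<Longrightarrow> Poly_Mapping.keys (push f z) \<subseteq> X \<times> Y'"
  unfolding push_def by (rule order_trans[OF keys_frag_extend]) (auto split: if_splits dest!: subsetD)

lemma push_push: "push f (push g z) = push (f \<circ> g) z"
  using subset_UNIV by (induction z rule: frag_induction) auto

lemma push_cong: "\<lbrakk>Poly_Mapping.keys z \<subseteq> X \<times> Y; \<And>y. y \<in> Y \<Longrightarrow> f y = g y\<rbrakk> \<Longrightarrow> push f z = push g z"
  unfolding push_def by (rule frag_extend_eq) auto

lemma push_ident: "\<lbrakk>Poly_Mapping.keys z \<subseteq> X \<times> Y; \<And>y. y \<in> Y \<Longrightarrow> f y = y\<rbrakk> \<Longrightarrow> push f z = z"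
  by (induction z rule: frag_induction) auto

lemma keys_diff_subset: "\<lbrakk>Poly_Mapping.keys z \<subseteq> S; Poly_Mapping.keys w \<subseteq> S\<rbrakk> \<Longrightarrow> Poly_Mapping.keys (z - w) \<subseteq> S"
  and keys_add_subset: "\<lbrakk>Poly_Mapping.keys z \<subseteq> S; Poly_Mapping.keys w \<subseteq> S\<rbrakk> \<Longrightarrow> Poly_Mapping.keys (z + w) \<subseteq> S"
  using keys_diff[of z w] Poly_Mapping.keys_add[of z w] by auto

lemma tensor_relations_carrier:
  assumes "module R M" and "module R N"
  shows "tensor_relations R M N \<subseteq> carrier (free_Abelian_group (carrier M \<times> carrier N))"
proof -
  interpret M: module R M by fact
  interpret N: module R N by fact
  show ?thesis
    by (auto simp: tensor_relations_def dest!: subsetD[OF keys_diff] split: if_splits)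
qed

context
  fixes R :: "('r, 'a) ring_scheme" and M :: "('r, 'm) module" and N :: "('r, 'n) module"
  assumes M: "module R M" and N: "module R N"
begin

interpretation M: module R M by (rule M)
interpretation N: module R N by (rule N)
interpretation F: comm_group "free_Abelian_group (carrier M \<times> carrier N)"
  by (rule abelian_free_Abelian_group)

lemma tensor_subgroup_subgroup:
  "subgroup (tensor_subgroup R M N) (free_Abelian_group (carrier M \<times> carrier N))"
  unfolding tensor_subgroup_def
  by (rule F.generate_is_subgroup[OF tensor_relations_carrier[OF M N]])

lemma tensor_subgroup_keys: "z \<in> tensor_subgroup R M N \<Longrightarrow> Poly_Mapping.keys z \<subseteq> carrier M \<times> carrier N"
  using subgroup.subset[OF tensor_subgroup_subgroup] by fastforce

lemma tensor_subgroup_zero: "0 \<in> tensor_subgroup R M N"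
  using subgroup.one_closed[OF tensor_subgroup_subgroup] by simp

lemma tensor_subgroup_add:
  "\<lbrakk>z \<in> tensor_subgroup R M N; w \<in> tensor_subgroup R M N\<rbrakk> \<Longrightarrow> z + w \<in> tensor_subgroup R M N"
  using subgroup.m_closed[OF tensor_subgroup_subgroup] by simp

lemma tensor_subgroup_minus:
  "z \<in> tensor_subgroup R M N \<Longrightarrow> - z \<in> tensor_subgroup R M N"
  using subgroup.m_inv_closed[OF tensor_subgroup_subgroup, of z] tensor_subgroup_keys by simp

lemma tensor_subgroup_diff:
  "\<lbrakk>z \<in> tensor_subgroup R M N; w \<in> tensor_subgroup R M N\<rbrakk> \<Longrightarrow> z - w \<in> tensor_subgroup R M N"
  using tensor_subgroup_add[OF _ tensor_subgroup_minus, of z w] by simp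

lemma tensor_add_left:
  "\<lbrakk>x \<in> carrier M; x' \<in> carrier M; y \<in> carrier N\<rbrakk> \<Longrightarrow>
   frag_of (x \<oplus>\<^bsub>M\<^esub> x', y) - frag_of (x, y) - frag_of (x', y) \<in> tensor_subgroup R M N"
  unfolding tensor_subgroup_def by (rule generate.incl) (auto simp: tensor_relations_def)

lemma tensor_add_right:
  "\<lbrakk>x \<in> carrier M; y \<in> carrier N; y' \<in> carrier N\<rbrakk> \<Longrightarrow>
   frag_of (x, y \<oplus>\<^bsub>N\<^esub> y') - frag_of (x, y) - frag_of (x, y') \<in> tensor_subgroup R M N"
  unfolding tensor_subgroup_def by (rule generate.incl) (auto simp: tensor_relations_def)

lemma tensor_balanced:
  "\<lbrakk>r \<in> carrier R; x \<in> carrier M; y \<in> carrier N\<rbrakk> \<Longrightarrow>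
   frag_of (r \<odot>\<^bsub>M\<^esub> x, y) - frag_of (x, r \<odot>\<^bsub>N\<^esub> y) \<in> tensor_subgroup R M N"
  unfolding tensor_subgroup_def by (rule generate.incl) (auto simp: tensor_relations_def)

lemma tensor_zero_right:
  assumes "x \<in> carrier M"
  shows "frag_of (x, \<zero>\<^bsub>N\<^esub>) \<in> tensor_subgroup R M N"
  using tensor_subgroup_minus[OF tensor_add_right[OF assms N.zero_closed N.zero_closed]] by simp

lemma tensor_subgroup_induct:
  assumes z: "z \<in> tensor_subgroup R M N"
    and zero: "P 0" and diff: "\<And>z w. P z \<Longrightarrow> P w \<Longrightarrow> P (z - w)"
    and add_left: "\<And>x x' y. \<lbrakk>x \<in> carrier M; x' \<in> carrier M; y \<in> carrier N\<rbrakk> \<Longrightarrow>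
        P (frag_of (x \<oplus>\<^bsub>M\<^esub> x', y) - frag_of (x, y) - frag_of (x', y))"
    and add_right: "\<And>x y y'. \<lbrakk>x \<in> carrier M; y \<in> carrier N; y' \<in> carrier N\<rbrakk> \<Longrightarrow>
        P (frag_of (x, y \<oplus>\<^bsub>N\<^esub> y') - frag_of (x, y) - frag_of (x, y'))"
    and balanced: "\<And>r x y. \<lbrakk>r \<in> carrier R; x \<in> carrier M; y \<in> carrier N\<rbrakk> \<Longrightarrow>
        P (frag_of (r \<odot>\<^bsub>M\<^esub> x, y) - frag_of (x, r \<odot>\<^bsub>N\<^esub> y))"
  shows "P z"
proof -
  have rel: "P z" if "z \<in> tensor_relations R M N" for z
    using that add_left add_right balanced by (auto simp: tensor_relations_def)
  have minus: "P (- z)" if "P z" for z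
    using diff[OF zero that] by simp
  show ?thesis
    using z unfolding tensor_subgroup_def
  proof (induction rule: generate.induct)
    case (inv h)
    then show ?case using minus[OF rel[OF inv]] tensor_relations_carrier[OF M N] by fastforce
  next
    case (eng h1 h2)
    then show ?case using diff[OF eng(3) minus[OF eng(4)]] by simp
  qed (auto intro: zero rel)
qed

end

lemma push_tensor_subgroup:
  assumes M: "module R M" and N: "module R N" and N': "module R N'" and f: "f \<in> module_homs R N N'"
    and z: "z \<in> tensor_subgroup R M N"
  shows "push f z \<in> tensor_subgroup R M N'"
  using z
proof (induction rule: tensor_subgroup_induct[OF M N, consumes 1, case_names zero diff add_left add_right balanced])
  case zero
  then show ?case by (simp add: tensor_subgroup_zero[OF M N'])
next
  case (diff z w)
  then show ?case by (simp add: tensor_subgroup_diff[OF M N'])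
next
  case (add_left x x' y)
  then show ?case using f by (auto simp: module_homs_iff intro: tensor_add_left[OF M N'])
next
  case (add_right x x' y)
  then show ?case using f by (auto simp: module_homs_iff intro: tensor_add_right[OF M N'])
next
  case (balanced r x y)
  then show ?case using f by (auto simp: module_homs_iff intro: tensor_balanced[OF M N'])
qed

text \<open>The formal sums whose class in \<open>M \<otimes> N\<close> comes from \<open>M \<otimes> H\<close>.\<close>

definition tensor_image :: "('r, 'a) ring_scheme \<Rightarrow> ('r, 'm) module \<Rightarrow> ('r, 'n) module \<Rightarrow> 'n set \<Rightarrow> ('m \<times> 'n \<Rightarrow>\<^sub>0 int) set"
  where "tensor_image R M N H =
    {z. Poly_Mapping.keys z \<subseteq> carrier M \<times> carrier N \<and>
        (\<exists>w. Poly_Mapping.keys w \<subseteq> carrier M \<times> H \<and> z - w \<in> tensor_subgroup R M N)}"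

context
  fixes R :: "('r, 'a) ring_scheme" and M :: "('r, 'm) module" and N :: "('r, 'n) module" and H :: "'n set"
  assumes M: "module R M" and N: "module R N"
begin

lemma tensor_image_of_subgroup: "z \<in> tensor_subgroup R M N \<Longrightarrow> z \<in> tensor_image R M N H"
  using tensor_subgroup_keys[OF M N] by (auto simp: tensor_image_def intro!: exI[of _ 0])

lemma tensor_image_of_keys:
  "\<lbrakk>Poly_Mapping.keys z \<subseteq> carrier M \<times> H; H \<subseteq> carrier N\<rbrakk> \<Longrightarrow> z \<in> tensor_image R M N H"
  using tensor_subgroup_zero[OF M N] by (auto simp: tensor_image_def intro!: exI[of _ z])

lemma tensor_image_diff:
  assumes "z \<in> tensor_image R M N H" "w \<in> tensor_image R M N H"
  shows "z - w \<in> tensor_image R M N H"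
proof -
  have keys: "Poly_Mapping.keys z \<subseteq> carrier M \<times> carrier N" "Poly_Mapping.keys w \<subseteq> carrier M \<times> carrier N"
    using assms unfolding tensor_image_def by simp_all
  obtain u v where uv: "Poly_Mapping.keys u \<subseteq> carrier M \<times> H" "z - u \<in> tensor_subgroup R M N"
    "Poly_Mapping.keys v \<subseteq> carrier M \<times> H" "w - v \<in> tensor_subgroup R M N"
    using assms unfolding tensor_image_def by blast
  have "(z - w) - (u - v) \<in> tensor_subgroup R M N"
    using tensor_subgroup_diff[OF M N uv(2,4)] by (simp add: algebra_simps)
  then show ?thesis
    unfolding tensor_image_def using keys_diff_subset[OF keys] keys_diff_subset[OF uv(1,3)] by blast
qed

lemma tensor_image_add:
  assumes "z \<in> tensor_image R M N H" "w \<in> tensor_image R M N H"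
  shows "z + w \<in> tensor_image R M N H"
  using tensor_image_diff[OF assms(1) tensor_image_diff[OF tensor_image_of_subgroup[OF tensor_subgroup_zero[OF M N]] assms(2)]]
  by simp

end

lemma tensor_image_mono: "H \<subseteq> H' \<Longrightarrow> z \<in> tensor_image R M N H \<Longrightarrow> z \<in> tensor_image R M N H'"
proof -
  assume HH': "H \<subseteq> H'" and "z \<in> tensor_image R M N H"
  then obtain w where zw: "Poly_Mapping.keys z \<subseteq> carrier M \<times> carrier N" "z - w \<in> tensor_subgroup R M N"
    and w: "Poly_Mapping.keys w \<subseteq> carrier M \<times> H"
    unfolding tensor_image_def by blast
  have "Poly_Mapping.keys w \<subseteq> carrier M \<times> H'"
    by (rule order_trans[OF w Sigma_mono]) (use HH' in auto)
  with zw show ?thesis unfolding tensor_image_def by blast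
qed

lemma tensor_image_push:
  assumes M: "module R M" and N: "module R N" and N': "module R N'" and f: "f \<in> module_homs R N N'"
    and z: "z \<in> tensor_image R M N H" and H: "f ` H \<subseteq> H'"
  shows "push f z \<in> tensor_image R M N' H'"
proof -
  obtain w where zk: "Poly_Mapping.keys z \<subseteq> carrier M \<times> carrier N"
    and w: "Poly_Mapping.keys w \<subseteq> carrier M \<times> H" and "z - w \<in> tensor_subgroup R M N"
    using z by (auto simp: tensor_image_def)
  then have "push f z - push f w \<in> tensor_subgroup R M N'"
    using push_tensor_subgroup[OF M N N' f] by (metis push_simps(4))
  moreover have sub: "f ` carrier N \<subseteq> carrier N'" using f by (auto simp: module_homs_iff)
  ultimately show ?thesis
    using keys_push[OF w H] keys_push[OF zk sub] unfolding tensor_image_def by blast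
qed

text \<open>The additive map on formal sums with values \<open>f\<close> on the generators in \<open>S\<close>, which exists by the
  universal property of free abelian groups.\<close>

definition frag_eval :: "('a, 'm) ring_scheme \<Rightarrow> 'k set \<Rightarrow> ('k \<Rightarrow> 'a) \<Rightarrow> ('k \<Rightarrow>\<^sub>0 int) \<Rightarrow> 'a"
  where "frag_eval A S f =
    (SOME h. h \<in> hom (free_Abelian_group S) (add_monoid A) \<and> (\<forall>x\<in>S. h (frag_of x) = f x))"

context
  fixes A :: "('a, 'm) ring_scheme" (structure) and S :: "'k set" and f :: "'k \<Rightarrow> 'a"
  assumes A: "ring A" and f: "f ` S \<subseteq> carrier A"
begin

interpretation A: ring A by (rule A)

lemma frag_eval_props:
  "frag_eval A S f \<in> hom (free_Abelian_group S) (add_monoid A)" "x \<in> S \<Longrightarrow> frag_eval A S f (frag_of x) = f x"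
proof -
  obtain h where h: "h \<in> hom (free_Abelian_group S) (add_monoid A)" "\<And>x. x \<in> S \<Longrightarrow> h (frag_of x) = f x"
    by (rule comm_group.free_Abelian_group_universal[OF A.a_comm_group, of f S]) (simp add: f, blast)
  have "frag_eval A S f \<in> hom (free_Abelian_group S) (add_monoid A) \<and> (\<forall>x\<in>S. frag_eval A S f (frag_of x) = f x)"
    unfolding frag_eval_def by (rule someI[of _ h]) (simp add: h)
  then show "frag_eval A S f \<in> hom (free_Abelian_group S) (add_monoid A)" "x \<in> S \<Longrightarrow> frag_eval A S f (frag_of x) = f x"
    by simp_all
qed

interpretation E: group_hom "free_Abelian_group S" "add_monoid A" "frag_eval A S f"
  using frag_eval_props(1) A.a_group by (simp add: group_hom_def group_hom_axioms_def)

lemma frag_eval_closed: "Poly_Mapping.keys z \<subseteq> S \<Longrightarrow> frag_eval A S f z \<in> carrier A"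
  using E.hom_closed[of z] by simp

lemma frag_eval_zero: "frag_eval A S f 0 = \<zero>"
  using E.hom_one by simp

lemma frag_eval_diff:
  assumes z: "Poly_Mapping.keys z \<subseteq> S" and w: "Poly_Mapping.keys w \<subseteq> S"
  shows "frag_eval A S f (z - w) = frag_eval A S f z \<ominus> frag_eval A S f w"
proof -
  have "frag_eval A S f (- w) = \<ominus> frag_eval A S f w"
    using E.hom_inv[of w] w unfolding a_inv_def by simp
  then show ?thesis using E.hom_mult[of z "- w"] z w unfolding a_minus_def by simp
qed

end

text \<open>The universal property of the tensor product, for maps into the additive group of a ring.\<close>

lemma frag_eval_tensor_subgroup:
  assumes M: "module R M" and N: "module R N" and A: "ring A"
    and f: "f ` (carrier M \<times> carrier N) \<subseteq> carrier A"
    and add_left: "\<And>x x' y. \<lbrakk>x \<in> carrier M; x' \<in> carrier M; y \<in> carrier N\<rbrakk> \<Longrightarrow>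
        f (x \<oplus>\<^bsub>M\<^esub> x', y) = f (x, y) \<oplus>\<^bsub>A\<^esub> f (x', y)"
    and add_right: "\<And>x y y'. \<lbrakk>x \<in> carrier M; y \<in> carrier N; y' \<in> carrier N\<rbrakk> \<Longrightarrow>
        f (x, y \<oplus>\<^bsub>N\<^esub> y') = f (x, y) \<oplus>\<^bsub>A\<^esub> f (x, y')"
    and balanced: "\<And>r x y. \<lbrakk>r \<in> carrier R; x \<in> carrier M; y \<in> carrier N\<rbrakk> \<Longrightarrow>
        f (r \<odot>\<^bsub>M\<^esub> x, y) = f (x, r \<odot>\<^bsub>N\<^esub> y)"
    and z: "z \<in> tensor_subgroup R M N"
  shows "frag_eval A (carrier M \<times> carrier N) f z = \<zero>\<^bsub>A\<^esub>"
proof -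
  interpret A: ring A by fact
  interpret M: module R M by fact
  interpret N: module R N by fact
  let ?S = "carrier M \<times> carrier N"
  let ?ev = "frag_eval A ?S f"
  note diff = frag_eval_diff[OF A f] and of = frag_eval_props(2)[OF A f]
  have fc: "f (x, y) \<in> carrier A" if "x \<in> carrier M" "y \<in> carrier N" for x y using f that by blast
  have "z \<in> carrier (free_Abelian_group ?S) \<and> ?ev z = \<zero>\<^bsub>A\<^esub>"
    using z
  proof (induction rule: tensor_subgroup_induct[OF M N, consumes 1, case_names zero diff add_left add_right balanced])
    case zero
    then show ?case by (simp add: frag_eval_zero[OF A f])
  next
    case (diff z w)
    then show ?case using frag_eval_diff[OF A f, of z w] keys_diff_subset[of z ?S w]
      by (simp add: a_minus_def)
  next
    case (add_left x x' y)
    then have k: "Poly_Mapping.keys (frag_of (x \<oplus>\<^bsub>M\<^esub> x', y) - frag_of (x, y)) \<subseteq> ?S"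
      by (intro keys_diff_subset) auto
    then have "Poly_Mapping.keys (frag_of (x \<oplus>\<^bsub>M\<^esub> x', y) - frag_of (x, y) - frag_of (x', y)) \<subseteq> ?S"
      using add_left by (intro keys_diff_subset) auto
    moreover have "f (x, y) \<oplus>\<^bsub>A\<^esub> f (x', y) \<ominus>\<^bsub>A\<^esub> f (x, y) \<ominus>\<^bsub>A\<^esub> f (x', y) = \<zero>\<^bsub>A\<^esub>"
      using fc add_left by (simp add: a_minus_def A.a_ac A.r_neg A.r_neg1 A.r_neg2)
    ultimately show ?case
      using diff[OF k, of "frag_of (x', y)"] diff[of "frag_of (x \<oplus>\<^bsub>M\<^esub> x', y)" "frag_of (x, y)"] add_left
      by (simp add: of assms(5))
  next
    case (add_right x y y')
    then have k: "Poly_Mapping.keys (frag_of (x, y \<oplus>\<^bsub>N\<^esub> y') - frag_of (x, y)) \<subseteq> ?S"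
      by (intro keys_diff_subset) auto
    then have "Poly_Mapping.keys (frag_of (x, y \<oplus>\<^bsub>N\<^esub> y') - frag_of (x, y) - frag_of (x, y')) \<subseteq> ?S"
      using add_right by (intro keys_diff_subset) auto
    moreover have "f (x, y) \<oplus>\<^bsub>A\<^esub> f (x, y') \<ominus>\<^bsub>A\<^esub> f (x, y) \<ominus>\<^bsub>A\<^esub> f (x, y') = \<zero>\<^bsub>A\<^esub>"
      using fc add_right by (simp add: a_minus_def A.a_ac A.r_neg A.r_neg1 A.r_neg2)
    ultimately show ?case
      using diff[OF k, of "frag_of (x, y')"] diff[of "frag_of (x, y \<oplus>\<^bsub>N\<^esub> y')" "frag_of (x, y)"] add_right
      by (simp add: of assms(6))
  next
    case (balanced r x y)
    then have "Poly_Mapping.keys (frag_of (r \<odot>\<^bsub>M\<^esub> x, y) - frag_of (x, r \<odot>\<^bsub>N\<^esub> y)) \<subseteq> ?S"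
      by (intro keys_diff_subset) auto
    then show ?case
      using diff[of "frag_of (r \<odot>\<^bsub>M\<^esub> x, y)" "frag_of (x, r \<odot>\<^bsub>N\<^esub> y)"] balanced fc
      by (simp add: of assms(7) A.r_right_minus_eq)
  qed
  then show ?thesis ..
qed

section \<open>Flatness and faithful flatness on elements\<close>

abbreviation tensor_coset
  where "tensor_coset R M N z \<equiv> tensor_subgroup R M N #>\<^bsub>free_Abelian_group (carrier M \<times> carrier N)\<^esub> z"

context
  fixes R :: "('r, 'a) ring_scheme" and M :: "('r, 'm) module" and N :: "('r, 'n) module"
  assumes M: "module R M" and N: "module R N"
begin

interpretation F: comm_group "free_Abelian_group (carrier M \<times> carrier N)"
  by (rule abelian_free_Abelian_group)

interpretation S: normal "tensor_subgroup R M N" "free_Abelian_group (carrier M \<times> carrier N)"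
  by (rule F.subgroup_imp_normal[OF tensor_subgroup_subgroup[OF M N]])

lemma tensor_coset_eq_iff:
  assumes "Poly_Mapping.keys z \<subseteq> carrier M \<times> carrier N" "Poly_Mapping.keys w \<subseteq> carrier M \<times> carrier N"
  shows "tensor_coset R M N z = tensor_coset R M N w \<longleftrightarrow> z - w \<in> tensor_subgroup R M N"
proof -
  have "z \<in> tensor_coset R M N w \<longleftrightarrow> z - w \<in> tensor_subgroup R M N"
    using S.rcos_module[OF group_free_Abelian_group, of w z] assms by simp
  moreover have "z \<in> tensor_coset R M N w" if "tensor_coset R M N z = tensor_coset R M N w"
    using F.rcos_self[OF _ S.subgroup_axioms, of z] that assms by simp
  moreover have "tensor_coset R M N z = tensor_coset R M N w" if "z \<in> tensor_coset R M N w"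
    using F.repr_independence[OF that _ S.subgroup_axioms] assms by simp
  ultimately show ?thesis by blast
qed

end

context
  fixes R :: "('r, 'a) ring_scheme" and M :: "('r, 'm) module" and N :: "('r, 'n) module"
  assumes M: "module R M" and N: "module R N"
begin

interpretation F: comm_group "free_Abelian_group (carrier M \<times> carrier N)"
  by (rule abelian_free_Abelian_group)

interpretation S: normal "tensor_subgroup R M N" "free_Abelian_group (carrier M \<times> carrier N)"
  by (rule F.subgroup_imp_normal[OF tensor_subgroup_subgroup[OF M N]])

lemma tensor_group_group: "group (tensor_group R M N)"
  unfolding tensor_group_def by (rule S.factorgroup_is_group)

lemma tensor_group_carrier:
  "carrier (tensor_group R M N) = {tensor_coset R M N z | z. Poly_Mapping.keys z \<subseteq> carrier M \<times> carrier N}"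
  by (auto simp: tensor_group_def FactGroup_def RCOSETS_def)

lemma tensor_group_one: "\<one>\<^bsub>tensor_group R M N\<^esub> = tensor_coset R M N 0"
  using F.coset_mult_one[OF S.subset] by (simp add: tensor_group_def FactGroup_def)

lemma tensor_group_mult:
  assumes "Poly_Mapping.keys z \<subseteq> carrier M \<times> carrier N" "Poly_Mapping.keys w \<subseteq> carrier M \<times> carrier N"
  shows "tensor_coset R M N z \<otimes>\<^bsub>tensor_group R M N\<^esub> tensor_coset R M N w = tensor_coset R M N (z + w)"
  using S.rcos_sum[of z w] assms by (simp add: tensor_group_def FactGroup_def)

lemma tensor_map_coset:
  assumes N': "module R N'" and f: "f \<in> module_homs R N N'"
    and z: "Poly_Mapping.keys z \<subseteq> carrier M \<times> carrier N"
  shows "tensor_map R M N' f (tensor_coset R M N z) = tensor_coset R M N' (push f z)"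
proof -
  have sub: "f ` carrier N \<subseteq> carrier N'" using f by (auto simp: module_homs_iff)
  have "tensor_coset R M N' (push f w) = tensor_coset R M N' (push f z)"
    if w: "w \<in> tensor_coset R M N z" for w
  proof -
    have wk: "Poly_Mapping.keys w \<subseteq> carrier M \<times> carrier N"
      using S.elemrcos_carrier[OF group_free_Abelian_group _ w] z by simp
    have "w - z \<in> tensor_subgroup R M N"
      using S.rcos_module_imp[OF group_free_Abelian_group _ w] z by simp
    then have "push f (w - z) \<in> tensor_subgroup R M N'"
      by (rule push_tensor_subgroup[OF M N N' f])
    then show ?thesis
      using tensor_coset_eq_iff[OF M N' keys_push[OF wk sub] keys_push[OF z sub]] by simp
  qed
  moreover have "z \<in> tensor_coset R M N z"
    using F.rcos_self[OF _ S.subgroup_axioms, of z] z by simp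
  ultimately show ?thesis
    unfolding tensor_map_def push_def[symmetric] by blast
qed

end

lemma tensor_map_group_hom:
  assumes M: "module R M" and N: "module R N" and N': "module R N'" and f: "f \<in> module_homs R N N'"
  shows "group_hom (tensor_group R M N) (tensor_group R M N') (tensor_map R M N' f)"
proof -
  have sub: "f ` carrier N \<subseteq> carrier N'" using f by (auto simp: module_homs_iff)
  note keys = keys_push[OF _ sub, of _ "carrier M"]
  have "tensor_map R M N' f \<in> hom (tensor_group R M N) (tensor_group R M N')"
  proof (rule homI)
    fix X assume "X \<in> carrier (tensor_group R M N)"
    then obtain z where z: "X = tensor_coset R M N z" "Poly_Mapping.keys z \<subseteq> carrier M \<times> carrier N"
      by (auto simp: tensor_group_carrier[OF M N])
    then show "tensor_map R M N' f X \<in> carrier (tensor_group R M N')"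
      using keys by (auto simp: tensor_map_coset[OF M N N' f] tensor_group_carrier[OF M N'])
    fix Y assume "Y \<in> carrier (tensor_group R M N)"
    then obtain w where w: "Y = tensor_coset R M N w" "Poly_Mapping.keys w \<subseteq> carrier M \<times> carrier N"
      by (auto simp: tensor_group_carrier[OF M N])
    show "tensor_map R M N' f (X \<otimes>\<^bsub>tensor_group R M N\<^esub> Y)
        = tensor_map R M N' f X \<otimes>\<^bsub>tensor_group R M N'\<^esub> tensor_map R M N' f Y"
      using z w keys
      by (simp add: tensor_map_coset[OF M N N' f] tensor_group_mult[OF M N] tensor_group_mult[OF M N'] keys_add_subset)
  qed
  then show ?thesis
    using tensor_group_group[OF M N] tensor_group_group[OF M N']
    by (simp add: group_hom_def group_hom_axioms_def)
qed

text \<open>Flatness quantifies over modules carried by lists over \<open>R\<close>. A module on another type is brought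
  there by an injection of its carrier. The fields for multiplication, which module records inherit
  from ring records, are filled with a default value.\<close>

definition module_copy :: "('m \<Rightarrow> 'n) \<Rightarrow> ('r, 'm) module \<Rightarrow> ('r, 'n) module"
  where "module_copy \<iota> M =
    \<lparr>carrier = \<iota> ` carrier M, monoid.mult = (\<lambda>_ _. \<iota> \<zero>\<^bsub>M\<^esub>), one = \<iota> \<zero>\<^bsub>M\<^esub>, ring.zero = \<iota> \<zero>\<^bsub>M\<^esub>,
     add = (\<lambda>x y. \<iota> (inv_into (carrier M) \<iota> x \<oplus>\<^bsub>M\<^esub> inv_into (carrier M) \<iota> y)),
     smult = (\<lambda>r x. \<iota> (r \<odot>\<^bsub>M\<^esub> inv_into (carrier M) \<iota> x))\<rparr>"

context
  fixes R :: "('r, 'a) ring_scheme" and M :: "('r, 'm) module" and \<iota> :: "'m \<Rightarrow> 'n"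
  assumes M: "module R M" and inj: "inj_on \<iota> (carrier M)"
begin

interpretation module R M by (rule M)

lemma module_copy_module: "module R (module_copy \<iota> M)"
proof (rule moduleI)
  show "abelian_group (module_copy \<iota> M)"
  proof (rule abelian_groupI)
    fix x assume "x \<in> carrier (module_copy \<iota> M)"
    then obtain a where "a \<in> carrier M" "x = \<iota> a" by (auto simp: module_copy_def)
    then show "\<exists>y\<in>carrier (module_copy \<iota> M). y \<oplus>\<^bsub>module_copy \<iota> M\<^esub> x = \<zero>\<^bsub>module_copy \<iota> M\<^esub>"
      using M.l_neg inj by (auto simp: module_copy_def intro!: bexI[of _ "\<ominus>\<^bsub>M\<^esub> a"])
  qed (use inj in \<open>auto simp: module_copy_def M.a_ac\<close>)
qed (use inj R.is_cring in \<open>auto simp: module_copy_def smult_l_distr smult_r_distr smult_assoc1\<close>)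

lemma module_copy_hom: "\<iota> \<in> module_homs R M (module_copy \<iota> M)"
  using inj by (simp add: module_homs_iff module_copy_def)

lemma module_copy_hom_inv: "inv_into (carrier M) \<iota> \<in> module_homs R (module_copy \<iota> M) M"
  using inj by (auto simp: module_homs_iff module_copy_def)

end

lemma submodule_incl_hom:
  "H \<subseteq> carrier M \<Longrightarrow> (\<lambda>x. x) \<in> module_homs R (M\<lparr>carrier := H\<rparr>) M"
  by (auto simp: module_homs_iff)

lemma module_hom_kernel_submodule:
  assumes M: "module R M" and N: "module R N" and f: "f \<in> module_homs R M N"
  shows "submodule {x \<in> carrier M. f x = \<zero>\<^bsub>N\<^esub>} R M"
proof -
  interpret M: module R M by fact
  interpret N: module R N by fact
  show ?thesis
  proof (rule M.submoduleI)
    fix a assume a: "a \<in> {x \<in> carrier M. f x = \<zero>\<^bsub>N\<^esub>}"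
    then have "f ((\<ominus>\<^bsub>R\<^esub> \<one>\<^bsub>R\<^esub>) \<odot>\<^bsub>M\<^esub> a) = \<zero>\<^bsub>N\<^esub>" using f by (simp add: module_homs_iff)
    then show "\<ominus>\<^bsub>M\<^esub> a \<in> {x \<in> carrier M. f x = \<zero>\<^bsub>N\<^esub>}" using a by (simp add: M.smult_l_minus)
  qed (use f module_homs_zero[OF M N f] in \<open>auto simp: module_homs_iff\<close>)
qed

lemma exact_seq_three_iff:
  "exact_seq ([G3, G2, G1], [g, f]) \<longleftrightarrow>
     group_hom G1 G2 f \<and> group_hom G2 G3 g \<and> kernel G2 G3 g = f ` carrier G1"
  by (auto simp: group_hom_def group_hom_axioms_def)

text \<open>Flatness for \<open>K \<rightarrow> N2 \<rightarrow> N3\<close>, where \<open>K\<close> is the kernel of \<open>g\<close>: the class of \<open>z\<close> vanishes in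
  \<open>M \<otimes> N3\<close>, hence comes from \<open>M \<otimes> K\<close>.\<close>

lemma flat_tensor_kernel_list:
  fixes R :: "'r ring" and N2 N3 :: "('r, 'r list) module"
  assumes flat: "flat_module R M" and M: "module R M" and N2: "module R N2" and N3: "module R N3"
    and g: "g \<in> module_homs R N2 N3"
    and z: "Poly_Mapping.keys z \<subseteq> carrier M \<times> carrier N2" and gz: "push g z \<in> tensor_subgroup R M N3"
  shows "z \<in> tensor_image R M N2 {x \<in> carrier N2. g x = \<zero>\<^bsub>N3\<^esub>}"
proof -
  let ?K = "{x \<in> carrier N2. g x = \<zero>\<^bsub>N3\<^esub>}"
  let ?N1 = "N2\<lparr>carrier := ?K\<rparr>"
  have N1: "module R ?N1"
    by (rule submodule.submodule_is_module[OF module_hom_kernel_submodule[OF N2 N3 g] N2])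
  have incl: "(\<lambda>x. x) \<in> module_homs R ?N1 N2" by (rule submodule_incl_hom) auto
  have "exact_seq ([additive_group N3, additive_group N2, additive_group ?N1], [g, \<lambda>x. x])"
    using module_homs_group_hom[OF N1 N2 incl] module_homs_group_hom[OF N2 N3 g]
    by (auto simp: exact_seq_three_iff kernel_def additive_group_def simp del: exact_seq_cons_iff exact_seq_end_iff)
  then have "exact_seq ([tensor_group R M N3, tensor_group R M N2, tensor_group R M ?N1],
                  [tensor_map R M N3 g, tensor_map R M N2 (\<lambda>x. x)])"
    using flat incl g N1 N2 N3 unfolding flat_module_def by blast
  then have ex: "kernel (tensor_group R M N2) (tensor_group R M N3) (tensor_map R M N3 g)
      = tensor_map R M N2 (\<lambda>x. x) ` carrier (tensor_group R M ?N1)"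
    by (simp add: exact_seq_three_iff del: exact_seq_cons_iff exact_seq_end_iff)
  have "Poly_Mapping.keys (push g z) \<subseteq> carrier M \<times> carrier N3"
    using gz by (rule tensor_subgroup_keys[OF M N3])
  then have "tensor_coset R M N2 z \<in> kernel (tensor_group R M N2) (tensor_group R M N3) (tensor_map R M N3 g)"
    using z gz tensor_coset_eq_iff[OF M N3, of "push g z" 0]
    by (auto simp: kernel_def tensor_group_carrier[OF M N2] tensor_map_coset[OF M N2 N3 g] tensor_group_one[OF M N3])
  then obtain w where w: "Poly_Mapping.keys w \<subseteq> carrier M \<times> ?K"
    and "tensor_coset R M N2 z = tensor_map R M N2 (\<lambda>x. x) (tensor_coset R M ?N1 w)"
    unfolding ex by (auto simp: tensor_group_carrier[OF M N1])
  moreover have "push (\<lambda>x. x) w = w" by (rule push_ident[OF w]) simp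
  moreover have wN: "Poly_Mapping.keys w \<subseteq> carrier M \<times> carrier N2" using w by auto
  ultimately have "tensor_coset R M N2 z = tensor_coset R M N2 w"
    using tensor_map_coset[OF M N1 N2 incl, of w] w by simp
  then have "z - w \<in> tensor_subgroup R M N2"
    using tensor_coset_eq_iff[OF M N2 z wN] by simp
  then show ?thesis using z w by (auto simp: tensor_image_def)
qed

text \<open>The injections and their inverses are module homomorphisms between the modules and their copies,
  so they carry tensor relations to tensor relations and the kernel of \<open>g\<close> to that of its copy.\<close>

lemma flat_tensor_kernel:
  fixes R :: "'r ring" and N2 :: "('r, 'm2) module" and N3 :: "('r, 'm3) module"
    and \<iota>2 :: "'m2 \<Rightarrow> 'r list" and \<iota>3 :: "'m3 \<Rightarrow> 'r list"
  assumes flat: "flat_module R M" and M: "module R M" and N2: "module R N2" and N3: "module R N3"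
    and inj2: "inj_on \<iota>2 (carrier N2)" and inj3: "inj_on \<iota>3 (carrier N3)"
    and g: "g \<in> module_homs R N2 N3"
    and z: "Poly_Mapping.keys z \<subseteq> carrier M \<times> carrier N2" and gz: "push g z \<in> tensor_subgroup R M N3"
  shows "z \<in> tensor_image R M N2 {x \<in> carrier N2. g x = \<zero>\<^bsub>N3\<^esub>}"
proof -
  let ?N2 = "module_copy \<iota>2 N2" and ?N3 = "module_copy \<iota>3 N3"
  let ?inv = "inv_into (carrier N2) \<iota>2"
  define g' where "g' = \<iota>3 \<circ> (g \<circ> ?inv)"
  note C2 = module_copy_module[OF N2 inj2] and C3 = module_copy_module[OF N3 inj3]
  note \<iota>2 = module_copy_hom[OF N2 inj2] and \<iota>3 = module_copy_hom[OF N3 inj3]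
  note inv2 = module_copy_hom_inv[OF N2 inj2]
  have g': "g' \<in> module_homs R ?N2 ?N3"
    unfolding g'_def by (intro module_homs_comp[OF _ \<iota>3] module_homs_comp[OF inv2] g)
  have \<iota>z: "Poly_Mapping.keys (push \<iota>2 z) \<subseteq> carrier M \<times> carrier ?N2"
    by (rule keys_push[OF z]) (auto simp: module_copy_def)
  have "push g' (push \<iota>2 z) = push \<iota>3 (push g z)"
    unfolding push_push by (rule push_cong[OF z]) (use inj2 in \<open>auto simp: g'_def\<close>)
  then have "push g' (push \<iota>2 z) \<in> tensor_subgroup R M ?N3"
    using push_tensor_subgroup[OF M N3 C3 \<iota>3 gz] by simp
  then have "push \<iota>2 z \<in> tensor_image R M ?N2 {x \<in> carrier ?N2. g' x = \<zero>\<^bsub>?N3\<^esub>}"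
    by (rule flat_tensor_kernel_list[OF flat M C2 C3 g' \<iota>z])
  then have "push ?inv (push \<iota>2 z) \<in> tensor_image R M N2 {x \<in> carrier N2. g x = \<zero>\<^bsub>N3\<^esub>}"
  proof (rule tensor_image_push[OF M C2 N2 inv2])
    have "g x = \<zero>\<^bsub>N3\<^esub>" if "x \<in> carrier N2" "\<iota>3 (g x) = \<iota>3 \<zero>\<^bsub>N3\<^esub>" for x
      using that g inj_onD[OF inj3, of "g x" "\<zero>\<^bsub>N3\<^esub>"] abelian_monoid.zero_closed[OF abelian_group.axioms(1), OF module.axioms(2)[OF N3]]
      by (auto simp: module_homs_iff)
    then show "?inv ` {x \<in> carrier ?N2. g' x = \<zero>\<^bsub>?N3\<^esub>} \<subseteq> {x \<in> carrier N2. g x = \<zero>\<^bsub>N3\<^esub>}"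
      using inj2 by (auto simp: module_copy_def g'_def)
  qed
  moreover have "push ?inv (push \<iota>2 z) = z"
    unfolding push_push by (rule push_ident[OF z]) (use inj2 in auto)
  ultimately show ?thesis by simp
qed

text \<open>Surjectivity of \<open>H \<rightarrow> N\<close> is exactness of \<open>H \<rightarrow> N \<rightarrow> 0\<close>, which faithful flatness reflects from the
  tensored sequence. The zero module is realised inside \<open>N\<close>.\<close>

lemma faithfully_flat_surjective_list:
  fixes R :: "'r ring" and N :: "('r, 'r list) module"
  assumes ff: "faithfully_flat_module R M" and M: "module R M" and N: "module R N"
    and H: "submodule H R N"
    and surj: "\<And>z. Poly_Mapping.keys z \<subseteq> carrier M \<times> carrier N \<Longrightarrow> z \<in> tensor_image R M N H"
  shows "H = carrier N"
proof -
  interpret N: module R N by fact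
  let ?N1 = "N\<lparr>carrier := H\<rparr>" and ?N3 = "N\<lparr>carrier := {\<zero>\<^bsub>N\<^esub>}\<rparr>"
  have HN: "H \<subseteq> carrier N" using N.submoduleE[OF H] by simp
  have N1: "module R ?N1" by (rule submodule.submodule_is_module[OF H N])
  have N3: "module R ?N3"
    by (rule submodule.submodule_is_module[OF _ N]) (rule N.submoduleI; auto)
  have incl: "(\<lambda>x. x) \<in> module_homs R ?N1 N" by (rule submodule_incl_hom[OF HN])
  have zero: "(\<lambda>x. \<zero>\<^bsub>N\<^esub>) \<in> module_homs R N ?N3" by (simp add: module_homs_iff)
  let ?T1 = "tensor_group R M ?N1" and ?T2 = "tensor_group R M N" and ?T3 = "tensor_group R M ?N3"
  let ?f = "tensor_map R M N (\<lambda>x. x)" and ?g = "tensor_map R M ?N3 (\<lambda>x. \<zero>\<^bsub>N\<^esub>)"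
  have null: "push (\<lambda>x. \<zero>\<^bsub>N\<^esub>) z \<in> tensor_subgroup R M ?N3"
    if "Poly_Mapping.keys z \<subseteq> carrier M \<times> carrier N" for z
    using that
  proof (induction z rule: frag_induction)
    case (one x)
    then show ?case using tensor_zero_right[OF M N3] by auto
  qed (auto simp: tensor_subgroup_zero[OF M N3] tensor_subgroup_diff[OF M N3])
  have "kernel ?T2 ?T3 ?g = carrier ?T2"
  proof -
    have "?g (tensor_coset R M N z) = \<one>\<^bsub>?T3\<^esub>" if z: "Poly_Mapping.keys z \<subseteq> carrier M \<times> carrier N" for z
      using tensor_map_coset[OF M N N3 zero z] null[OF z] tensor_group_one[OF M N3]
        tensor_coset_eq_iff[OF M N3 tensor_subgroup_keys[OF M N3 null[OF z]], of 0] by simp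
    then show ?thesis by (auto simp: kernel_def tensor_group_carrier[OF M N])
  qed
  moreover have "?f ` carrier ?T1 = carrier ?T2"
  proof
    show "?f ` carrier ?T1 \<subseteq> carrier ?T2"
      using tensor_map_group_hom[OF M N1 N incl] by (auto simp: group_hom.hom_closed)
    show "carrier ?T2 \<subseteq> ?f ` carrier ?T1"
    proof
      fix X assume "X \<in> carrier ?T2"
      then obtain z where z: "Poly_Mapping.keys z \<subseteq> carrier M \<times> carrier N" and X: "X = tensor_coset R M N z"
        by (auto simp: tensor_group_carrier[OF M N])
      obtain w where w: "Poly_Mapping.keys w \<subseteq> carrier M \<times> H" and zw: "z - w \<in> tensor_subgroup R M N"
        using surj[OF z] by (auto simp: tensor_image_def)
      have "Poly_Mapping.keys w \<subseteq> carrier M \<times> carrier N" using w HN by auto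
      then have "X = tensor_coset R M N w"
        using zw tensor_coset_eq_iff[OF M N z] X by simp
      also have "\<dots> = ?f (tensor_coset R M ?N1 w)"
        using w push_ident[OF w, of "\<lambda>x. x"] tensor_map_coset[OF M N1 N incl, of w] by simp
      finally show "X \<in> ?f ` carrier ?T1" using w by (auto simp: tensor_group_carrier[OF M N1])
    qed
  qed
  ultimately have "exact_seq ([?T3, ?T2, ?T1], [?g, ?f])"
    using tensor_map_group_hom[OF M N1 N incl] tensor_map_group_hom[OF M N N3 zero]
    by (simp add: exact_seq_three_iff del: exact_seq_cons_iff exact_seq_end_iff)
  then have "exact_seq ([additive_group ?N3, additive_group N, additive_group ?N1], [\<lambda>x. \<zero>\<^bsub>N\<^esub>, \<lambda>x. x])"
    using ff incl zero N1 N N3 unfolding faithfully_flat_module_def by blast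
  then show ?thesis
    by (auto simp: exact_seq_three_iff kernel_def additive_group_def simp del: exact_seq_cons_iff exact_seq_end_iff)
qed

lemma faithfully_flat_surjective:
  fixes R :: "'r ring" and N :: "('r, 'm2) module" and \<iota> :: "'m2 \<Rightarrow> 'r list"
  assumes ff: "faithfully_flat_module R M" and M: "module R M" and N: "module R N"
    and inj: "inj_on \<iota> (carrier N)" and H: "submodule H R N"
    and surj: "\<And>z. Poly_Mapping.keys z \<subseteq> carrier M \<times> carrier N \<Longrightarrow> z \<in> tensor_image R M N H"
  shows "H = carrier N"
proof -
  interpret N: module R N by fact
  let ?N = "module_copy \<iota> N" and ?inv = "inv_into (carrier N) \<iota>"
  note C = module_copy_module[OF N inj] and \<iota> = module_copy_hom[OF N inj] and inv = module_copy_hom_inv[OF N inj]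
  interpret C: module R ?N by (rule C)
  have HN: "H \<subseteq> carrier N" using N.submoduleE[OF H] by simp
  have inv_\<iota>: "?inv (\<iota> x) = x" if "x \<in> H" for x
    using that HN inj by auto
  have "submodule (\<iota> ` H) R ?N"
  proof (rule C.submoduleI)
    fix a assume "a \<in> \<iota> ` H"
    then obtain x where x: "x \<in> H" "a = \<iota> x" by auto
    \<comment> \<open>Negation is multiplication by the scalar \<open>-1\<close>, which commutes with \<open>\<iota>\<close>.\<close>
    have "\<ominus>\<^bsub>?N\<^esub> a = \<iota> (\<ominus>\<^bsub>N\<^esub> x)"
    proof -
      have "(\<ominus>\<^bsub>R\<^esub> \<one>\<^bsub>R\<^esub>) \<odot>\<^bsub>?N\<^esub> a = \<iota> ((\<ominus>\<^bsub>R\<^esub> \<one>\<^bsub>R\<^esub>) \<odot>\<^bsub>N\<^esub> x)"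
        using \<iota> x HN by (auto simp: module_homs_iff)
      then show ?thesis using x HN \<iota> C.smult_l_minus[of "\<one>\<^bsub>R\<^esub>" a] N.smult_l_minus[of "\<one>\<^bsub>R\<^esub>" x]
        by (auto simp: module_homs_iff)
    qed
    then show "\<ominus>\<^bsub>?N\<^esub> a \<in> \<iota> ` H" using N.submoduleE(3)[OF H] x by auto
  qed (use N.submoduleE[OF H] subgroup.one_closed[OF submodule.axioms(1)[OF H]] HN inv_\<iota> in \<open>auto simp: module_copy_def\<close>)
  moreover have "z \<in> tensor_image R M ?N (\<iota> ` H)" if z: "Poly_Mapping.keys z \<subseteq> carrier M \<times> carrier ?N" for z
  proof -
    have "push ?inv z \<in> tensor_image R M N H"
      by (rule surj[OF keys_push[OF z]]) (use inj in \<open>auto simp: module_copy_def\<close>)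
    then have "push \<iota> (push ?inv z) \<in> tensor_image R M ?N (\<iota> ` H)"
      by (rule tensor_image_push[OF M N C \<iota>]) simp
    moreover have "push \<iota> (push ?inv z) = z"
      unfolding push_push by (rule push_ident[OF z]) (use inj in \<open>auto simp: module_copy_def\<close>)
    ultimately show ?thesis by simp
  qed
  ultimately have "\<iota> ` H = carrier ?N"
    by (rule faithfully_flat_surjective_list[OF ff M C])
  then show ?thesis using HN inj by (simp add: module_copy_def inj_on_image_eq_iff)
qed

section \<open>Tensor products of algebras\<close>

lemma pair_ring_simps:
  "carrier (pair_ring A A') = {z. Poly_Mapping.keys z \<subseteq> carrier A \<times> carrier A'}"
  "\<one>\<^bsub>pair_ring A A'\<^esub> = frag_of (\<one>\<^bsub>A\<^esub>, \<one>\<^bsub>A'\<^esub>)"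
  "\<zero>\<^bsub>pair_ring A A'\<^esub> = 0"
  "z \<oplus>\<^bsub>pair_ring A A'\<^esub> w = z + w"
  by (simp_all add: pair_ring_def)

lemma pair_ring_mult:
  "frag_of (a, b) \<otimes>\<^bsub>pair_ring A A'\<^esub> frag_of (c, d) = frag_of (a \<otimes>\<^bsub>A\<^esub> c, b \<otimes>\<^bsub>A'\<^esub> d)"
  "0 \<otimes>\<^bsub>pair_ring A A'\<^esub> z = 0"
  "z \<otimes>\<^bsub>pair_ring A A'\<^esub> 0 = 0"
  "(z + z') \<otimes>\<^bsub>pair_ring A A'\<^esub> w = z \<otimes>\<^bsub>pair_ring A A'\<^esub> w + z' \<otimes>\<^bsub>pair_ring A A'\<^esub> w"
  "(z - z') \<otimes>\<^bsub>pair_ring A A'\<^esub> w = z \<otimes>\<^bsub>pair_ring A A'\<^esub> w - z' \<otimes>\<^bsub>pair_ring A A'\<^esub> w"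
  "z \<otimes>\<^bsub>pair_ring A A'\<^esub> (w + w') = z \<otimes>\<^bsub>pair_ring A A'\<^esub> w + z \<otimes>\<^bsub>pair_ring A A'\<^esub> w'"
  "z \<otimes>\<^bsub>pair_ring A A'\<^esub> (w - w') = z \<otimes>\<^bsub>pair_ring A A'\<^esub> w - z \<otimes>\<^bsub>pair_ring A A'\<^esub> w'"
proof -
  let ?m = "\<lambda>z w. z \<otimes>\<^bsub>pair_ring A A'\<^esub> w"
  show 1: "frag_of (a, b) \<otimes>\<^bsub>pair_ring A A'\<^esub> frag_of (c, d) = frag_of (a \<otimes>\<^bsub>A\<^esub> c, b \<otimes>\<^bsub>A'\<^esub> d)"
    and 2: "?m 0 z = 0" and 3: "?m (z + z') w = ?m z w + ?m z' w"
    and 4: "?m (z - z') w = ?m z w - ?m z' w" for z z' w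
    by (simp_all add: pair_ring_def frag_extend_add frag_extend_diff)
  show "?m z 0 = 0"
    by (simp add: pair_ring_def) (rule frag_extend_eq_0, auto)
  show "?m z (w - w') = ?m z w - ?m z w'"
    using subset_UNIV
  proof (induction z rule: frag_induction)
    case (one x)
    then show ?case by (cases x) (simp add: pair_ring_def frag_extend_diff)
  qed (auto simp: 2 4)
  show "?m z (w + w') = ?m z w + ?m z w'"
    using subset_UNIV
  proof (induction z rule: frag_induction)
    case (one x)
    then show ?case by (cases x) (simp add: pair_ring_def frag_extend_add)
  qed (auto simp: 2 4)
qed

context
  fixes A :: "'a ring" and A' :: "'b ring"
  assumes A: "cring A" and A': "cring A'"
begin

interpretation A: cring A by (rule A)
interpretation A': cring A' by (rule A')

text \<open>Both sides of each ring law are additive in every argument, so the laws reduce to pure tensors.\<close>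

lemma pair_ring_cring: "cring (pair_ring A A')"
proof -
  let ?m = "\<lambda>z w. z \<otimes>\<^bsub>pair_ring A A'\<^esub> w"
  let ?S = "carrier A \<times> carrier A'"
  have closed: "Poly_Mapping.keys (?m z w) \<subseteq> ?S"
    if z: "Poly_Mapping.keys z \<subseteq> ?S" and w: "Poly_Mapping.keys w \<subseteq> ?S" for z w
    using z
  proof (induction z rule: frag_induction)
    case (one x)
    show ?case
      using w by (induction w rule: frag_induction) (use one in \<open>auto simp: pair_ring_mult dest!: subsetD[OF keys_diff] split: prod.splits\<close>)
  qed (auto simp: pair_ring_mult dest!: subsetD[OF keys_diff])
  have one: "?m (frag_of (\<one>\<^bsub>A\<^esub>, \<one>\<^bsub>A'\<^esub>)) z = z" if "Poly_Mapping.keys z \<subseteq> ?S" for z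
    using that by (induction z rule: frag_induction) (auto simp: pair_ring_mult)
  have comm: "?m z w = ?m w z"
    if z: "Poly_Mapping.keys z \<subseteq> ?S" and w: "Poly_Mapping.keys w \<subseteq> ?S" for z w
    using z
  proof (induction z rule: frag_induction)
    case (one x)
    show ?case
      using w by (induction w rule: frag_induction) (use one in \<open>auto simp: pair_ring_mult A.m_comm A'.m_comm\<close>)
  qed (auto simp: pair_ring_mult)
  have assoc: "?m (?m z w) v = ?m z (?m w v)"
    if z: "Poly_Mapping.keys z \<subseteq> ?S" and w: "Poly_Mapping.keys w \<subseteq> ?S" and v: "Poly_Mapping.keys v \<subseteq> ?S" for z w v
    using z
  proof (induction z rule: frag_induction)
    case (one x)
    show ?case using w
    proof (induction w rule: frag_induction)
      case (one y)
      show ?case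
        using v by (induction v rule: frag_induction)
          (use one \<open>x \<in> ?S\<close> in \<open>auto simp: pair_ring_mult A.m_assoc A'.m_assoc\<close>)
    qed (auto simp: pair_ring_mult)
  qed (auto simp: pair_ring_mult)
  show ?thesis
  proof (rule cringI)
    show "abelian_group (pair_ring A A')"
    proof (rule abelian_groupI)
      fix x assume "x \<in> carrier (pair_ring A A')"
      then show "\<exists>y\<in>carrier (pair_ring A A'). y \<oplus>\<^bsub>pair_ring A A'\<^esub> x = \<zero>\<^bsub>pair_ring A A'\<^esub>"
        by (intro bexI[of _ "- x"]) (auto simp: pair_ring_simps)
    qed (auto simp: pair_ring_simps dest!: subsetD[OF Poly_Mapping.keys_add])
    show "Group.comm_monoid (pair_ring A A')"
      by (rule comm_monoidI) (use closed one comm assoc in \<open>auto simp: pair_ring_simps split: if_splits\<close>)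
  qed (simp add: pair_ring_simps pair_ring_mult)
qed

lemma pair_ring_minus:
  assumes "Poly_Mapping.keys w \<subseteq> carrier A \<times> carrier A'"
  shows "\<ominus>\<^bsub>pair_ring A A'\<^esub> w = - w" and "z \<ominus>\<^bsub>pair_ring A A'\<^esub> w = z - w"
proof -
  interpret cring "pair_ring A A'" by (rule pair_ring_cring)
  show "\<ominus>\<^bsub>pair_ring A A'\<^esub> w = - w"
    by (rule minus_equality) (use assms in \<open>auto simp: pair_ring_simps\<close>)
  then show "z \<ominus>\<^bsub>pair_ring A A'\<^esub> w = z - w"
    by (simp add: a_minus_def pair_ring_simps)
qed

end

context
  fixes R :: "'r ring" and A :: "'a ring" and A' :: "'b ring" and f :: "'r \<Rightarrow> 'a" and f' :: "'r \<Rightarrow> 'b"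
  assumes R: "cring R" and A: "cring A" and A': "cring A'"
    and f: "f \<in> ring_hom R A" and f': "f' \<in> ring_hom R A'"
begin

interpretation A: cring A by (rule A)
interpretation A': cring A' by (rule A')
interpretation P: cring "pair_ring A A'" by (rule pair_ring_cring[OF A A'])

lemmas left_module = module_restrict_scalars[OF R A f] and right_module = module_restrict_scalars[OF R A' f']

abbreviation (input) "tensor_rel \<equiv> tensor_subgroup R (restrict_scalars f A) (restrict_scalars f' A')"

text \<open>A pure tensor times a defining relation is a defining relation. So the subgroup spanned by the
  relations is an ideal, and the tensor product of two algebras has as its additive group the tensor
  product of the modules. This is what gives access to the vanishing of an element of the algebra.\<close>

lemma tensor_subgroup_ideal: "ideal tensor_rel (pair_ring A A')"
proof (rule idealI)
  show "ring (pair_ring A A')" by (rule P.ring_axioms)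
  note keys = tensor_subgroup_keys[OF left_module right_module, unfolded restrict_scalars_simps]
  show "subgroup tensor_rel (add_monoid (pair_ring A A'))"
    by (rule P.add.subgroupI)
       (use keys tensor_subgroup_zero[OF left_module right_module] tensor_subgroup_add[OF left_module right_module] tensor_subgroup_minus[OF left_module right_module]
         pair_ring_minus(1)[OF A A']
         in \<open>auto simp: pair_ring_simps\<close>)
  have left: "x \<otimes>\<^bsub>pair_ring A A'\<^esub> a \<in> tensor_rel" if a: "a \<in> tensor_rel" and x: "x \<in> carrier (pair_ring A A')" for a x
  proof -
    have "Poly_Mapping.keys x \<subseteq> carrier A \<times> carrier A'" using x by (simp add: pair_ring_simps)
    then show ?thesis
    proof (induction x rule: frag_induction)
      case (one k)
      then obtain u v where k: "k = (u, v)" "u \<in> carrier A" "v \<in> carrier A'" by auto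
      show ?case using a
      proof (induction rule: tensor_subgroup_induct[OF left_module right_module, consumes 1, case_names zero diff add_left add_right balanced])
        case (add_left x x' y)
        then show ?case
          using k tensor_add_left[OF left_module right_module, of "u \<otimes>\<^bsub>A\<^esub> x" "u \<otimes>\<^bsub>A\<^esub> x'" "v \<otimes>\<^bsub>A'\<^esub> y"]
          by (simp add: restrict_scalars_simps pair_ring_mult A.r_distr)
      next
        case (add_right x y y')
        then show ?case
          using k tensor_add_right[OF left_module right_module, of "u \<otimes>\<^bsub>A\<^esub> x" "v \<otimes>\<^bsub>A'\<^esub> y" "v \<otimes>\<^bsub>A'\<^esub> y'"]
          by (simp add: restrict_scalars_simps pair_ring_mult A'.r_distr)
      next
        case (balanced r x y)
        then show ?case
          using k tensor_balanced[OF left_module right_module, of r "u \<otimes>\<^bsub>A\<^esub> x" "v \<otimes>\<^bsub>A'\<^esub> y"] ring_hom_closed[OF f] ring_hom_closed[OF f']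
          by (simp add: restrict_scalars_simps pair_ring_mult A.m_lcomm A'.m_lcomm)
      qed (auto simp: pair_ring_mult tensor_subgroup_zero[OF left_module right_module] tensor_subgroup_diff[OF left_module right_module])
    qed (auto simp: pair_ring_mult tensor_subgroup_zero[OF left_module right_module] tensor_subgroup_diff[OF left_module right_module])
  qed
  fix a x assume a: "a \<in> tensor_rel" and x: "x \<in> carrier (pair_ring A A')"
  then show "x \<otimes>\<^bsub>pair_ring A A'\<^esub> a \<in> tensor_rel" by (rule left)
  moreover have "a \<in> carrier (pair_ring A A')" using keys[OF a] by (simp add: pair_ring_simps)
  ultimately show "a \<otimes>\<^bsub>pair_ring A A'\<^esub> x \<in> tensor_rel" using x by (simp add: P.m_comm)
qed

lemma algebra_tensor_ideal_eq: "algebra_tensor_ideal R A f A' f' = tensor_rel"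
proof -
  let ?rel = "tensor_relations R (restrict_scalars f A) (restrict_scalars f' A')"
  have rel: "?rel \<subseteq> carrier (pair_ring A A')"
    using tensor_relations_carrier[OF left_module right_module] by (simp add: free_Abelian_group_def pair_ring_simps restrict_scalars_simps)
  have "?rel \<subseteq> tensor_rel" unfolding tensor_subgroup_def by (auto intro: generate.incl)
  then have "algebra_tensor_ideal R A f A' f' \<subseteq> tensor_rel"
    unfolding algebra_tensor_ideal_def by (rule P.genideal_minimal[OF tensor_subgroup_ideal])
  moreover have "tensor_rel \<subseteq> algebra_tensor_ideal R A f A' f'"
  proof
    interpret I: ideal "algebra_tensor_ideal R A f A' f'" "pair_ring A A'"
      unfolding algebra_tensor_ideal_def by (rule P.genideal_ideal[OF rel])
    have sub: "?rel \<subseteq> algebra_tensor_ideal R A f A' f'"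
      unfolding algebra_tensor_ideal_def by (rule P.genideal_self[OF rel])
    have keys: "Poly_Mapping.keys z \<subseteq> carrier A \<times> carrier A'" if "z \<in> algebra_tensor_ideal R A f A' f'" for z
      using I.Icarr[OF that] by (simp add: pair_ring_simps)
    fix z assume "z \<in> tensor_rel"
    then show "z \<in> algebra_tensor_ideal R A f A' f'"
    proof (induction rule: tensor_subgroup_induct[OF left_module right_module, consumes 1, case_names zero diff add_left add_right balanced])
      case zero
      then show ?case using I.zero_closed by (simp add: pair_ring_simps)
    next
      case (diff z w)
      then show ?case using I.a_closed[of z "- w"] I.a_inv_closed[of w] keys[of w]
        by (simp add: pair_ring_minus[OF A A'] pair_ring_simps)
    qed (rule subsetD[OF sub], unfold tensor_relations_def, blast)+
  qed
  ultimately show ?thesis by blast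
qed

interpretation I: ideal "algebra_tensor_ideal R A f A' f'" "pair_ring A A'"
  unfolding algebra_tensor_ideal_eq by (rule tensor_subgroup_ideal)

abbreviation (input) "tensor_class \<equiv> (\<lambda>z. algebra_tensor_ideal R A f A' f' +>\<^bsub>pair_ring A A'\<^esub> z)"

lemma algebra_tensor_cring: "cring (algebra_tensor R A f A' f')"
  unfolding algebra_tensor_def by (rule I.quotient_is_cring[OF P.is_cring])

lemma algebra_tensor_class_hom: "tensor_class \<in> ring_hom (pair_ring A A') (algebra_tensor R A f A' f')"
  unfolding algebra_tensor_def by (rule I.rcos_ring_hom)

lemma algebra_tensor_carrier:
  "carrier (algebra_tensor R A f A' f') = {tensor_class z | z. Poly_Mapping.keys z \<subseteq> carrier A \<times> carrier A'}"
  by (auto simp: algebra_tensor_def FactRing_def A_RCOSETS_def' pair_ring_simps)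

lemma algebra_tensor_class_eq_iff:
  assumes "Poly_Mapping.keys z \<subseteq> carrier A \<times> carrier A'" "Poly_Mapping.keys w \<subseteq> carrier A \<times> carrier A'"
  shows "tensor_class z = tensor_class w \<longleftrightarrow> z - w \<in> tensor_rel"
  using P.quotient_eq_iff_same_a_r_cos[OF I.ideal_axioms, of z w] assms
  by (simp add: pair_ring_simps pair_ring_minus[OF A A'] algebra_tensor_ideal_eq)

lemma algebra_tensor_class_self:
  "Poly_Mapping.keys z \<subseteq> carrier A \<times> carrier A' \<Longrightarrow> z \<in> tensor_class z"
  using I.a_rcos_self[of z] by (simp add: pair_ring_simps)

lemma algebra_tensor_class_keys:
  "\<lbrakk>X \<in> carrier (algebra_tensor R A f A' f'); z \<in> X\<rbrakk> \<Longrightarrow>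
   Poly_Mapping.keys z \<subseteq> carrier A \<times> carrier A' \<and> X = tensor_class z"
proof -
  assume "X \<in> carrier (algebra_tensor R A f A' f')" and z: "z \<in> X"
  then obtain w where w: "Poly_Mapping.keys w \<subseteq> carrier A \<times> carrier A'" and X: "X = tensor_class w"
    unfolding algebra_tensor_carrier by blast
  have wc: "w \<in> carrier (pair_ring A A')" using w by (simp add: pair_ring_simps)
  have "z \<in> carrier (pair_ring A A')" using I.a_elemrcos_carrier[OF wc] z X by blast
  moreover have "X = tensor_class z" using I.a_repr_independence'[OF _ wc, of z] z X by simp
  ultimately show ?thesis by (simp add: pair_ring_simps)
qed

lemma algebra_tensor_left_hom: "(\<lambda>a. tensor_class (frag_of (a, \<one>\<^bsub>A'\<^esub>))) \<in> ring_hom A (algebra_tensor R A f A' f')"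
proof (rule ring_hom_memI)
  fix x y assume xy: "x \<in> carrier A" "y \<in> carrier A"
  show "tensor_class (frag_of (x, \<one>\<^bsub>A'\<^esub>)) \<in> carrier (algebra_tensor R A f A' f')"
    using xy by (auto simp: algebra_tensor_carrier)
  show "tensor_class (frag_of (x \<otimes>\<^bsub>A\<^esub> y, \<one>\<^bsub>A'\<^esub>)) = tensor_class (frag_of (x, \<one>\<^bsub>A'\<^esub>)) \<otimes>\<^bsub>algebra_tensor R A f A' f'\<^esub> tensor_class (frag_of (y, \<one>\<^bsub>A'\<^esub>))"
    using xy by (simp add: pair_ring_simps pair_ring_mult flip: ring_hom_mult[OF algebra_tensor_class_hom])
  have "tensor_class (frag_of (x \<oplus>\<^bsub>A\<^esub> y, \<one>\<^bsub>A'\<^esub>)) = tensor_class (frag_of (x, \<one>\<^bsub>A'\<^esub>) + frag_of (y, \<one>\<^bsub>A'\<^esub>))"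
    using xy tensor_add_left[OF left_module right_module, of x y "\<one>\<^bsub>A'\<^esub>"]
    by (subst algebra_tensor_class_eq_iff[OF _ keys_add_subset]) (auto simp: restrict_scalars_simps diff_diff_eq)
  then show "tensor_class (frag_of (x \<oplus>\<^bsub>A\<^esub> y, \<one>\<^bsub>A'\<^esub>)) = tensor_class (frag_of (x, \<one>\<^bsub>A'\<^esub>)) \<oplus>\<^bsub>algebra_tensor R A f A' f'\<^esub> tensor_class (frag_of (y, \<one>\<^bsub>A'\<^esub>))"
    using xy by (simp add: pair_ring_simps flip: ring_hom_add[OF algebra_tensor_class_hom])
qed (use ring_hom_one[OF algebra_tensor_class_hom] in \<open>simp add: pair_ring_simps\<close>)

lemma algebra_tensor_right_hom: "algebra_tensor_right R A f A' f' \<in> ring_hom A' (algebra_tensor R A f A' f')"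
  unfolding algebra_tensor_right_def[abs_def]
proof (rule ring_hom_memI)
  fix x y assume xy: "x \<in> carrier A'" "y \<in> carrier A'"
  show "tensor_class (frag_of (\<one>\<^bsub>A\<^esub>, x)) \<in> carrier (algebra_tensor R A f A' f')"
    using xy by (auto simp: algebra_tensor_carrier)
  show "tensor_class (frag_of (\<one>\<^bsub>A\<^esub>, x \<otimes>\<^bsub>A'\<^esub> y)) = tensor_class (frag_of (\<one>\<^bsub>A\<^esub>, x)) \<otimes>\<^bsub>algebra_tensor R A f A' f'\<^esub> tensor_class (frag_of (\<one>\<^bsub>A\<^esub>, y))"
    using xy by (simp add: pair_ring_simps pair_ring_mult flip: ring_hom_mult[OF algebra_tensor_class_hom])
  have "tensor_class (frag_of (\<one>\<^bsub>A\<^esub>, x \<oplus>\<^bsub>A'\<^esub> y)) = tensor_class (frag_of (\<one>\<^bsub>A\<^esub>, x) + frag_of (\<one>\<^bsub>A\<^esub>, y))"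
    using xy tensor_add_right[OF left_module right_module, of "\<one>\<^bsub>A\<^esub>" x y]
    by (subst algebra_tensor_class_eq_iff[OF _ keys_add_subset]) (auto simp: restrict_scalars_simps diff_diff_eq)
  then show "tensor_class (frag_of (\<one>\<^bsub>A\<^esub>, x \<oplus>\<^bsub>A'\<^esub> y)) = tensor_class (frag_of (\<one>\<^bsub>A\<^esub>, x)) \<oplus>\<^bsub>algebra_tensor R A f A' f'\<^esub> tensor_class (frag_of (\<one>\<^bsub>A\<^esub>, y))"
    using xy by (simp add: pair_ring_simps flip: ring_hom_add[OF algebra_tensor_class_hom])
qed (use ring_hom_one[OF algebra_tensor_class_hom] in \<open>simp add: pair_ring_simps\<close>)

lemma algebra_tensor_balanced:
  assumes "r \<in> carrier R" "x \<in> carrier A" "y \<in> carrier A'"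
  shows "tensor_class (frag_of (f r \<otimes>\<^bsub>A\<^esub> x, y)) = tensor_class (frag_of (x, f' r \<otimes>\<^bsub>A'\<^esub> y))"
  using assms tensor_balanced[OF left_module right_module, of r x y] ring_hom_closed[OF f] ring_hom_closed[OF f']
  by (subst algebra_tensor_class_eq_iff) (auto simp: restrict_scalars_simps)

text \<open>The kernel of \<open>A \<rightarrow> A \<otimes> A'\<close> contains \<open>f(I)\<close>, because \<open>f(i) \<otimes> 1 = 1 \<otimes> f'(i) = 0\<close> for \<open>i \<in> I\<close>.\<close>

lemma algebra_tensor_extended_ideal:
  assumes I: "I \<subseteq> carrier R" and f'I: "\<And>i. i \<in> I \<Longrightarrow> f' i = \<zero>\<^bsub>A'\<^esub>" and c: "c \<in> Idl\<^bsub>A\<^esub> (f ` I)"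
  shows "tensor_class (frag_of (c, \<one>\<^bsub>A'\<^esub>)) = \<zero>\<^bsub>algebra_tensor R A f A' f'\<^esub>"
proof -
  let ?h = "\<lambda>a. tensor_class (frag_of (a, \<one>\<^bsub>A'\<^esub>))" and ?T = "algebra_tensor R A f A' f'"
  interpret T: cring ?T by (rule algebra_tensor_cring)
  interpret h: ring_hom_ring A ?T ?h
    by (rule ring_hom_ringI2[OF A.ring_axioms T.ring_axioms algebra_tensor_left_hom])
  have "?h (f i) = \<zero>\<^bsub>?T\<^esub>" if i: "i \<in> I" for i
  proof -
    have iR: "i \<in> carrier R" using i I by blast
    have "?h (f i) = tensor_class (frag_of (\<one>\<^bsub>A\<^esub>, f' i))"
      using algebra_tensor_balanced[OF iR A.one_closed A'.one_closed] ring_hom_closed[OF f iR] ring_hom_closed[OF f' iR]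
      by simp
    also have "\<dots> = algebra_tensor_right R A f A' f' \<zero>\<^bsub>A'\<^esub>"
      unfolding algebra_tensor_right_def f'I[OF i] by (rule refl)
    also have "\<dots> = \<zero>\<^bsub>?T\<^esub>"
      by (rule ring_hom_zero[OF algebra_tensor_right_hom A'.ring_axioms T.ring_axioms])
    finally show ?thesis .
  qed
  then have "f ` I \<subseteq> a_kernel A ?T ?h"
    unfolding a_kernel_def' using ring_hom_closed[OF f subsetD[OF I]]
    by (intro image_subsetI CollectI conjI)
  then have "Idl\<^bsub>A\<^esub> (f ` I) \<subseteq> a_kernel A ?T ?h"
    by (rule A.genideal_minimal[OF h.kernel_is_ideal])
  then have "c \<in> a_kernel A ?T ?h" using c by (rule subsetD)
  then show ?thesis unfolding a_kernel_def' mem_Collect_eq by (rule conjunct2)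
qed

end

lemma frag_of_pow:
  "frag_of (a, b) [^]\<^bsub>pair_ring A A'\<^esub> (n::nat) = frag_of (a [^]\<^bsub>A\<^esub> n, b [^]\<^bsub>A'\<^esub> n)"
  unfolding nat_pow_def by (induction n) (simp_all add: pair_ring_simps pair_ring_mult)

section \<open>Colon ideals under flat extension\<close>

lemma ideal_smult_image:
  assumes "cring C" and "b \<in> g ` I" and "g ` I \<subseteq> carrier C" and "c \<in> carrier C"
  shows "c \<otimes>\<^bsub>C\<^esub> b \<in> Idl\<^bsub>C\<^esub> (g ` I)"
proof -
  interpret cring C by fact
  interpret I: ideal "Idl\<^bsub>C\<^esub> (g ` I)" C by (rule genideal_ideal) fact
  show ?thesis using genideal_self[OF assms(3)] assms by (intro I.I_l_closed) auto
qed

lemma frag_eval_in_ideal: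
  assumes A: "ring A" and f: "f ` S \<subseteq> carrier A" and J: "ideal J A" and "S' \<subseteq> S"
    and z: "Poly_Mapping.keys z \<subseteq> S'" and fJ: "\<And>x. x \<in> S' \<Longrightarrow> f x \<in> J"
  shows "frag_eval A S f z \<in> J"
proof -
  interpret ideal J A by fact
  show ?thesis
    using z
  proof (induction z rule: free_Abelian_group_induct[consumes 1, case_names zero diff one])
    case zero
    then show ?case by (simp add: frag_eval_zero[OF A f])
  next
    case (diff z w)
    then have "frag_eval A S f (z - w) = frag_eval A S f z \<ominus>\<^bsub>A\<^esub> frag_eval A S f w"
      using \<open>S' \<subseteq> S\<close> by (intro frag_eval_diff[OF A f]) auto
    then show ?case using diff a_closed a_inv_closed by (simp add: a_minus_def)
  next
    case (one x)
    then show ?case using \<open>S' \<subseteq> S\<close> fJ by (auto simp: frag_eval_props(2)[OF A f])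
  qed
qed

text \<open>Multiplication by \<open>a\<close>, as a map from \<open>B\<close> to \<open>B/I\<close>, has kernel \<open>(I : a)\<close>. It sends \<open>x \<otimes> 1\<close> to
  \<open>x \<otimes> a = g(a)x \<otimes> 1\<close>, which is zero in \<open>C \<otimes> B/I\<close>. By flatness \<open>x \<otimes> 1\<close> comes from \<open>C \<otimes> (I : a)\<close>,
  and evaluating pure tensors \<open>c \<otimes> b\<close> to \<open>c g(b)\<close> places \<open>x\<close> in the extension of \<open>(I : a)\<close>.\<close>

lemma flat_colon:
  fixes B :: "'b ring" and C :: "'c ring"
  assumes B: "cring B" and C: "cring C" and g: "g \<in> ring_hom B C" and flat: "flat_module B (restrict_scalars g C)"
    and I: "ideal I B" and a: "a \<in> carrier B" and x: "x \<in> carrier C"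
    and gax: "g a \<otimes>\<^bsub>C\<^esub> x \<in> Idl\<^bsub>C\<^esub> (g ` I)"
  shows "x \<in> Idl\<^bsub>C\<^esub> (g ` {r \<in> carrier B. a \<otimes>\<^bsub>B\<^esub> r \<in> I})"
proof -
  interpret B: cring B by fact
  interpret C: cring C by fact
  interpret I: ideal I B by fact
  let ?K = "{r \<in> carrier B. a \<otimes>\<^bsub>B\<^esub> r \<in> I}"
  let ?D = "B Quot I" and ?q = "\<lambda>b. I +>\<^bsub>B\<^esub> b"
  let ?M = "restrict_scalars g C" and ?N = "restrict_scalars (\<lambda>x. x) B" and ?Q = "restrict_scalars ?q ?D"
  have D: "cring ?D" by (rule I.quotient_is_cring[OF B])
  interpret D: cring ?D by (rule D)
  have q: "?q \<in> ring_hom B ?D" by (rule I.rcos_ring_hom)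
  have id: "(\<lambda>x. x) \<in> ring_hom B B" by (rule ring_hom_memI) auto
  note M = module_restrict_scalars[OF B C g] and N = module_restrict_scalars[OF B B id]
    and Q = module_restrict_scalars[OF B D q]
  have q0: "?q b = \<zero>\<^bsub>?D\<^esub> \<longleftrightarrow> b \<in> I" if "b \<in> carrier B" for b
    using that I.rcos_const_imp_mem[of b] I.a_rcos_const[of b] unfolding FactRing_def by fastforce
  define h where "h r = ?q (a \<otimes>\<^bsub>B\<^esub> r)" for r
  have h: "h \<in> module_homs B ?N ?Q"
    using a ring_hom_mult[OF q] ring_hom_add[OF q] ring_hom_closed[OF q] ring_hom_closed[OF q a]
    by (simp add: module_homs_iff restrict_scalars_simps h_def B.r_distr D.m_lcomm)
  let ?cl = "\<lambda>z. algebra_tensor_ideal B C g ?D ?q +>\<^bsub>pair_ring C ?D\<^esub> z"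
  note T = B C D g q
  have T_ring: "ring (algebra_tensor B C g ?D ?q)" by (rule cring.axioms(1)[OF algebra_tensor_cring[OF T]])
  have "?cl (frag_of (x, ?q a)) = ?cl (frag_of (x, ?q a \<otimes>\<^bsub>?D\<^esub> \<one>\<^bsub>?D\<^esub>))"
    using D.r_one[OF ring_hom_closed[OF q a]] by simp
  also have "\<dots> = ?cl (frag_of (g a \<otimes>\<^bsub>C\<^esub> x, \<one>\<^bsub>?D\<^esub>))"
    by (rule algebra_tensor_balanced[OF T a x D.one_closed, symmetric])
  also have "\<dots> = \<zero>\<^bsub>algebra_tensor B C g ?D ?q\<^esub>"
    by (rule algebra_tensor_extended_ideal[OF T I.a_subset _ gax]) (use q0 I.Icarr in blast)
  also have "\<dots> = ?cl 0"
    using ring_hom_zero[OF algebra_tensor_class_hom[OF T] cring.axioms(1)[OF pair_ring_cring[OF C D]] T_ring]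
    by (simp add: pair_ring_simps)
  finally have "frag_of (x, ?q a) \<in> tensor_subgroup B ?M ?Q"
    using algebra_tensor_class_eq_iff[OF T, of "frag_of (x, ?q a)" 0] x ring_hom_closed[OF q a] by simp
  then have push: "push h (frag_of (x, \<one>\<^bsub>B\<^esub>)) \<in> tensor_subgroup B ?M ?Q"
    using a by (simp add: h_def)
  have "carrier ?D \<subseteq> range (\<lambda>l. ?q (hd l))"
  proof
    fix X assume "X \<in> carrier ?D"
    then obtain b where "X = ?q b" unfolding FactRing_def A_RCOSETS_def' by auto
    then have "X = ?q (hd [b])" by simp
    then show "X \<in> range (\<lambda>l. ?q (hd l))" by blast
  qed
  then obtain \<iota> :: "'b set \<Rightarrow> 'b list" where \<iota>: "inj_on \<iota> (carrier ?D)"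
    by (meson inj_on_inv_into)
  have "frag_of (x, \<one>\<^bsub>B\<^esub>) \<in> tensor_image B ?M ?N {r \<in> carrier ?N. h r = \<zero>\<^bsub>?Q\<^esub>}"
    by (rule flat_tensor_kernel[OF flat M N Q _ _ h _ push, of "\<lambda>x. [x]" \<iota>])
       (use x \<iota> in \<open>auto simp: restrict_scalars_simps inj_on_def\<close>)
  moreover have "{r \<in> carrier ?N. h r = \<zero>\<^bsub>?Q\<^esub>} = ?K"
    using q0 a by (simp add: restrict_scalars_simps h_def cong: conj_cong)
  ultimately obtain w where w: "Poly_Mapping.keys w \<subseteq> carrier C \<times> ?K"
    and xw: "frag_of (x, \<one>\<^bsub>B\<^esub>) - w \<in> tensor_subgroup B ?M ?N"
    unfolding tensor_image_def restrict_scalars_simps by auto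
  let ?f = "\<lambda>(c, b). c \<otimes>\<^bsub>C\<^esub> g b" and ?S = "carrier C \<times> carrier B"
  let ?ev = "frag_eval C ?S ?f"
  have f: "?f ` ?S \<subseteq> carrier C" using ring_hom_closed[OF g] by auto
  have wS: "Poly_Mapping.keys w \<subseteq> ?S" using w by auto
  have "?ev (frag_of (x, \<one>\<^bsub>B\<^esub>) - w) = \<zero>\<^bsub>C\<^esub>"
    by (rule frag_eval_tensor_subgroup[OF M N C.ring_axioms, unfolded restrict_scalars_simps, OF f _ _ _ xw])
       (use ring_hom_closed[OF g] in \<open>simp_all add: ring_hom_add[OF g] ring_hom_mult[OF g] C.l_distr C.r_distr C.m_ac\<close>)
  moreover have "?ev (frag_of (x, \<one>\<^bsub>B\<^esub>) - w) = x \<ominus>\<^bsub>C\<^esub> ?ev w"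
    using frag_eval_diff[OF C.ring_axioms f _ wS, of "frag_of (x, \<one>\<^bsub>B\<^esub>)"]
      frag_eval_props(2)[OF C.ring_axioms f, of "(x, \<one>\<^bsub>B\<^esub>)"] x ring_hom_one[OF g] by simp
  moreover have "?ev w \<in> carrier C" by (rule frag_eval_closed[OF C.ring_axioms f wS])
  ultimately have "x = ?ev w" using x by (simp add: C.r_right_minus_eq)
  moreover have "?ev w \<in> Idl\<^bsub>C\<^esub> (g ` ?K)"
  proof (rule frag_eval_in_ideal[OF C.ring_axioms f _ _ w])
    have gK: "g ` ?K \<subseteq> carrier C" using ring_hom_closed[OF g] by auto
    then show "ideal (Idl\<^bsub>C\<^esub> (g ` ?K)) C" by (rule C.genideal_ideal)
    show "?f k \<in> Idl\<^bsub>C\<^esub> (g ` ?K)" if "k \<in> carrier C \<times> ?K" for k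
      using that ideal_smult_image[OF C _ gK] by (cases k) auto
  qed auto
  ultimately show ?thesis by simp
qed

section \<open>The relative Frobenius on a fibre\<close>

locale char_p_hom =
  fixes p :: nat and B :: "'b ring" and C :: "'c ring" and g :: "'b \<Rightarrow> 'c"
  assumes p: "Factorial_Ring.prime p" and B: "cring B" and C: "cring C" and g: "g \<in> ring_hom B C"
    and char_B: "[p] \<cdot>\<^bsub>B\<^esub> \<one>\<^bsub>B\<^esub> = \<zero>\<^bsub>B\<^esub>"
begin

sublocale B: cring B by (rule B)
sublocale C: cring C by (rule C)

lemma char_C: "[p] \<cdot>\<^bsub>C\<^esub> \<one>\<^bsub>C\<^esub> = \<zero>\<^bsub>C\<^esub>"
  by (rule ring_hom_char[OF B.ring_axioms C.ring_axioms g char_B])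

abbreviation "C\<^sub>B \<equiv> restrict_scalars g C"
abbreviation "F\<^sub>B \<equiv> restrict_scalars (frobenius p B) B"

lemma frob_B: "frobenius p B \<in> ring_hom B B"
  by (rule frobenius_ring_hom[OF B p char_B])

lemma frob_C: "frobenius p C \<in> ring_hom C C"
  by (rule frobenius_ring_hom[OF C p char_C])

lemma module_C: "module B C\<^sub>B" and module_F: "module B F\<^sub>B"
  by (rule module_restrict_scalars[OF B C g] module_restrict_scalars[OF B B frob_B])+

text \<open>The map from \<open>C \<otimes> F\<^sub>*B\<close> to \<open>C\<close>, on formal sums of pure tensors.\<close>

definition relative_frobenius :: "('c \<times> 'b \<Rightarrow>\<^sub>0 int) \<Rightarrow> 'c"
  where "relative_frobenius = frag_eval C (carrier C \<times> carrier B) (\<lambda>(c, b). c [^]\<^bsub>C\<^esub> p \<otimes>\<^bsub>C\<^esub> g b)"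

lemma relative_frobenius_closed:
    "Poly_Mapping.keys z \<subseteq> carrier C \<times> carrier B \<Longrightarrow> relative_frobenius z \<in> carrier C"
  and relative_frobenius_zero: "relative_frobenius 0 = \<zero>\<^bsub>C\<^esub>"
  and relative_frobenius_diff: "\<lbrakk>Poly_Mapping.keys z \<subseteq> carrier C \<times> carrier B; Poly_Mapping.keys w \<subseteq> carrier C \<times> carrier B\<rbrakk> \<Longrightarrow>
    relative_frobenius (z - w) = relative_frobenius z \<ominus>\<^bsub>C\<^esub> relative_frobenius w"
  and relative_frobenius_of: "\<lbrakk>c \<in> carrier C; b \<in> carrier B\<rbrakk> \<Longrightarrow>
    relative_frobenius (frag_of (c, b)) = c [^]\<^bsub>C\<^esub> p \<otimes>\<^bsub>C\<^esub> g b"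
proof -
  have im: "(\<lambda>(c, b). c [^]\<^bsub>C\<^esub> p \<otimes>\<^bsub>C\<^esub> g b) ` (carrier C \<times> carrier B) \<subseteq> carrier C"
    using ring_hom_closed[OF g] by auto
  show "Poly_Mapping.keys z \<subseteq> carrier C \<times> carrier B \<Longrightarrow> relative_frobenius z \<in> carrier C"
    "relative_frobenius 0 = \<zero>\<^bsub>C\<^esub>"
    "\<lbrakk>Poly_Mapping.keys z \<subseteq> carrier C \<times> carrier B; Poly_Mapping.keys w \<subseteq> carrier C \<times> carrier B\<rbrakk> \<Longrightarrow>
    relative_frobenius (z - w) = relative_frobenius z \<ominus>\<^bsub>C\<^esub> relative_frobenius w"
    "\<lbrakk>c \<in> carrier C; b \<in> carrier B\<rbrakk> \<Longrightarrow> relative_frobenius (frag_of (c, b)) = c [^]\<^bsub>C\<^esub> p \<otimes>\<^bsub>C\<^esub> g b"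
    unfolding relative_frobenius_def
    using frag_eval_closed[OF C.ring_axioms im] frag_eval_zero[OF C.ring_axioms im]
      frag_eval_diff[OF C.ring_axioms im] frag_eval_props(2)[OF C.ring_axioms im]
    by simp_all
qed

end

locale char_p_fiber = char_p_hom p B C g
  for p :: nat and B :: "'b ring" and C :: "'c ring" and g :: "'b \<Rightarrow> 'c" +
  fixes P :: "'b set"
  assumes P: "primeideal P B"
begin

abbreviation "\<kappa> \<equiv> residue_field B P"
abbreviation "\<rho> \<equiv> residue_map B P"
abbreviation "F\<kappa> \<equiv> restrict_scalars (\<lambda>b. frobenius p \<kappa> (\<rho> b)) \<kappa>"

abbreviation "fiber \<equiv> algebra_tensor B C g \<kappa> \<rho>"
abbreviation "fiber_scalar \<equiv> algebra_tensor_right B C g \<kappa> \<rho>"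
abbreviation "fiber_class z \<equiv> algebra_tensor_ideal B C g \<kappa> \<rho> +>\<^bsub>pair_ring C \<kappa>\<^esub> z"
abbreviation "fiber_of c \<equiv> fiber_class (frag_of (c, \<one>\<^bsub>\<kappa>\<^esub>))"

text \<open>The extension of \<open>\<kappa>\<close> by the \<open>p\<close>-th roots of its elements is, up to isomorphism, \<open>\<kappa>\<close> itself with \<open>\<kappa>\<close>
  embedded by Frobenius; so \<open>[\<alpha>]\<close> is the \<open>p\<close>-th root of the image of \<open>\<alpha>\<close>. The elements are wrapped as
  lists because geometric reducedness quantifies over fields whose elements are lists over \<open>\<kappa>\<close>.\<close>

definition root_field where "root_field = image_ring (\<lambda>\<alpha>. [\<alpha>]) \<kappa>"
definition root_map where "root_map = (\<lambda>\<alpha>. [frobenius p \<kappa> \<alpha>])"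

abbreviation "root_fiber \<equiv> algebra_tensor \<kappa> fiber fiber_scalar root_field root_map"
abbreviation "root_class z \<equiv> algebra_tensor_ideal \<kappa> fiber fiber_scalar root_field root_map +>\<^bsub>pair_ring fiber root_field\<^esub> z"

sublocale \<kappa>: field \<kappa> by (rule residue_field_is_field[OF P])

lemma \<rho>: "\<rho> \<in> ring_hom B \<kappa>" by (rule residue_map_ring_hom[OF P])

lemma char_\<kappa>: "[p] \<cdot>\<^bsub>\<kappa>\<^esub> \<one>\<^bsub>\<kappa>\<^esub> = \<zero>\<^bsub>\<kappa>\<^esub>"
  by (rule ring_hom_char[OF B.ring_axioms \<kappa>.ring_axioms \<rho> char_B])

lemma frob_\<kappa>: "frobenius p \<kappa> \<in> ring_hom \<kappa> \<kappa>"
  by (rule frobenius_ring_hom[OF \<kappa>.is_cring p char_\<kappa>])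

lemma module_F\<kappa>: "module B F\<kappa>" and module_\<kappa>: "module B (restrict_scalars \<rho> \<kappa>)"
  by (rule module_restrict_scalars[OF B \<kappa>.is_cring]; rule \<rho> ring_hom_trans[OF \<rho> frob_\<kappa>, unfolded comp_def])+

lemma fiber_cring: "cring fiber" by (rule algebra_tensor_cring[OF B C \<kappa>.is_cring g \<rho>])
sublocale fiber: cring fiber by (rule fiber_cring)

lemma fiber_of_hom: "(\<lambda>c. fiber_of c) \<in> ring_hom C fiber"
  by (rule algebra_tensor_left_hom[OF B C \<kappa>.is_cring g \<rho>])

lemma fiber_scalar_hom: "fiber_scalar \<in> ring_hom \<kappa> fiber"
  by (rule algebra_tensor_right_hom[OF B C \<kappa>.is_cring g \<rho>])

lemma root_field_is_field: "field root_field" and singleton_hom: "(\<lambda>\<alpha>. [\<alpha>]) \<in> ring_hom \<kappa> root_field"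
  unfolding root_field_def using \<kappa>.inj_imp_image_ring_is_field[of "\<lambda>\<alpha>. [\<alpha>]"] inj_imp_image_ring_iso[of "\<lambda>\<alpha>. [\<alpha>]" \<kappa>]
  by (auto simp: ring_iso_def inj_on_def)
sublocale root_field: field root_field by (rule root_field_is_field)

lemma root_map_hom: "root_map \<in> ring_hom \<kappa> root_field"
  using ring_hom_trans[OF frob_\<kappa> singleton_hom] by (simp add: root_map_def comp_def)

lemma root_fiber_cring: "cring root_fiber"
  by (rule algebra_tensor_cring[OF \<kappa>.is_cring fiber_cring root_field.is_cring fiber_scalar_hom root_map_hom])
sublocale root_fiber: cring root_fiber by (rule root_fiber_cring)

lemma root_of_hom: "(\<lambda>x. root_class (frag_of (x, \<one>\<^bsub>root_field\<^esub>))) \<in> ring_hom fiber root_fiber"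
  by (rule algebra_tensor_left_hom[OF \<kappa>.is_cring fiber_cring root_field.is_cring fiber_scalar_hom root_map_hom])

lemma root_class_hom: "(\<lambda>z. root_class z) \<in> ring_hom (pair_ring fiber root_field) root_fiber"
  by (rule algebra_tensor_class_hom[OF \<kappa>.is_cring fiber_cring root_field.is_cring fiber_scalar_hom root_map_hom])

lemma frob_root: "frobenius p root_fiber \<in> ring_hom root_fiber root_fiber"
proof (rule frobenius_ring_hom[OF root_fiber_cring p])
  show "[p] \<cdot>\<^bsub>root_fiber\<^esub> \<one>\<^bsub>root_fiber\<^esub> = \<zero>\<^bsub>root_fiber\<^esub>"
    by (rule ring_hom_char[OF _ _ ring_hom_trans[OF fiber_of_hom root_of_hom] char_C])
       (simp_all add: C.ring_axioms root_fiber.ring_axioms)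
qed

lemma fiber_scalar_mult:
  assumes b: "b \<in> carrier B" and c: "c \<in> carrier C"
  shows "fiber_scalar (\<rho> b) \<otimes>\<^bsub>fiber\<^esub> fiber_of c = fiber_of (c \<otimes>\<^bsub>C\<^esub> g b)"
proof -
  have "fiber_scalar (\<rho> b) \<otimes>\<^bsub>fiber\<^esub> fiber_of c = fiber_class (frag_of (\<one>\<^bsub>C\<^esub>, \<rho> b) \<otimes>\<^bsub>pair_ring C \<kappa>\<^esub> frag_of (c, \<one>\<^bsub>\<kappa>\<^esub>))"
    using b c ring_hom_closed[OF \<rho>]
      ring_hom_mult[OF algebra_tensor_class_hom[OF B C \<kappa>.is_cring g \<rho>], of "frag_of (\<one>\<^bsub>C\<^esub>, \<rho> b)" "frag_of (c, \<one>\<^bsub>\<kappa>\<^esub>)"]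
    by (simp add: algebra_tensor_right_def pair_ring_simps)
  also have "\<dots> = fiber_class (frag_of (c, \<rho> b \<otimes>\<^bsub>\<kappa>\<^esub> \<one>\<^bsub>\<kappa>\<^esub>))"
    using b c ring_hom_closed[OF \<rho>] by (simp add: pair_ring_mult)
  also have "\<dots> = fiber_of (g b \<otimes>\<^bsub>C\<^esub> c)"
    using b c by (intro algebra_tensor_balanced[OF B C \<kappa>.is_cring g \<rho>, symmetric]) auto
  finally show ?thesis using b c ring_hom_closed[OF g] by (simp add: C.m_comm)
qed

lemma fiber_of_extended_prime:
  assumes "c \<in> Idl\<^bsub>C\<^esub> (g ` P)"
  shows "fiber_of c = \<zero>\<^bsub>fiber\<^esub>"
proof (rule algebra_tensor_extended_ideal[OF B C \<kappa>.is_cring g \<rho> _ _ assms])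
  show "P \<subseteq> carrier B" using ideal.Icarr[OF primeideal.axioms(1)[OF P]] by (rule subsetI)
  then show "\<rho> b = \<zero>\<^bsub>\<kappa>\<^esub>" if "b \<in> P" for b
    using residue_map_eq_zero_iff[OF P] that by blast
qed

text \<open>The map that sends \<open>c \<otimes> b\<close> to the tensor of \<open>c \<otimes> 1\<close> with the \<open>p\<close>-th root of \<open>b\<close>.\<close>

definition root_lift :: "('c \<times> 'b \<Rightarrow>\<^sub>0 int) \<Rightarrow> _"
  where "root_lift = frag_extend (\<lambda>(c, b). frag_of (fiber_of c, [\<rho> b]))"

lemma root_lift_simps:
  "root_lift 0 = 0" "root_lift (frag_of (c, b)) = frag_of (fiber_of c, [\<rho> b])"
  "root_lift (z - w) = root_lift z - root_lift w"
  by (simp_all add: root_lift_def frag_extend_diff)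

lemma root_lift_keys:
  assumes "Poly_Mapping.keys z \<subseteq> carrier C \<times> carrier B"
  shows "Poly_Mapping.keys (root_lift z) \<subseteq> carrier fiber \<times> carrier root_field"
  using assms ring_hom_closed[OF fiber_of_hom] ring_hom_closed[OF \<rho>] ring_hom_closed[OF singleton_hom]
  by (induction z rule: frag_induction) (auto simp: root_lift_simps dest!: subsetD[OF keys_diff])

text \<open>Both sides are additive in \<open>z\<close>, the left one because Frobenius is. For a pure tensor \<open>c \<otimes> b\<close>, the
  \<open>p\<close>-th power turns the root of \<open>b\<close> into the scalar \<open>b\<close>, which moves across the tensor sign and
  multiplies \<open>c\<^sup>p\<close>.\<close>

lemma root_lift_power:
  assumes "Poly_Mapping.keys z \<subseteq> carrier C \<times> carrier B"
  shows "root_class (root_lift z) [^]\<^bsub>root_fiber\<^esub> p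
       = root_class (frag_of (fiber_of (relative_frobenius z), \<one>\<^bsub>root_field\<^esub>))"
proof -
  let ?root_of = "\<lambda>c. root_class (frag_of (fiber_of c, \<one>\<^bsub>root_field\<^esub>))"
  have hom: "?root_of \<in> ring_hom C root_fiber"
    using ring_hom_trans[OF fiber_of_hom root_of_hom] by (simp add: comp_def)
  have Pr: "ring (pair_ring fiber root_field)"
    by (rule cring.axioms(1)[OF pair_ring_cring[OF fiber_cring root_field.is_cring]])
  note power_minus = ring_hom_minus[OF root_fiber.ring_axioms root_fiber.ring_axioms frob_root, unfolded frobenius_def]
  have cl: "root_class w \<in> carrier root_fiber" if "Poly_Mapping.keys w \<subseteq> carrier fiber \<times> carrier root_field" for w
    using ring_hom_closed[OF root_class_hom, of w] that by (simp add: pair_ring_simps)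
  show ?thesis
    using assms
  proof (induction z rule: free_Abelian_group_induct[consumes 1, case_names zero diff one])
    case zero
    have "root_class 0 = \<zero>\<^bsub>root_fiber\<^esub>"
      using ring_hom_zero[OF root_class_hom Pr root_fiber.ring_axioms] by (simp add: pair_ring_simps)
    then show ?case
      using ring_hom_zero[OF hom C.ring_axioms root_fiber.ring_axioms]  prime_gt_0_nat[OF p]
      by (simp add: root_lift_simps relative_frobenius_zero root_fiber.nat_pow_zero)
  next
    case (diff z w)
    have "root_class (root_lift (z - w)) = root_class (root_lift z) \<ominus>\<^bsub>root_fiber\<^esub> root_class (root_lift w)"
      using ring_hom_minus[OF Pr root_fiber.ring_axioms root_class_hom, of "root_lift z" "root_lift w"]
        root_lift_keys diff(1,2) pair_ring_minus(2)[OF fiber_cring root_field.is_cring]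
      by (simp add: root_lift_simps pair_ring_simps)
    then show ?case
      using diff power_minus[OF cl cl] root_lift_keys ring_hom_minus[OF C.ring_axioms root_fiber.ring_axioms hom]
      by (simp add: relative_frobenius_diff relative_frobenius_closed)
  next
    case (one k)
    then obtain c b where k: "k = (c, b)" "c \<in> carrier C" "b \<in> carrier B" by blast
    have \<rho>b: "\<rho> b \<in> carrier \<kappa>" using k ring_hom_closed[OF \<rho>] by blast
    have fc: "fiber_of c' \<in> carrier fiber" if "c' \<in> carrier C" for c' using that ring_hom_closed[OF fiber_of_hom] by blast
    have "root_class (root_lift (frag_of k)) [^]\<^bsub>root_fiber\<^esub> p
        = root_class (frag_of (fiber_of c [^]\<^bsub>fiber\<^esub> p, [\<rho> b] [^]\<^bsub>root_field\<^esub> p))"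
      using ring_hom_nat_pow[OF Pr root_fiber.ring_axioms root_class_hom, of "frag_of (fiber_of c, [\<rho> b])" p]
        k fc \<rho>b ring_hom_closed[OF singleton_hom]
      by (simp add: root_lift_simps frag_of_pow pair_ring_simps)
    also have "fiber_of c [^]\<^bsub>fiber\<^esub> p = fiber_of (c [^]\<^bsub>C\<^esub> p)"
      using ring_hom_nat_pow[OF C.ring_axioms fiber.ring_axioms fiber_of_hom] k by simp
    also have "[\<rho> b] [^]\<^bsub>root_field\<^esub> p = root_map (\<rho> b)"
      using ring_hom_nat_pow[OF \<kappa>.ring_axioms root_field.ring_axioms singleton_hom \<rho>b, of p]
      by (simp add: root_map_def frobenius_def)
    also have "\<dots> = root_map (\<rho> b) \<otimes>\<^bsub>root_field\<^esub> \<one>\<^bsub>root_field\<^esub>"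
      using ring_hom_closed[OF root_map_hom \<rho>b] by simp
    also have "root_class (frag_of (fiber_of (c [^]\<^bsub>C\<^esub> p), root_map (\<rho> b) \<otimes>\<^bsub>root_field\<^esub> \<one>\<^bsub>root_field\<^esub>))
        = root_class (frag_of (fiber_scalar (\<rho> b) \<otimes>\<^bsub>fiber\<^esub> fiber_of (c [^]\<^bsub>C\<^esub> p), \<one>\<^bsub>root_field\<^esub>))"
      using k fc \<rho>b
      by (intro algebra_tensor_balanced[OF \<kappa>.is_cring fiber_cring root_field.is_cring fiber_scalar_hom root_map_hom, symmetric]) auto
    also have "fiber_scalar (\<rho> b) \<otimes>\<^bsub>fiber\<^esub> fiber_of (c [^]\<^bsub>C\<^esub> p) = fiber_of (relative_frobenius (frag_of k))"
      using k by (simp add: fiber_scalar_mult relative_frobenius_of)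
    finally show ?case .
  qed
qed

text \<open>The map from \<open>C \<otimes> \<kappa>\<close> to \<open>C \<otimes> F\<^sub>*\<kappa>\<close> that sends \<open>c \<otimes> \<alpha>\<close> to \<open>c \<otimes> \<alpha>\<^sup>p\<beta>\<close>.\<close>

definition twist :: "_ \<Rightarrow> ('c \<times> _ \<Rightarrow>\<^sub>0 int) \<Rightarrow> _"
  where "twist \<beta> = push (\<lambda>\<alpha>. \<alpha> [^]\<^bsub>\<kappa>\<^esub> p \<otimes>\<^bsub>\<kappa>\<^esub> \<beta>)"

text \<open>The comparison map from \<open>(C \<otimes> \<kappa>) \<otimes> \<kappa>\<^sup>1\<^sup>/\<^sup>p\<close> to \<open>C \<otimes> F\<^sub>*\<kappa>\<close>. The first component of a pair is a
  class, of which an arbitrary representative is taken; another choice changes the value by relations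
  only.\<close>

definition contract
  where "contract = frag_extend (\<lambda>(X, l). twist (hd l) (SOME z. z \<in> X))"

abbreviation "residue_relations \<equiv> tensor_subgroup B C\<^sub>B F\<kappa>"

lemma twist_tensor:
  assumes \<beta>: "\<beta> \<in> carrier \<kappa>" and z: "z \<in> tensor_subgroup B C\<^sub>B (restrict_scalars \<rho> \<kappa>)"
  shows "twist \<beta> z \<in> residue_relations"
  unfolding twist_def
proof (rule push_tensor_subgroup[OF module_C module_\<kappa> module_F\<kappa> _ z])
  have add: "(x \<oplus>\<^bsub>\<kappa>\<^esub> y) [^]\<^bsub>\<kappa>\<^esub> p = x [^]\<^bsub>\<kappa>\<^esub> p \<oplus>\<^bsub>\<kappa>\<^esub> y [^]\<^bsub>\<kappa>\<^esub> p" if "x \<in> carrier \<kappa>" "y \<in> carrier \<kappa>" for x y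
    using ring_hom_add[OF frob_\<kappa> that] by (simp add: frobenius_def)
  show "(\<lambda>\<alpha>. \<alpha> [^]\<^bsub>\<kappa>\<^esub> p \<otimes>\<^bsub>\<kappa>\<^esub> \<beta>) \<in> module_homs B (restrict_scalars \<rho> \<kappa>) F\<kappa>"
    using \<beta> ring_hom_closed[OF \<rho>]
    by (auto simp: module_homs_iff restrict_scalars_simps add \<kappa>.l_distr frobenius_def \<kappa>.nat_pow_distrib \<kappa>.m_assoc)
qed

text \<open>Of the three kinds of relation, additivity in the first component compares the chosen
  representative of a sum with the sum of the chosen ones, which have the same class. Additivity in
  the second component holds summand by summand. The relation for a scalar \<open>r\<close> is respected because
  \<open>r\<close> contributes \<open>r\<^sup>p\<close> on both sides: on the left by \<open>(r\<alpha>)\<^sup>p = r\<^sup>p\<alpha>\<^sup>p\<close>, on the right by the embedding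
  of \<open>\<kappa>\<close> in its extension.\<close>

lemma contract_tensor:
  assumes "w \<in> tensor_subgroup \<kappa> (restrict_scalars fiber_scalar fiber) (restrict_scalars root_map root_field)"
  shows "contract w \<in> residue_relations"
proof -
  note MF = module_restrict_scalars[OF \<kappa>.is_cring fiber_cring fiber_scalar_hom]
    and MK = module_restrict_scalars[OF \<kappa>.is_cring root_field.is_cring root_map_hom]
  note class_iff = algebra_tensor_class_eq_iff[OF B C \<kappa>.is_cring g \<rho>]
  note tensor_rules = tensor_subgroup_zero[OF module_C module_F\<kappa>] tensor_subgroup_diff[OF module_C module_F\<kappa>]
  have contract: "contract 0 = 0" "contract (w - w') = contract w - contract w'"
    "contract (frag_of (X, l)) = twist (hd l) (SOME z. z \<in> X)" for w w' X l
    by (simp_all add: contract_def frag_extend_diff)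
  have rep: "fiber_class (SOME z. z \<in> X) = X" "Poly_Mapping.keys (SOME z. z \<in> X) \<subseteq> carrier C \<times> carrier \<kappa>"
    if X: "X \<in> carrier fiber" for X
  proof -
    obtain z where z: "X = fiber_class z" "Poly_Mapping.keys z \<subseteq> carrier C \<times> carrier \<kappa>"
      using X unfolding algebra_tensor_carrier[OF B C \<kappa>.is_cring g \<rho>]
      by (elim CollectE exE conjE) (rule that)
    have "z \<in> X"
      unfolding z(1) by (rule algebra_tensor_class_self[OF B C \<kappa>.is_cring g \<rho> z(2)])
    then have "(SOME z. z \<in> X) \<in> X" by (rule someI)
    from algebra_tensor_class_keys[OF B C \<kappa>.is_cring g \<rho> X this]
    show "fiber_class (SOME z. z \<in> X) = X" "Poly_Mapping.keys (SOME z. z \<in> X) \<subseteq> carrier C \<times> carrier \<kappa>"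
      by simp_all
  qed
  have twist_eq: "twist \<beta> z - twist \<beta> z' \<in> residue_relations"
    if "\<beta> \<in> carrier \<kappa>" "fiber_class z = fiber_class z'" "Poly_Mapping.keys z \<subseteq> carrier C \<times> carrier \<kappa>"
      "Poly_Mapping.keys z' \<subseteq> carrier C \<times> carrier \<kappa>" for \<beta> z z'
    using twist_tensor[OF that(1), of "z - z'"] class_iff[OF that(3,4)] that(2) by (simp add: twist_def)
  have hd_root_field: "hd l \<in> carrier \<kappa>" "l = [hd l]" if "l \<in> carrier root_field" for l
    using that by (auto simp: root_field_def image_ring_carrier)
  have hd_add: "hd (l \<oplus>\<^bsub>root_field\<^esub> l') = hd l \<oplus>\<^bsub>\<kappa>\<^esub> hd l'" and hd_mult: "hd (l \<otimes>\<^bsub>root_field\<^esub> l') = hd l \<otimes>\<^bsub>\<kappa>\<^esub> hd l'"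
    if l: "l \<in> carrier root_field" "l' \<in> carrier root_field" for l l'
    using ring_hom_add[OF singleton_hom hd_root_field(1)[OF l(1)] hd_root_field(1)[OF l(2)]]
      ring_hom_mult[OF singleton_hom hd_root_field(1)[OF l(1)] hd_root_field(1)[OF l(2)]] hd_root_field(2)[OF l(1)] hd_root_field(2)[OF l(2)]
    by (metis list.sel(1))+
  have class_add: "fiber_class (z + z') = fiber_class z \<oplus>\<^bsub>fiber\<^esub> fiber_class z'"
    and class_mult: "fiber_class (z \<otimes>\<^bsub>pair_ring C \<kappa>\<^esub> z') = fiber_class z \<otimes>\<^bsub>fiber\<^esub> fiber_class z'"
    if "Poly_Mapping.keys z \<subseteq> carrier C \<times> carrier \<kappa>" "Poly_Mapping.keys z' \<subseteq> carrier C \<times> carrier \<kappa>" for z z'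
    using that ring_hom_add[OF algebra_tensor_class_hom[OF B C \<kappa>.is_cring g \<rho>], of z z']
      ring_hom_mult[OF algebra_tensor_class_hom[OF B C \<kappa>.is_cring g \<rho>], of z z']
    by (simp_all add: pair_ring_simps)
  show ?thesis
    using assms
  proof (induction rule: tensor_subgroup_induct[OF MF MK, consumes 1, case_names zero diff add_left add_right balanced])
    case zero
    then show ?case by (simp add: contract tensor_rules)
  next
    case (diff z w)
    then show ?case by (simp add: contract tensor_rules)
  next
    case (add_left X Y l)
    then have X: "X \<in> carrier fiber" and Y: "Y \<in> carrier fiber" and l: "l \<in> carrier root_field"
      by (simp_all add: restrict_scalars_simps)
    let ?z = "\<lambda>X. SOME z. z \<in> X"
    have XY: "X \<oplus>\<^bsub>fiber\<^esub> Y \<in> carrier fiber" using X Y by simp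
    have "twist (hd l) (?z (X \<oplus>\<^bsub>fiber\<^esub> Y)) - twist (hd l) (?z X + ?z Y) \<in> residue_relations"
      by (rule twist_eq[OF hd_root_field(1)[OF l]])
         (simp_all add: rep(1)[OF XY] rep(1)[OF X] rep(1)[OF Y] rep(2)[OF XY]
            class_add[OF rep(2)[OF X] rep(2)[OF Y]] keys_add_subset[OF rep(2)[OF X] rep(2)[OF Y]])
    then have "twist (hd l) (?z (X \<oplus>\<^bsub>fiber\<^esub> Y)) - twist (hd l) (?z X) - twist (hd l) (?z Y) \<in> residue_relations"
      by (simp add: twist_def diff_diff_eq)
    then show ?case by (simp add: contract restrict_scalars_simps)
  next
    case (add_right X l l')
    then have X: "X \<in> carrier fiber" and l: "l \<in> carrier root_field" "l' \<in> carrier root_field"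
      by (simp_all add: restrict_scalars_simps)
    have "twist (\<beta> \<oplus>\<^bsub>\<kappa>\<^esub> \<gamma>) z - twist \<beta> z - twist \<gamma> z \<in> residue_relations"
      if \<beta>: "\<beta> \<in> carrier \<kappa>" "\<gamma> \<in> carrier \<kappa>" and z: "Poly_Mapping.keys z \<subseteq> carrier C \<times> carrier \<kappa>" for \<beta> \<gamma> z
      using z
    proof (induction z rule: frag_induction)
      case zero
      then show ?case by (simp add: twist_def tensor_rules)
    next
      case (one k)
      then obtain c \<alpha> where k: "k = (c, \<alpha>)" "c \<in> carrier C" "\<alpha> \<in> carrier \<kappa>" by auto
      then show ?case
        using \<beta> tensor_add_right[OF module_C module_F\<kappa>, of c "\<alpha> [^]\<^bsub>\<kappa>\<^esub> p \<otimes>\<^bsub>\<kappa>\<^esub> \<beta>" "\<alpha> [^]\<^bsub>\<kappa>\<^esub> p \<otimes>\<^bsub>\<kappa>\<^esub> \<gamma>"]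
        by (simp add: twist_def restrict_scalars_simps \<kappa>.r_distr)
    next
      case (diff a b)
      from tensor_rules(2)[OF this] show ?case by (simp add: twist_def algebra_simps)
    qed
    from this[OF hd_root_field(1)[OF l(1)] hd_root_field(1)[OF l(2)] rep(2)[OF X]]
    show ?case by (simp add: contract restrict_scalars_simps hd_add[OF l])
  next
    case (balanced r X l)
    then have r: "r \<in> carrier \<kappa>" and X: "X \<in> carrier fiber" and l: "l \<in> carrier root_field"
      by (simp_all add: restrict_scalars_simps)
    let ?z = "SOME z. z \<in> X"
    have rX: "fiber_scalar r \<otimes>\<^bsub>fiber\<^esub> X \<in> carrier fiber"
      using r X ring_hom_closed[OF fiber_scalar_hom] by simp
    \<comment> \<open>The product of \<open>1 \<otimes> r\<close> with the representative of \<open>X\<close> is a second representative of \<open>rX\<close>, on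
      which the twist can be computed.\<close>
    define w where "w = frag_of (\<one>\<^bsub>C\<^esub>, r) \<otimes>\<^bsub>pair_ring C \<kappa>\<^esub> ?z"
    have w_class: "fiber_class w = fiber_scalar r \<otimes>\<^bsub>fiber\<^esub> X"
      unfolding w_def using class_mult[OF _ rep(2)[OF X], of "frag_of (\<one>\<^bsub>C\<^esub>, r)"] r rep(1)[OF X]
      by (simp add: algebra_tensor_right_def)
    interpret PR: cring "pair_ring C \<kappa>" by (rule pair_ring_cring[OF C \<kappa>.is_cring])
    have w_keys: "Poly_Mapping.keys w \<subseteq> carrier C \<times> carrier \<kappa>"
      unfolding w_def using PR.m_closed[of "frag_of (\<one>\<^bsub>C\<^esub>, r)" ?z] r rep(2)[OF X] by (simp add: pair_ring_simps)
    have el: "root_map r \<otimes>\<^bsub>root_field\<^esub> l \<in> carrier root_field" "hd (root_map r \<otimes>\<^bsub>root_field\<^esub> l) = r [^]\<^bsub>\<kappa>\<^esub> p \<otimes>\<^bsub>\<kappa>\<^esub> hd l"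
      using hd_mult[OF ring_hom_closed[OF root_map_hom r] l] ring_hom_closed[OF root_map_hom r] l
      by (simp_all add: root_map_def frobenius_def)
    have "twist \<beta> (frag_of (\<one>\<^bsub>C\<^esub>, r) \<otimes>\<^bsub>pair_ring C \<kappa>\<^esub> z) = twist (r [^]\<^bsub>\<kappa>\<^esub> p \<otimes>\<^bsub>\<kappa>\<^esub> \<beta>) z"
      if \<beta>: "\<beta> \<in> carrier \<kappa>" and z: "Poly_Mapping.keys z \<subseteq> carrier C \<times> carrier \<kappa>" for \<beta> z
      using z
    proof (induction z rule: frag_induction)
      case (one k)
      then show ?case using r \<beta> by (auto simp: twist_def pair_ring_mult \<kappa>.nat_pow_distrib \<kappa>.m_ac)
    qed (simp_all add: twist_def pair_ring_mult)
    from this[OF hd_root_field(1)[OF l] rep(2)[OF X]]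
    have "twist (hd l) w = twist (hd (root_map r \<otimes>\<^bsub>root_field\<^esub> l)) ?z" by (simp add: w_def el)
    moreover have "twist (hd l) (SOME z. z \<in> fiber_scalar r \<otimes>\<^bsub>fiber\<^esub> X) - twist (hd l) w \<in> residue_relations"
      by (rule twist_eq[OF hd_root_field(1)[OF l] _ rep(2)[OF rX] w_keys]) (simp add: rep(1)[OF rX] w_class)
    ultimately show ?case by (simp add: contract restrict_scalars_simps)
  qed
qed

lemma contract_root_lift:
  assumes "Poly_Mapping.keys z \<subseteq> carrier C \<times> carrier B"
  shows "contract (root_lift z) - push \<rho> z \<in> residue_relations"
  using assms
proof (induction z rule: frag_induction)
  case zero
  then show ?case by (simp add: contract_def root_lift_simps tensor_subgroup_zero[OF module_C module_F\<kappa>])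
next
  case (one k)
  then obtain c b where k: "k = (c, b)" "c \<in> carrier C" "b \<in> carrier B" by auto
  have \<rho>b: "\<rho> b \<in> carrier \<kappa>" using k ring_hom_closed[OF \<rho>] by blast
  let ?z = "SOME z. z \<in> fiber_of c"
  have ck: "Poly_Mapping.keys (frag_of (c, \<one>\<^bsub>\<kappa>\<^esub>)) \<subseteq> carrier C \<times> carrier \<kappa>" using k by simp
  have "?z \<in> fiber_of c"
    using algebra_tensor_class_self[OF B C \<kappa>.is_cring g \<rho> ck] by (rule someI)
  from algebra_tensor_class_keys[OF B C \<kappa>.is_cring g \<rho> ring_hom_closed[OF fiber_of_hom k(2)] this]
  have z: "Poly_Mapping.keys ?z \<subseteq> carrier C \<times> carrier \<kappa>" "fiber_of c = fiber_class ?z"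
    by blast+
  then have "?z - frag_of (c, \<one>\<^bsub>\<kappa>\<^esub>) \<in> tensor_subgroup B C\<^sub>B (restrict_scalars \<rho> \<kappa>)"
    using algebra_tensor_class_eq_iff[OF B C \<kappa>.is_cring g \<rho> z(1) ck] by simp
  from twist_tensor[OF \<rho>b this] show ?case
    using k \<rho>b by (simp add: contract_def root_lift_simps twist_def)
next
  case (diff a b)
  from tensor_subgroup_diff[OF module_C module_F\<kappa> this] show ?case
    by (simp add: contract_def frag_extend_diff root_lift_simps algebra_simps)
qed

text \<open>By \<open>root_lift_power\<close> the image of \<open>z\<close> in \<open>(C \<otimes> \<kappa>) \<otimes> \<kappa>\<^sup>1\<^sup>/\<^sup>p\<close> is nilpotent, hence zero. Contracting,
  \<open>z\<close> vanishes in \<open>C \<otimes> F\<^sub>*\<kappa>\<close>, and flatness applies to \<open>F\<^sub>*B \<rightarrow> F\<^sub>*\<kappa>\<close>, whose kernel is \<open>P\<close>.\<close>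

lemma relative_frobenius_fiber_kernel:
  assumes flat: "flat_module B C\<^sub>B" and red: "geometrically_reduced \<kappa> fiber fiber_scalar"
    and z: "Poly_Mapping.keys z \<subseteq> carrier C \<times> carrier B"
    and rel: "relative_frobenius z \<in> Idl\<^bsub>C\<^esub> (g ` P)"
  shows "z \<in> tensor_image B C\<^sub>B F\<^sub>B P"
proof -
  note keys = root_lift_keys[OF z]
  have "root_class (root_lift z) [^]\<^bsub>root_fiber\<^esub> p = \<zero>\<^bsub>root_fiber\<^esub>"
    using root_lift_power[OF z] fiber_of_extended_prime[OF rel]
      ring_hom_zero[OF root_of_hom fiber.ring_axioms root_fiber.ring_axioms] by simp
  moreover have "reduced_ring root_fiber"
    using red root_field_is_field root_map_hom unfolding geometrically_reduced_def by blast
  moreover have "root_class (root_lift z) \<in> carrier root_fiber"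
    using ring_hom_closed[OF root_class_hom] keys by (simp add: pair_ring_simps)
  ultimately have "root_class (root_lift z) = \<zero>\<^bsub>root_fiber\<^esub>"
    unfolding reduced_ring_def by blast
  also have "\<dots> = root_class 0"
    using ring_hom_zero[OF root_class_hom cring.axioms(1)[OF pair_ring_cring[OF fiber_cring root_field.is_cring]] root_fiber.ring_axioms]
    by (simp add: pair_ring_simps)
  finally have "root_lift z \<in> tensor_subgroup \<kappa> (restrict_scalars fiber_scalar fiber) (restrict_scalars root_map root_field)"
    using algebra_tensor_class_eq_iff[OF \<kappa>.is_cring fiber_cring root_field.is_cring fiber_scalar_hom root_map_hom keys, of 0] by simp
  then have "contract (root_lift z) \<in> residue_relations" by (rule contract_tensor)
  from tensor_subgroup_diff[OF module_C module_F\<kappa> this contract_root_lift[OF z]]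
  have push: "push \<rho> z \<in> residue_relations" by simp
  obtain \<iota> :: "_ \<Rightarrow> 'b list" where \<iota>: "inj_on \<iota> (carrier \<kappa>)"
    using residue_field_inj_list[OF P] by blast
  have hom: "\<rho> \<in> module_homs B F\<^sub>B F\<kappa>"
    using ring_hom_closed[OF \<rho>] ring_hom_add[OF \<rho>] ring_hom_mult[OF \<rho>] ring_hom_closed[OF frob_B]
      ring_hom_nat_pow[OF B.ring_axioms \<kappa>.ring_axioms \<rho>]
    by (simp add: module_homs_iff restrict_scalars_simps frobenius_def)
  have "z \<in> tensor_image B C\<^sub>B F\<^sub>B {x \<in> carrier F\<^sub>B. \<rho> x = \<zero>\<^bsub>F\<kappa>\<^esub>}"
    by (rule flat_tensor_kernel[OF flat module_C module_F module_F\<kappa> _ _ hom _ push, of "\<lambda>x. [x]" \<iota>])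
       (use z \<iota> in \<open>auto simp: restrict_scalars_simps inj_on_def\<close>)
  moreover have "{x \<in> carrier F\<^sub>B. \<rho> x = \<zero>\<^bsub>F\<kappa>\<^esub>} = P"
    using residue_map_eq_zero_iff[OF P] ideal.Icarr[OF primeideal.axioms(1)[OF P]]
    by (auto simp: restrict_scalars_simps)
  ultimately show ?thesis by simp
qed

end

section \<open>Maximal ideals in families and associated primes\<close>

lemma (in noetherian_ring) exists_maximal_ideal_in:
  assumes "\<S> \<noteq> {}" "\<S> \<subseteq> {I. ideal I R}"
  shows "\<exists>M\<in>\<S>. \<forall>J\<in>\<S>. M \<subseteq> J \<longrightarrow> J = M"
proof (rule subset_Zorn)
  fix Ch assume Ch: "subset.chain \<S> Ch"
  show "\<exists>U\<in>\<S>. \<forall>X\<in>Ch. X \<subseteq> U"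
  proof (cases "Ch = {}")
    case True
    then show ?thesis using assms(1) by blast
  next
    case False
    have sub: "Ch \<subseteq> \<S>" using Ch unfolding pred_on.chain_def by (rule conjunct1)
    have "subset.chain {I. ideal I R} Ch"
      using Ch subset_trans[OF sub assms(2)] unfolding pred_on.chain_def by simp
    then have "\<Union>Ch \<in> Ch" by (rule ideal_chain_is_trivial[OF False])
    then show ?thesis using sub by (intro bexI[of _ "\<Union>Ch"]) auto
  qed
qed

lemma (in cring) colon_ideal:
  assumes I: "ideal I R" and a: "a \<in> carrier R"
  shows "ideal {r \<in> carrier R. a \<otimes> r \<in> I} R"
proof -
  interpret I: ideal I R by fact
  show ?thesis
  proof (rule idealI[OF ring_axioms])
    show "subgroup {r \<in> carrier R. a \<otimes> r \<in> I} (add_monoid R)"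
      by (rule add.subgroupI) (use a I.zero_closed in \<open>auto simp: r_distr r_minus intro: I.a_closed\<close>)
    fix r x assume r: "r \<in> {r \<in> carrier R. a \<otimes> r \<in> I}" and x: "x \<in> carrier R"
    then have "a \<otimes> r \<otimes> x \<in> I" using I.I_r_closed by blast
    then show "r \<otimes> x \<in> {r \<in> carrier R. a \<otimes> r \<in> I}" "x \<otimes> r \<in> {r \<in> carrier R. a \<otimes> r \<in> I}"
      using r x a by (auto simp: m_ac)
  qed
qed

text \<open>A maximal one among the ideals \<open>(I : a)\<close> with \<open>a\<close> outside \<open>I\<close> is prime: if \<open>xy\<close> lies in it and \<open>y\<close>
  does not, then \<open>(I : ay)\<close> contains \<open>(I : a)\<close>, hence equals it, and \<open>x\<close> lies in \<open>(I : ay)\<close>.\<close>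

lemma exists_associated_prime:
  assumes noeth: "noetherian_ring R" and cring: "cring R" and I: "ideal I R" and proper: "I \<noteq> carrier R"
  shows "\<exists>a \<in> carrier R - I. primeideal {r \<in> carrier R. a \<otimes>\<^bsub>R\<^esub> r \<in> I} R"
proof -
  interpret cring R by fact
  interpret I: ideal I R by fact
  let ?colon = "\<lambda>a. {r \<in> carrier R. a \<otimes>\<^bsub>R\<^esub> r \<in> I}"
  have "carrier R - I \<noteq> {}" using proper I.a_subset by blast
  then have "?colon ` (carrier R - I) \<noteq> {}" by simp
  moreover have "?colon ` (carrier R - I) \<subseteq> {J. ideal J R}" using colon_ideal[OF I] by blast
  ultimately have "\<exists>M\<in>?colon ` (carrier R - I). \<forall>J\<in>?colon ` (carrier R - I). M \<subseteq> J \<longrightarrow> J = M"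
    by (rule noetherian_ring.exists_maximal_ideal_in[OF noeth])
  then obtain M where M: "M \<in> ?colon ` (carrier R - I)"
    and maximal: "\<forall>J\<in>?colon ` (carrier R - I). M \<subseteq> J \<longrightarrow> J = M" by (rule bexE)
  from M obtain a where Ma: "M = ?colon a" and "a \<in> carrier R - I" by (rule imageE)
  then have a: "a \<in> carrier R" "a \<notin> I" by simp_all
  have max: "?colon b = ?colon a" if "b \<in> carrier R - I" "?colon a \<subseteq> ?colon b" for b
    using bspec[OF maximal imageI[OF that(1)]] that(2) unfolding Ma by (rule mp)
  have "primeideal (?colon a) R"
  proof (rule primeidealI[OF colon_ideal[OF I a(1)] cring])
    have "\<one>\<^bsub>R\<^esub> \<notin> ?colon a" using a by simp
    then show "carrier R \<noteq> ?colon a" using one_closed by metis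
    fix x y assume x: "x \<in> carrier R" and y: "y \<in> carrier R" and xy: "x \<otimes>\<^bsub>R\<^esub> y \<in> ?colon a"
    show "x \<in> ?colon a \<or> y \<in> ?colon a"
    proof (cases "y \<in> ?colon a")
      case False
      have sub: "?colon a \<subseteq> ?colon (a \<otimes>\<^bsub>R\<^esub> y)"
      proof
        fix r assume r: "r \<in> ?colon a"
        then have "(a \<otimes>\<^bsub>R\<^esub> r) \<otimes>\<^bsub>R\<^esub> y \<in> I" using I.I_r_closed[OF _ y] by blast
        then show "r \<in> ?colon (a \<otimes>\<^bsub>R\<^esub> y)" using r y a by (auto simp: m_ac)
      qed
      have "a \<otimes>\<^bsub>R\<^esub> y \<in> carrier R - I" using False y a by simp
      from max[OF this sub] have "?colon (a \<otimes>\<^bsub>R\<^esub> y) = ?colon a" .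
      moreover have "x \<in> ?colon (a \<otimes>\<^bsub>R\<^esub> y)" using xy x y a by (auto simp: m_ac)
      ultimately show ?thesis by simp
    qed simp
  qed
  then show ?thesis using a by (intro bexI[of _ a]) simp_all
qed

section \<open>Injectivity of the relative Frobenius\<close>

context char_p_hom
begin

abbreviation "extended I \<equiv> Idl\<^bsub>C\<^esub> (g ` I)"

lemma extended_ideal: "I \<subseteq> carrier B \<Longrightarrow> ideal (extended I) C"
  using ring_hom_closed[OF g] by (intro C.genideal_ideal) auto

lemma relative_frobenius_tensor_subgroup:
  assumes "z \<in> tensor_subgroup B C\<^sub>B F\<^sub>B"
  shows "relative_frobenius z = \<zero>\<^bsub>C\<^esub>"
proof -
  have add: "(x \<oplus>\<^bsub>C\<^esub> y) [^]\<^bsub>C\<^esub> p = x [^]\<^bsub>C\<^esub> p \<oplus>\<^bsub>C\<^esub> y [^]\<^bsub>C\<^esub> p" if "x \<in> carrier C" "y \<in> carrier C" for x y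
    using ring_hom_add[OF frob_C that] by (simp add: frobenius_def)
  have f: "(\<lambda>(c, b). c [^]\<^bsub>C\<^esub> p \<otimes>\<^bsub>C\<^esub> g b) ` (carrier C \<times> carrier B) \<subseteq> carrier C"
    using ring_hom_closed[OF g] by auto
  show ?thesis
    unfolding relative_frobenius_def
    by (rule frag_eval_tensor_subgroup[OF module_C module_F C.ring_axioms, unfolded restrict_scalars_simps, OF f _ _ _ assms])
       (use ring_hom_closed[OF g] in \<open>simp_all add: ring_hom_add[OF g] ring_hom_mult[OF g] add C.l_distr C.r_distr
          C.m_ac C.nat_pow_distrib frobenius_def ring_hom_nat_pow[OF B.ring_axioms C.ring_axioms g]\<close>)
qed

lemma relative_frobenius_tensor_image:
  assumes I: "I \<subseteq> carrier B" and z: "z \<in> tensor_image B C\<^sub>B F\<^sub>B I"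
  shows "relative_frobenius z \<in> extended I"
proof -
  obtain w where zk: "Poly_Mapping.keys z \<subseteq> carrier C \<times> carrier B" and w: "Poly_Mapping.keys w \<subseteq> carrier C \<times> I"
    and zw: "z - w \<in> tensor_subgroup B C\<^sub>B F\<^sub>B"
    using z unfolding tensor_image_def restrict_scalars_simps by auto
  have wk: "Poly_Mapping.keys w \<subseteq> carrier C \<times> carrier B" using w I by auto
  have "relative_frobenius z \<ominus>\<^bsub>C\<^esub> relative_frobenius w = \<zero>\<^bsub>C\<^esub>"
    using relative_frobenius_tensor_subgroup[OF zw] relative_frobenius_diff[OF zk wk] by simp
  then have "relative_frobenius z = relative_frobenius w"
    using relative_frobenius_closed[OF zk] relative_frobenius_closed[OF wk] by (simp add: C.r_right_minus_eq)
  also have "\<dots> \<in> extended I"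
    unfolding relative_frobenius_def
  proof (rule frag_eval_in_ideal[OF C.ring_axioms _ extended_ideal[OF I] _ w])
    have gI: "g ` I \<subseteq> carrier C" using ring_hom_closed[OF g] I by auto
    show "(case k of (c, b) \<Rightarrow> c [^]\<^bsub>C\<^esub> p \<otimes>\<^bsub>C\<^esub> g b) \<in> extended I" if "k \<in> carrier C \<times> I" for k
      using that ideal_smult_image[OF C _ gI] by (cases k) auto
  qed (use ring_hom_closed[OF g] I in auto)
  finally show ?thesis .
qed

text \<open>Injectivity of the map from \<open>C \<otimes> F\<^sub>*(B/I)\<close> to \<open>C/IC\<close>, stated on \<open>C \<otimes> F\<^sub>*B\<close>.\<close>

definition injective_modulo :: "'b set \<Rightarrow> bool"
  where "injective_modulo I \<longleftrightarrow>
    (\<forall>z. Poly_Mapping.keys z \<subseteq> carrier C \<times> carrier B \<longrightarrow> relative_frobenius z \<in> extended I \<longrightarrow>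
         z \<in> tensor_image B C\<^sub>B F\<^sub>B I)"

lemma extended_mono: "\<lbrakk>I \<subseteq> J; J \<subseteq> carrier B\<rbrakk> \<Longrightarrow> extended I \<subseteq> extended J"
proof -
  assume IJ: "I \<subseteq> J" and J: "J \<subseteq> carrier B"
  have "g ` J \<subseteq> carrier C" using J ring_hom_closed[OF g] by auto
  then have "g ` I \<subseteq> extended J" using C.genideal_self IJ by blast
  then show ?thesis by (rule C.genideal_minimal[OF extended_ideal[OF J]])
qed

lemma relative_frobenius_push:
  assumes a: "a \<in> carrier B" and z: "Poly_Mapping.keys z \<subseteq> carrier C \<times> carrier B"
  shows "relative_frobenius (push (\<lambda>b. a \<otimes>\<^bsub>B\<^esub> b) z) = g a \<otimes>\<^bsub>C\<^esub> relative_frobenius z"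
  using z
proof (induction z rule: free_Abelian_group_induct[consumes 1, case_names zero diff one])
  case zero
  then show ?case using ring_hom_closed[OF g a] by (simp add: relative_frobenius_zero)
next
  case (diff z w)
  have im: "(\<lambda>b. a \<otimes>\<^bsub>B\<^esub> b) ` carrier B \<subseteq> carrier B" using a by auto
  show ?case
    using diff relative_frobenius_diff[OF keys_push[OF diff(1) im] keys_push[OF diff(2) im]] ring_hom_closed[OF g a]
      relative_frobenius_closed
    by (simp add: relative_frobenius_diff a_minus_def C.r_distr C.r_minus)
next
  case (one k)
  then show ?case
    using a ring_hom_closed[OF g] by (auto simp: relative_frobenius_of ring_hom_mult[OF g] C.m_ac)
qed

text \<open>This is the five lemma for \<open>0 \<rightarrow> B/(I : a) \<rightarrow> B/I \<rightarrow> B/J \<rightarrow> 0\<close>, whose first map is multiplication by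
  \<open>a\<close>. If \<open>z\<close> has image in \<open>IC\<close>, then \<open>z\<close> comes from \<open>C \<otimes> J\<close>, so it is \<open>av\<close> modulo \<open>C \<otimes> I\<close> for
  some \<open>v\<close>. The image of \<open>v\<close> lies in the extension of \<open>(I : a)\<close> by \<open>flat_colon\<close>; so \<open>v\<close> comes from
  \<open>C \<otimes> (I : a)\<close>, and \<open>av\<close> from \<open>C \<otimes> I\<close>.\<close>

lemma injective_modulo_extension:
  assumes flat: "flat_module B C\<^sub>B" and I: "ideal I B" and a: "a \<in> carrier B"
    and colon: "injective_modulo {r \<in> carrier B. a \<otimes>\<^bsub>B\<^esub> r \<in> I}"
    and J: "J = {x \<oplus>\<^bsub>B\<^esub> a \<otimes>\<^bsub>B\<^esub> y | x y. x \<in> I \<and> y \<in> carrier B}" and inj_J: "injective_modulo J"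
  shows "injective_modulo I"
  unfolding injective_modulo_def
proof (intro allI impI)
  interpret I: ideal I B by fact
  let ?T = "tensor_image B C\<^sub>B F\<^sub>B I" and ?K = "{r \<in> carrier B. a \<otimes>\<^bsub>B\<^esub> r \<in> I}"
  let ?\<mu> = "push (\<lambda>b. a \<otimes>\<^bsub>B\<^esub> b)"
  note T_diff = tensor_image_diff[OF module_C module_F, of _ I] and T_add = tensor_image_add[OF module_C module_F, of _ I]
    and T_sub = tensor_image_of_subgroup[OF module_C module_F, of _ I]
  have IB: "I \<subseteq> carrier B" by (rule I.a_subset)
  have IJ: "I \<subseteq> J" using a IB by (force simp: J intro: exI[of _ "\<zero>\<^bsub>B\<^esub>"])
  have JB: "J \<subseteq> carrier B" using a IB by (auto simp: J)
  have \<mu>_keys: "Poly_Mapping.keys (?\<mu> v) \<subseteq> carrier C \<times> carrier B" if "Poly_Mapping.keys v \<subseteq> carrier C \<times> carrier B" for v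
    by (rule keys_push[OF that]) (use a in auto)
  fix z assume z: "Poly_Mapping.keys z \<subseteq> carrier C \<times> carrier B" and rel: "relative_frobenius z \<in> extended I"
  then have "z \<in> tensor_image B C\<^sub>B F\<^sub>B J"
    using inj_J extended_mono[OF IJ JB] unfolding injective_modulo_def by blast
  then obtain w where w: "Poly_Mapping.keys w \<subseteq> carrier C \<times> J" and zw: "z - w \<in> tensor_subgroup B C\<^sub>B F\<^sub>B"
    unfolding tensor_image_def restrict_scalars_simps by blast
  \<comment> \<open>A generator \<open>c \<otimes> (x + ay)\<close> of the part coming from \<open>J\<close> is \<open>a(c \<otimes> y)\<close> up to \<open>c \<otimes> x\<close>, which comes
    from \<open>I\<close>.\<close>
  have "\<exists>v. Poly_Mapping.keys v \<subseteq> carrier C \<times> carrier B \<and> w - ?\<mu> v \<in> ?T"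
    using w
  proof (induction w rule: frag_induction)
    case zero
    then show ?case using T_sub[OF tensor_subgroup_zero[OF module_C module_F]] by (intro exI[of _ 0]) simp
  next
    case (one k)
    then obtain c x y where k: "k = (c, x \<oplus>\<^bsub>B\<^esub> a \<otimes>\<^bsub>B\<^esub> y)" "c \<in> carrier C" "x \<in> I" "y \<in> carrier B"
      by (auto simp: J)
    have x: "x \<in> carrier B" using k IB by blast
    have "frag_of k - frag_of (c, x) - frag_of (c, a \<otimes>\<^bsub>B\<^esub> y) \<in> ?T"
      using T_sub[OF tensor_add_right[OF module_C module_F, of c x "a \<otimes>\<^bsub>B\<^esub> y"]] k x a
      by (simp add: restrict_scalars_simps)
    moreover have "frag_of (c, x) \<in> ?T"
      using k IB by (intro tensor_image_of_keys[OF module_C module_F]) (auto simp: restrict_scalars_simps)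
    ultimately have "frag_of k - frag_of (c, x) - frag_of (c, a \<otimes>\<^bsub>B\<^esub> y) + frag_of (c, x) \<in> ?T"
      by (rule T_add)
    then show ?case using k by (intro exI[of _ "frag_of (c, y)"]) (simp add: algebra_simps)
  next
    case (diff u v)
    then obtain u' v' where *: "Poly_Mapping.keys u' \<subseteq> carrier C \<times> carrier B" "u - ?\<mu> u' \<in> ?T"
      "Poly_Mapping.keys v' \<subseteq> carrier C \<times> carrier B" "v - ?\<mu> v' \<in> ?T" by blast
    then have "(u - v) - ?\<mu> (u' - v') \<in> ?T"
      using T_diff[OF *(2,4)] by (simp add: algebra_simps)
    then show ?case using keys_diff_subset[OF *(1,3)] by blast
  qed
  then obtain v where v: "Poly_Mapping.keys v \<subseteq> carrier C \<times> carrier B" and wv: "w - ?\<mu> v \<in> ?T" by blast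
  have zv: "z - ?\<mu> v \<in> ?T"
    using T_add[OF T_sub[OF zw] wv] by simp
  have "g a \<otimes>\<^bsub>C\<^esub> relative_frobenius v = relative_frobenius z \<ominus>\<^bsub>C\<^esub> relative_frobenius (z - ?\<mu> v)"
  proof -
    have cl: "relative_frobenius z \<in> carrier C" "g a \<otimes>\<^bsub>C\<^esub> relative_frobenius v \<in> carrier C"
      using relative_frobenius_closed z v ring_hom_closed[OF g a] by auto
    then show ?thesis
      using relative_frobenius_diff[OF z \<mu>_keys[OF v]]
      by (simp add: relative_frobenius_push[OF a v] a_minus_def C.minus_add C.r_neg2 C.a_comm)
  qed
  moreover have "relative_frobenius (z - ?\<mu> v) \<in> extended I"
    by (rule relative_frobenius_tensor_image[OF IB zv])
  ultimately have "g a \<otimes>\<^bsub>C\<^esub> relative_frobenius v \<in> extended I"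
  proof -
    interpret E: ideal "extended I" C by (rule extended_ideal[OF IB])
    assume "g a \<otimes>\<^bsub>C\<^esub> relative_frobenius v = relative_frobenius z \<ominus>\<^bsub>C\<^esub> relative_frobenius (z - ?\<mu> v)"
      and "relative_frobenius (z - ?\<mu> v) \<in> extended I"
    then show ?thesis using rel by (simp add: a_minus_def)
  qed
  then have "relative_frobenius v \<in> extended ?K"
    by (rule flat_colon[OF B C g flat I a relative_frobenius_closed[OF v]])
  then have vK: "v \<in> tensor_image B C\<^sub>B F\<^sub>B ?K"
    using colon v unfolding injective_modulo_def by blast
  have "?\<mu> v \<in> ?T"
  proof (rule tensor_image_push[OF module_C module_F module_F _ vK])
    show "(\<lambda>b. a \<otimes>\<^bsub>B\<^esub> b) \<in> module_homs B F\<^sub>B F\<^sub>B"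
      using a ring_hom_closed[OF frob_B] by (simp add: module_homs_iff restrict_scalars_simps B.r_distr B.m_lcomm)
  qed auto
  from T_add[OF zv this] show "z \<in> ?T" by simp
qed

text \<open>Let \<open>M\<close> be maximal among the ideals that violate the claim, and \<open>(M : a)\<close> prime with \<open>a\<close> outside \<open>M\<close>.
  Then \<open>M + aB\<close> is larger than \<open>M\<close>, so the claim holds for it as well as for \<open>(M : a)\<close>.\<close>

lemma injective_modulo_all:
  assumes noeth: "noetherian_ring B" and flat: "flat_module B C\<^sub>B"
    and prime: "\<And>P. primeideal P B \<Longrightarrow> injective_modulo P" and I: "ideal I B"
  shows "injective_modulo I"
proof (rule ccontr)
  let ?bad = "{I. ideal I B \<and> \<not> injective_modulo I}"
  assume "\<not> injective_modulo I"
  then have "?bad \<noteq> {}" "?bad \<subseteq> {I. ideal I B}" using I by blast+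
  then have "\<exists>M\<in>?bad. \<forall>J\<in>?bad. M \<subseteq> J \<longrightarrow> J = M"
    by (rule noetherian_ring.exists_maximal_ideal_in[OF noeth])
  then obtain M where M: "ideal M B" "\<not> injective_modulo M"
    and max: "\<And>J. \<lbrakk>ideal J B; \<not> injective_modulo J; M \<subseteq> J\<rbrakk> \<Longrightarrow> J = M"
    by blast
  interpret M: ideal M B by (rule M(1))
  have "M \<noteq> carrier B"
  proof
    assume "M = carrier B"
    then have "injective_modulo M"
      unfolding injective_modulo_def
      using tensor_image_of_keys[OF module_C module_F, of _ "carrier B"] by (simp add: restrict_scalars_simps)
    then show False using M by simp
  qed
  then obtain a where a: "a \<in> carrier B" "a \<notin> M" and P: "primeideal {r \<in> carrier B. a \<otimes>\<^bsub>B\<^esub> r \<in> M} B"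
    using exists_associated_prime[OF noeth B M(1)] by blast
  define J where "J = {x \<oplus>\<^bsub>B\<^esub> a \<otimes>\<^bsub>B\<^esub> y | x y. x \<in> M \<and> y \<in> carrier B}"
  have "M <+>\<^bsub>B\<^esub> PIdl\<^bsub>B\<^esub> a = J"
    using a by (auto simp: J_def set_add_def' cgenideal_def B.m_comm) (metis B.m_comm)+
  then have J: "ideal J B"
    using B.add_ideals[OF M(1) B.cgenideal_ideal[OF a(1)]] by simp
  have "M \<subseteq> J" using a M.a_subset by (force simp: J_def intro: exI[of _ "\<zero>\<^bsub>B\<^esub>"])
  moreover have "a \<in> J"
    unfolding J_def using a M.zero_closed by (intro CollectI exI[of _ "\<zero>\<^bsub>B\<^esub>"] exI[of _ "\<one>\<^bsub>B\<^esub>"]) simp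
  ultimately have "injective_modulo J" using max[OF J] a(2) by blast
  then have "injective_modulo M"
    by (rule injective_modulo_extension[OF flat M(1) a(1) prime[OF P] J_def])
  then show False using M by simp
qed

lemma relative_frobenius_injective:
  assumes noeth: "noetherian_ring B" and red: "reduced_hom B C g"
    and z: "Poly_Mapping.keys z \<subseteq> carrier C \<times> carrier B" and rel: "relative_frobenius z = \<zero>\<^bsub>C\<^esub>"
  shows "z \<in> tensor_image B C\<^sub>B F\<^sub>B {\<zero>\<^bsub>B\<^esub>}"
proof -
  have flat: "flat_module B C\<^sub>B" using red by (simp add: reduced_hom_def flat_hom_def)
  have "injective_modulo P" if P: "primeideal P B" for P
  proof -
    have fiber: "char_p_fiber p B C g P"
      by (intro char_p_fiber.intro char_p_fiber_axioms.intro char_p_hom_axioms P)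
    have "geometrically_reduced (residue_field B P)
         (algebra_tensor B C g (residue_field B P) (residue_map B P))
         (algebra_tensor_right B C g (residue_field B P) (residue_map B P))"
      using red P unfolding reduced_hom_def by blast
    then show ?thesis
      unfolding injective_modulo_def
      by (intro allI impI char_p_fiber.relative_frobenius_fiber_kernel[OF fiber flat])
  qed
  then have "injective_modulo {\<zero>\<^bsub>B\<^esub>}"
    by (intro injective_modulo_all[OF noeth flat _ B.zeroideal])
  moreover have "relative_frobenius z \<in> extended {\<zero>\<^bsub>B\<^esub>}"
  proof -
    have "ideal (extended {\<zero>\<^bsub>B\<^esub>}) C" by (rule extended_ideal) simp
    then show ?thesis
      unfolding rel by (intro additive_subgroup.zero_closed ideal.axioms(1))
  qed
  ultimately show ?thesis
    using z unfolding injective_modulo_def by (elim allE impE)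
qed

end

section \<open>Finite generation over Noetherian rings\<close>

text \<open>Combinations are built one term at a time, so that no coefficient families occur in the
  statements; \<open>finitely_generated_iff\<close> makes the connection with finite sums.\<close>

inductive_set lin_span :: "('r, 'a) ring_scheme \<Rightarrow> ('r, 'm, 'z) module_scheme \<Rightarrow> 'm set \<Rightarrow> 'm set"
  for R M X where
    zero: "\<zero>\<^bsub>M\<^esub> \<in> lin_span R M X"
  | add: "\<lbrakk>r \<in> carrier R; x \<in> X; v \<in> lin_span R M X\<rbrakk> \<Longrightarrow> r \<odot>\<^bsub>M\<^esub> x \<oplus>\<^bsub>M\<^esub> v \<in> lin_span R M X"

lemma lin_span_mono: "X \<subseteq> Y \<Longrightarrow> lin_span R M X \<subseteq> lin_span R M Y"
proof
  fix v assume "X \<subseteq> Y" "v \<in> lin_span R M X"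
  from this(2) show "v \<in> lin_span R M Y"
    by induction (use \<open>X \<subseteq> Y\<close> in \<open>auto intro: lin_span.intros\<close>)
qed

lemma lin_span_finite_support:
  "v \<in> lin_span R M X \<Longrightarrow> \<exists>X0 \<subseteq> X. finite X0 \<and> v \<in> lin_span R M X0"
proof (induction rule: lin_span.induct)
  case zero
  then show ?case by (auto intro!: exI[of _ "{}"] lin_span.zero)
next
  case (add r x v)
  then obtain X0 where X0: "X0 \<subseteq> X" "finite X0" "v \<in> lin_span R M X0" by blast
  then have "v \<in> lin_span R M (insert x X0)" using lin_span_mono[of X0 "insert x X0"] by blast
  then have "r \<odot>\<^bsub>M\<^esub> x \<oplus>\<^bsub>M\<^esub> v \<in> lin_span R M (insert x X0)"
    using add by (intro lin_span.add) auto
  then show ?case using X0 add by (intro exI[of _ "insert x X0"]) auto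
qed

context module
begin

lemma lin_span_closed: "X \<subseteq> carrier M \<Longrightarrow> lin_span R M X \<subseteq> carrier M"
proof
  fix v assume X: "X \<subseteq> carrier M" and "v \<in> lin_span R M X"
  from this(2) show "v \<in> carrier M" by induction (use X in auto)
qed

lemma lin_span_incl:
  assumes "X \<subseteq> carrier M" "x \<in> X"
  shows "x \<in> lin_span R M X"
  using lin_span.add[OF R.one_closed assms(2) lin_span.zero, of M] assms by auto

lemma lin_span_sum:
  assumes X: "X \<subseteq> carrier M" and "v \<in> lin_span R M X" "w \<in> lin_span R M X"
  shows "v \<oplus>\<^bsub>M\<^esub> w \<in> lin_span R M X"
  using assms(2)
proof induction
  case zero
  then show ?case using subsetD[OF lin_span_closed[OF X] assms(3)] assms(3) by simp
next
  case (add r x v)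
  have "r \<odot>\<^bsub>M\<^esub> x \<oplus>\<^bsub>M\<^esub> (v \<oplus>\<^bsub>M\<^esub> w) \<in> lin_span R M X"
    using add by (intro lin_span.add)
  then show ?case
    using add X assms(3) lin_span_closed[OF X] by (subst M.a_assoc) auto
qed

lemma lin_span_smult:
  assumes X: "X \<subseteq> carrier M" and a: "a \<in> carrier R" and "v \<in> lin_span R M X"
  shows "a \<odot>\<^bsub>M\<^esub> v \<in> lin_span R M X"
  using assms(3)
proof induction
  case zero
  then show ?case using a by (auto intro: lin_span.zero)
next
  case (add r x v)
  have "(a \<otimes> r) \<odot>\<^bsub>M\<^esub> x \<oplus>\<^bsub>M\<^esub> a \<odot>\<^bsub>M\<^esub> v \<in> lin_span R M X"
    using add a by (intro lin_span.add) auto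
  moreover have "x \<in> carrier M" "v \<in> carrier M" using add X lin_span_closed[OF X] by auto
  ultimately show ?case using a add(1) by (simp add: smult_r_distr smult_assoc1)
qed

lemma lin_span_submodule:
  assumes X: "X \<subseteq> carrier M"
  shows "submodule (lin_span R M X) R M"
proof (rule submoduleI)
  fix v assume v: "v \<in> lin_span R M X"
  have "(\<ominus> \<one>) \<odot>\<^bsub>M\<^esub> v \<in> lin_span R M X" by (rule lin_span_smult[OF X _ v]) simp
  then show "\<ominus>\<^bsub>M\<^esub> v \<in> lin_span R M X"
    using v lin_span_closed[OF X] by (simp add: smult_l_minus subset_iff)
qed (use X lin_span_closed lin_span_sum lin_span_smult in \<open>auto intro: lin_span.zero\<close>)

lemma submodule_zero: "submodule H R M \<Longrightarrow> \<zero>\<^bsub>M\<^esub> \<in> H"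
  using subgroup.one_closed[OF submodule.axioms(1)] by fastforce

lemma lin_span_minimal:
  assumes H: "submodule H R M" and "X \<subseteq> H"
  shows "lin_span R M X \<subseteq> H"
proof
  fix v assume "v \<in> lin_span R M X"
  then show "v \<in> H"
    by induction (use assms submoduleE[OF H] submodule_zero[OF H] in auto)
qed

lemma lin_span_finsum:
  assumes "finite X" and X: "X \<subseteq> carrier M" and c: "c \<in> X \<rightarrow> carrier R"
  shows "(\<Oplus>\<^bsub>M\<^esub>x\<in>X. c x \<odot>\<^bsub>M\<^esub> x) \<in> lin_span R M X"
proof -
  have "(\<Oplus>\<^bsub>M\<^esub>x\<in>Y. c x \<odot>\<^bsub>M\<^esub> x) \<in> lin_span R M X" if "finite Y" "Y \<subseteq> X" for Y
    using that
  proof (induction Y rule: finite_induct)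
    case empty
    then show ?case by (simp add: lin_span.zero)
  next
    case (insert y Y)
    then have "(\<Oplus>\<^bsub>M\<^esub>x\<in>insert y Y. c x \<odot>\<^bsub>M\<^esub> x) = c y \<odot>\<^bsub>M\<^esub> y \<oplus>\<^bsub>M\<^esub> (\<Oplus>\<^bsub>M\<^esub>x\<in>Y. c x \<odot>\<^bsub>M\<^esub> x)"
      using X c by (intro M.finsum_insert) (auto intro!: smult_closed)
    then show ?case using insert c by (auto intro!: lin_span.add)
  qed
  from this[OF assms(1) order_refl] show ?thesis .
qed

lemma lin_span_finsumE:
  assumes fin: "finite X" and X: "X \<subseteq> carrier M" and "v \<in> lin_span R M X"
  shows "\<exists>c\<in>X \<rightarrow> carrier R. v = (\<Oplus>\<^bsub>M\<^esub>x\<in>X. c x \<odot>\<^bsub>M\<^esub> x)"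
  using assms(3)
proof induction
  case zero
  have "(\<Oplus>\<^bsub>M\<^esub>x\<in>X. \<zero> \<odot>\<^bsub>M\<^esub> x) = (\<Oplus>\<^bsub>M\<^esub>x\<in>X. \<zero>\<^bsub>M\<^esub>)"
    using X by (intro M.finsum_cong') auto
  then show ?case by (intro bexI[of _ "\<lambda>_. \<zero>"]) auto
next
  case (add r x v)
  then obtain c where c: "c \<in> X \<rightarrow> carrier R" "v = (\<Oplus>\<^bsub>M\<^esub>x\<in>X. c x \<odot>\<^bsub>M\<^esub> x)" by blast
  have x: "x \<in> carrier M" using add X by blast
  have "(\<lambda>y. r \<odot>\<^bsub>M\<^esub> y) \<in> X \<rightarrow> carrier M" using X add(1) by blast
  then have "r \<odot>\<^bsub>M\<^esub> x = (\<Oplus>\<^bsub>M\<^esub>y\<in>X. if x = y then r \<odot>\<^bsub>M\<^esub> y else \<zero>\<^bsub>M\<^esub>)"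
    using M.add.finprod_singleton[OF add(2) fin, of "\<lambda>y. r \<odot>\<^bsub>M\<^esub> y"] by (simp add: finsum_def)
  then have "r \<odot>\<^bsub>M\<^esub> x \<oplus>\<^bsub>M\<^esub> v = (\<Oplus>\<^bsub>M\<^esub>y\<in>X. (if x = y then r \<odot>\<^bsub>M\<^esub> y else \<zero>\<^bsub>M\<^esub>) \<oplus>\<^bsub>M\<^esub> c y \<odot>\<^bsub>M\<^esub> y)"
    using c X add(1) by (subst M.finsum_addf) (auto intro!: smult_closed)
  also have "\<dots> = (\<Oplus>\<^bsub>M\<^esub>y\<in>X. (if x = y then r \<oplus> c y else c y) \<odot>\<^bsub>M\<^esub> y)"
    using c X add(1) by (intro M.finsum_cong') (auto simp: smult_l_distr Pi_iff subset_iff intro!: smult_closed)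
  finally show ?case
    using c add(1) by (intro bexI[of _ "\<lambda>y. if x = y then r \<oplus> c y else c y"]) (auto simp: Pi_iff)
qed

text \<open>Applied below both to a given submodule \<open>V\<close> and to the span of chosen elements of it; comparing the
  two ideals shows that the chosen elements realise all coefficients at \<open>s\<close>.\<close>

lemma coefficient_ideal:
  assumes V: "submodule V R M" and T: "submodule T R M" and s: "s \<in> carrier M"
  shows "ideal {r \<in> carrier R. \<exists>v\<in>V. \<exists>t\<in>T. v = r \<odot>\<^bsub>M\<^esub> s \<oplus>\<^bsub>M\<^esub> t} R" (is "ideal ?J R")
proof -
  have VM: "V \<subseteq> carrier M" and TM: "T \<subseteq> carrier M" using submoduleE(1) V T by auto
  have mult: "a \<otimes> r \<in> ?J" if a: "a \<in> carrier R" and r: "r \<in> ?J" for a r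
  proof -
    obtain v t where vt: "v \<in> V" "t \<in> T" "v = r \<odot>\<^bsub>M\<^esub> s \<oplus>\<^bsub>M\<^esub> t" using r by blast
    have "a \<odot>\<^bsub>M\<^esub> v = (a \<otimes> r) \<odot>\<^bsub>M\<^esub> s \<oplus>\<^bsub>M\<^esub> a \<odot>\<^bsub>M\<^esub> t"
      using vt TM r a s by (auto simp: smult_r_distr smult_assoc1 subset_iff)
    then show ?thesis
      using a r submoduleE(4)[OF V a vt(1)] submoduleE(4)[OF T a vt(2)] by auto
  qed
  have plus: "r \<oplus> r' \<in> ?J" if r: "r \<in> ?J" and r': "r' \<in> ?J" for r r'
  proof -
    obtain v t where vt: "v \<in> V" "t \<in> T" "v = r \<odot>\<^bsub>M\<^esub> s \<oplus>\<^bsub>M\<^esub> t" using r by blast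
    obtain v' t' where vt': "v' \<in> V" "t' \<in> T" "v' = r' \<odot>\<^bsub>M\<^esub> s \<oplus>\<^bsub>M\<^esub> t'" using r' by blast
    have "v \<oplus>\<^bsub>M\<^esub> v' = (r \<oplus> r') \<odot>\<^bsub>M\<^esub> s \<oplus>\<^bsub>M\<^esub> (t \<oplus>\<^bsub>M\<^esub> t')"
      using vt vt' TM r r' s by (auto simp: smult_l_distr subset_iff M.a_ac)
    then show ?thesis
      using r r' submoduleE(5)[OF V vt(1) vt'(1)] submoduleE(5)[OF T vt(2) vt'(2)] by blast
  qed
  have zero: "\<zero> \<in> ?J"
    using submodule_zero[OF V] submodule_zero[OF T] s by (auto intro!: bexI[of _ "\<zero>\<^bsub>M\<^esub>"])
  show ?thesis
  proof (rule idealI[OF R.ring_axioms])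
    show "subgroup ?J (add_monoid R)"
    proof (rule R.add.subgroupI)
      fix r assume r: "r \<in> ?J"
      then have "\<ominus> r = (\<ominus> \<one>) \<otimes> r" using R.l_minus[of \<one> r] by simp
      then show "\<ominus> r \<in> ?J" using mult[of "\<ominus> \<one>" r] r by simp
    qed (use zero plus in auto)
    show "a \<otimes> x \<in> ?J" if "x \<in> ?J" "a \<in> carrier R" for x a using mult that by blast
    show "x \<otimes> a \<in> ?J" if "x \<in> ?J" "a \<in> carrier R" for x a
      using mult[OF that(2,1)] that R.m_comm[of x a] by simp
  qed
qed

text \<open>The coefficients at \<open>s\<close> of the elements of \<open>W\<close> form a finitely generated ideal. Choose elements of
  \<open>W\<close> whose coefficients generate it. Subtracting a combination of them from a given element of \<open>W\<close>
  cancels its coefficient at \<open>s\<close>, and leaves an element of \<open>W\<close> in the span of \<open>S\<close>, where the induction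
  hypothesis applies.\<close>

lemma submodule_of_span_finitely_generated:
  assumes noeth: "noetherian_ring R"
  shows "\<lbrakk>finite S; S \<subseteq> carrier M; submodule W R M; W \<subseteq> lin_span R M S\<rbrakk> \<Longrightarrow>
    \<exists>G \<subseteq> W. finite G \<and> W \<subseteq> lin_span R M G"
proof (induction S arbitrary: W rule: finite_induct)
  case empty
  show ?case by (rule exI[of _ "{}"], intro conjI empty_subsetI finite.emptyI empty.prems(3))
next
  case (insert s S)
  have s: "s \<in> carrier M" and S: "S \<subseteq> carrier M" using insert by auto
  note T = lin_span_submodule[OF S]
  have W: "W \<subseteq> carrier M" using submoduleE(1)[OF insert(5)] .
  let ?J = "\<lambda>V. {r \<in> carrier R. \<exists>v\<in>V. \<exists>t\<in>lin_span R M S. v = r \<odot>\<^bsub>M\<^esub> s \<oplus>\<^bsub>M\<^esub> t}"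
  obtain A where A: "A \<subseteq> carrier R" "finite A" "?J W = Idl A"
    using noetherian_ring.finetely_gen[OF noeth coefficient_ideal[OF insert(5) T s]] by blast
  have "A \<subseteq> ?J W" using R.genideal_self[OF A(1)] A(3) by simp
  then have "\<forall>r\<in>A. \<exists>v. v \<in> W \<and> (\<exists>t\<in>lin_span R M S. v = r \<odot>\<^bsub>M\<^esub> s \<oplus>\<^bsub>M\<^esub> t)" by blast
  then obtain w where w: "\<And>r. r \<in> A \<Longrightarrow> w r \<in> W"
    "\<And>r. r \<in> A \<Longrightarrow> \<exists>t\<in>lin_span R M S. w r = r \<odot>\<^bsub>M\<^esub> s \<oplus>\<^bsub>M\<^esub> t" by metis
  have wA: "w ` A \<subseteq> carrier M" using w(1) W by blast
  note V = lin_span_submodule[OF wA]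
  have "submodule (W \<inter> lin_span R M S) R M"
  proof (rule submoduleI)
    show "W \<inter> lin_span R M S \<subseteq> carrier M" using W by blast
  qed (use submodule_zero[OF insert(5)] submodule_zero[OF T] submoduleE[OF insert(5)] submoduleE[OF T] in auto)
  then obtain G where G: "G \<subseteq> W \<inter> lin_span R M S" "finite G" "W \<inter> lin_span R M S \<subseteq> lin_span R M G"
    using insert.IH[OF S] by blast
  have GM: "G \<union> w ` A \<subseteq> carrier M" using G W wA by blast
  have decomp: "\<exists>r\<in>carrier R. \<exists>t\<in>lin_span R M S. x = r \<odot>\<^bsub>M\<^esub> s \<oplus>\<^bsub>M\<^esub> t" if "x \<in> lin_span R M (insert s S)" for x
    using that
  proof induction
    case zero
    then show ?case using s by (auto intro!: bexI[of _ \<zero>] bexI[of _ "\<zero>\<^bsub>M\<^esub>"] lin_span.zero)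
  next
    case (add a y x)
    then obtain r t where rt: "r \<in> carrier R" "t \<in> lin_span R M S" "x = r \<odot>\<^bsub>M\<^esub> s \<oplus>\<^bsub>M\<^esub> t" by blast
    have tM: "t \<in> carrier M" using rt lin_span_closed[OF S] by blast
    show ?case
    proof (cases "y = s")
      case True
      then have "a \<odot>\<^bsub>M\<^esub> y \<oplus>\<^bsub>M\<^esub> x = (a \<oplus> r) \<odot>\<^bsub>M\<^esub> s \<oplus>\<^bsub>M\<^esub> t"
        using rt tM add s by (simp add: smult_l_distr M.a_assoc)
      then show ?thesis using rt add by blast
    next
      case False
      then have y: "y \<in> S" using add by simp
      then have "a \<odot>\<^bsub>M\<^esub> y \<oplus>\<^bsub>M\<^esub> x = r \<odot>\<^bsub>M\<^esub> s \<oplus>\<^bsub>M\<^esub> (a \<odot>\<^bsub>M\<^esub> y \<oplus>\<^bsub>M\<^esub> t)"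
        using rt tM add s S by (auto simp: M.a_ac subset_iff)
      then show ?thesis using rt lin_span.add[OF add(1) y rt(2)] by blast
    qed
  qed
  have "x \<in> lin_span R M (G \<union> w ` A)" if x: "x \<in> W" for x
  proof -
    obtain r t where rt: "r \<in> carrier R" "t \<in> lin_span R M S" "x = r \<odot>\<^bsub>M\<^esub> s \<oplus>\<^bsub>M\<^esub> t"
      using decomp x insert(6) by blast
    then have "r \<in> Idl A" using x A(3) by blast
    also have "Idl A \<subseteq> ?J (lin_span R M (w ` A))"
      by (rule R.genideal_minimal[OF coefficient_ideal[OF V T s]])
         (use A(1) w(2) lin_span_incl[OF wA] in blast)
    finally obtain v t' where vt: "v \<in> lin_span R M (w ` A)" "t' \<in> lin_span R M S" "v = r \<odot>\<^bsub>M\<^esub> s \<oplus>\<^bsub>M\<^esub> t'"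
      by blast
    have cl: "t \<in> carrier M" "t' \<in> carrier M" "v \<in> carrier M" "x \<in> carrier M"
      using rt vt x W lin_span_closed[OF S] lin_span_closed[OF wA] by blast+
    have vW: "v \<in> W" using lin_span_minimal[OF insert(5), of "w ` A"] w(1) vt(1) by blast
    have rs: "r \<odot>\<^bsub>M\<^esub> s \<in> carrier M" using rt(1) s by simp
    have "v \<oplus>\<^bsub>M\<^esub> (t \<ominus>\<^bsub>M\<^esub> t') = (r \<odot>\<^bsub>M\<^esub> s \<oplus>\<^bsub>M\<^esub> t) \<oplus>\<^bsub>M\<^esub> (t' \<oplus>\<^bsub>M\<^esub> \<ominus>\<^bsub>M\<^esub> t')"
      unfolding vt(3) a_minus_def using rs cl(1,2) by (simp only: M.a_ac M.a_closed M.a_inv_closed)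
    also have "\<dots> = x" using cl rs rt(3) by (simp add: M.r_neg)
    finally have x_eq: "x = (t \<ominus>\<^bsub>M\<^esub> t') \<oplus>\<^bsub>M\<^esub> v" using cl by (simp add: M.a_comm)
    have "x \<ominus>\<^bsub>M\<^esub> v = t \<ominus>\<^bsub>M\<^esub> t'"
      unfolding x_eq using cl(1-3) by (simp add: a_minus_def M.a_assoc M.r_neg)
    moreover have "x \<ominus>\<^bsub>M\<^esub> v \<in> W" "t \<ominus>\<^bsub>M\<^esub> t' \<in> lin_span R M S"
      using x vW rt vt submoduleE(3,5)[OF insert(5)] submoduleE(3,5)[OF T] by (auto simp: a_minus_def)
    ultimately have "x \<ominus>\<^bsub>M\<^esub> v \<in> lin_span R M (G \<union> w ` A)"
      using G(3) lin_span_mono[of G "G \<union> w ` A" R M] by auto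
    moreover have "v \<in> lin_span R M (G \<union> w ` A)"
      using vt(1) lin_span_mono[of "w ` A" "G \<union> w ` A" R M] by auto
    moreover have "x = (x \<ominus>\<^bsub>M\<^esub> v) \<oplus>\<^bsub>M\<^esub> v"
      using cl by (simp add: a_minus_def M.a_assoc M.l_neg)
    ultimately show ?thesis using lin_span_sum[OF GM] by metis
  qed
  then show ?case using G w(1) A(2) by (intro exI[of _ "G \<union> w ` A"]) auto
qed

end

lemma finitely_generated_iff:
  fixes M :: "('r, 'm) module"
  assumes "module R M"
  shows "finitely_generated_module R M \<longleftrightarrow> (\<exists>S \<subseteq> carrier M. finite S \<and> lin_span R M S = carrier M)"
proof -
  interpret module R M by fact
  show ?thesis
  proof
    assume "finitely_generated_module R M"
    then obtain S where S: "S \<subseteq> carrier M" "finite S"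
      and gen: "\<And>x. x \<in> carrier M \<Longrightarrow> \<exists>c \<in> S \<rightarrow> carrier R. x = (\<Oplus>\<^bsub>M\<^esub>s\<in>S. c s \<odot>\<^bsub>M\<^esub> s)"
      by (auto simp: finitely_generated_module_def)
    have "carrier M \<subseteq> lin_span R M S"
      using gen lin_span_finsum[OF S(2,1)] by fastforce
    then show "\<exists>S \<subseteq> carrier M. finite S \<and> lin_span R M S = carrier M"
      using S lin_span_closed by blast
  next
    assume "\<exists>S \<subseteq> carrier M. finite S \<and> lin_span R M S = carrier M"
    then obtain S where S: "S \<subseteq> carrier M" "finite S" "lin_span R M S = carrier M" by blast
    show "finitely_generated_module R M"
      unfolding finitely_generated_module_def using S lin_span_finsumE[OF S(2,1)] by blast
  qed
qed

text \<open>The span of \<open>X\<close> has finitely many generators, and each of them involves finitely many elements of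
  \<open>X\<close>.\<close>

lemma noetherian_finite_subset_spans:
  fixes M :: "('r, 'm) module"
  assumes M: "module R M" and noeth: "noetherian_ring R" and fg: "finitely_generated_module R M" and X: "X \<subseteq> carrier M"
  shows "\<exists>X0 \<subseteq> X. finite X0 \<and> X \<subseteq> lin_span R M X0"
proof -
  interpret module R M by fact
  obtain S where "S \<subseteq> carrier M" "finite S" "lin_span R M S = carrier M"
    using fg finitely_generated_iff[OF M] by blast
  then obtain G where G: "G \<subseteq> lin_span R M X" "finite G" "lin_span R M X \<subseteq> lin_span R M G"
    using submodule_of_span_finitely_generated[OF noeth _ _ lin_span_submodule[OF X], of S] lin_span_closed[OF X] by metis
  have "\<forall>y\<in>G. \<exists>Y. Y \<subseteq> X \<and> finite Y \<and> y \<in> lin_span R M Y"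
    using G(1) lin_span_finite_support[of _ R M X] by blast
  then obtain Y where Y: "\<And>y. y \<in> G \<Longrightarrow> Y y \<subseteq> X" "\<And>y. y \<in> G \<Longrightarrow> finite (Y y)" "\<And>y. y \<in> G \<Longrightarrow> y \<in> lin_span R M (Y y)"
    by metis
  let ?X0 = "\<Union>(Y ` G)"
  have X0: "?X0 \<subseteq> X" using Y(1) by blast
  have "G \<subseteq> lin_span R M ?X0"
    using Y(3) lin_span_mono[of "Y _" ?X0 R M] by blast
  then have "lin_span R M G \<subseteq> lin_span R M ?X0"
    using X X0 by (intro lin_span_minimal lin_span_submodule) auto
  then have "X \<subseteq> lin_span R M ?X0" using lin_span_incl[OF X] G(3) by blast
  then show ?thesis using X0 Y(2) G(2) by blast
qed

section \<open>Descent of F-finiteness\<close>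

context char_p_hom
begin

text \<open>Choose a finite \<open>S \<subseteq> B\<close> such that \<open>g(S)\<close> spans \<open>g(B)\<close> over \<open>C\<close> acting through Frobenius. By
  injectivity of the relative Frobenius, \<open>C \<otimes> F\<^sub>*B\<close> is the image of \<open>C \<otimes> N\<close> for the span \<open>N\<close> of \<open>S\<close>,
  so that \<open>N\<close> is all of \<open>F\<^sub>*B\<close> by faithful flatness.\<close>

lemma F_finite_descends:
  assumes noeth_B: "noetherian_ring B" and noeth_C: "noetherian_ring C"
    and ff: "faithfully_flat_module B C\<^sub>B" and red: "reduced_hom B C g" and fin: "F_finite p C"
  shows "F_finite p B"
proof -
  let ?F = "restrict_scalars (frobenius p C) C"
  have F: "module C ?F" by (rule module_restrict_scalars[OF C C frob_C])
  interpret F: module C ?F by (rule F)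
  have gB: "g ` carrier B \<subseteq> carrier C" using ring_hom_closed[OF g] by auto
  obtain X0 where X0: "X0 \<subseteq> g ` carrier B" "finite X0" "g ` carrier B \<subseteq> lin_span C ?F X0"
    using noetherian_finite_subset_spans[OF F noeth_C, of "g ` carrier B"] fin gB
    by (auto simp: F_finite_def restrict_scalars_simps)
  then obtain S where S: "S \<subseteq> carrier B" "finite S" "X0 = g ` S"
    using finite_subset_image[OF X0(2,1)] by blast
  let ?N = "lin_span B F\<^sub>B S"
  have SF: "S \<subseteq> carrier F\<^sub>B" using S by (simp add: restrict_scalars_simps)
  have N: "submodule ?N B F\<^sub>B" by (rule module.lin_span_submodule[OF module_F SF])
  have NB: "?N \<subseteq> carrier B" using module.lin_span_closed[OF module_F SF] by (simp add: restrict_scalars_simps)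
  have SN: "S \<subseteq> ?N" using module.lin_span_incl[OF module_F SF] by blast
  \<comment> \<open>The span of \<open>g(S)\<close> is the image of the formal sums with second components in \<open>S\<close>.\<close>
  have lift: "\<exists>w. Poly_Mapping.keys w \<subseteq> carrier C \<times> S \<and> relative_frobenius w = u"
    if "u \<in> lin_span C ?F X0" for u
    using that
  proof induction
    case zero
    then show ?case by (intro exI[of _ 0]) (simp add: relative_frobenius_zero restrict_scalars_simps)
  next
    case (add r x v)
    then obtain w s where w: "Poly_Mapping.keys w \<subseteq> carrier C \<times> S" "relative_frobenius w = v"
      and s: "s \<in> S" "x = g s" using S by blast
    have wB: "Poly_Mapping.keys w \<subseteq> carrier C \<times> carrier B" using w S by auto
    have sB: "s \<in> carrier B" using s S by blast
    \<comment> \<open>Additivity is available for differences, so the sum is written as one.\<close>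
    have neg: "relative_frobenius (0 - w) = \<zero>\<^bsub>C\<^esub> \<ominus>\<^bsub>C\<^esub> v"
      using relative_frobenius_diff[OF _ wB, of 0] w by (simp add: relative_frobenius_zero)
    have "relative_frobenius (frag_of (r, s) - (0 - w)) = r [^]\<^bsub>C\<^esub> p \<otimes>\<^bsub>C\<^esub> g s \<ominus>\<^bsub>C\<^esub> (\<zero>\<^bsub>C\<^esub> \<ominus>\<^bsub>C\<^esub> v)"
      using relative_frobenius_diff[of "frag_of (r, s)" "0 - w"] wB add sB neg relative_frobenius_of[of r s] by simp
    also have "\<dots> = r [^]\<^bsub>C\<^esub> p \<otimes>\<^bsub>C\<^esub> g s \<oplus>\<^bsub>C\<^esub> v"
      using relative_frobenius_closed[OF wB] w ring_hom_closed[OF g sB] add by (simp add: a_minus_def)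
    finally have "relative_frobenius (frag_of (r, s) - (0 - w)) = r \<odot>\<^bsub>?F\<^esub> x \<oplus>\<^bsub>?F\<^esub> v"
      using s by (simp add: restrict_scalars_simps frobenius_def)
    moreover have "Poly_Mapping.keys (frag_of (r, s) - (0 - w)) \<subseteq> carrier C \<times> S"
      using w s add by (intro keys_diff_subset) auto
    ultimately show ?case by blast
  qed
  have generator: "frag_of (c, b) \<in> tensor_image B C\<^sub>B F\<^sub>B ?N" if c: "c \<in> carrier C" and b: "b \<in> carrier B" for c b
  proof -
    have X0C: "X0 \<subseteq> carrier ?F" using X0(1) gB by (simp add: restrict_scalars_simps subset_iff)
    \<comment> \<open>The image \<open>c\<^sup>p g(b)\<close> of \<open>c \<otimes> b\<close> is the scalar multiple of \<open>g(b)\<close> by \<open>c\<close> for the Frobenius action.\<close>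
    have "c \<odot>\<^bsub>?F\<^esub> g b \<in> lin_span C ?F X0"
      using F.lin_span_smult[OF X0C c] X0(3) b by blast
    then have "relative_frobenius (frag_of (c, b)) \<in> lin_span C ?F X0"
      using c b by (simp add: relative_frobenius_of restrict_scalars_simps frobenius_def)
    then obtain w where w: "Poly_Mapping.keys w \<subseteq> carrier C \<times> S"
      and rel: "relative_frobenius w = relative_frobenius (frag_of (c, b))" using lift by blast
    have wB: "Poly_Mapping.keys w \<subseteq> carrier C \<times> carrier B" using w S by auto
    have cb: "Poly_Mapping.keys (frag_of (c, b)) \<subseteq> carrier C \<times> carrier B" using c b by simp
    have "relative_frobenius (frag_of (c, b) - w) = \<zero>\<^bsub>C\<^esub>"
      using relative_frobenius_diff[OF cb wB] rel relative_frobenius_closed[OF cb] by (simp add: C.r_right_minus_eq)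
    then have "frag_of (c, b) - w \<in> tensor_image B C\<^sub>B F\<^sub>B {\<zero>\<^bsub>B\<^esub>}"
      by (rule relative_frobenius_injective[OF noeth_B red keys_diff_subset[OF cb wB]])
    moreover have "{\<zero>\<^bsub>B\<^esub>} \<subseteq> ?N" using lin_span.zero[of F\<^sub>B B S] by (simp add: restrict_scalars_simps)
    ultimately have "frag_of (c, b) - w \<in> tensor_image B C\<^sub>B F\<^sub>B ?N" by (rule tensor_image_mono[rotated])
    moreover have "w \<in> tensor_image B C\<^sub>B F\<^sub>B ?N"
      using w SN NB by (intro tensor_image_of_keys[OF module_C module_F]) (auto simp: restrict_scalars_simps)
    ultimately have "frag_of (c, b) - w + w \<in> tensor_image B C\<^sub>B F\<^sub>B ?N"
      by (rule tensor_image_add[OF module_C module_F])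
    then show ?thesis by simp
  qed
  have "?N = carrier F\<^sub>B"
  proof (rule faithfully_flat_surjective[OF ff module_C module_F _ N, of "\<lambda>x. [x]"])
    show "z \<in> tensor_image B C\<^sub>B F\<^sub>B ?N" if "Poly_Mapping.keys z \<subseteq> carrier C\<^sub>B \<times> carrier F\<^sub>B" for z
      using that
    proof (induction z rule: frag_induction)
      case zero
      then show ?case by (rule tensor_image_of_subgroup[OF module_C module_F tensor_subgroup_zero[OF module_C module_F]])
    next
      case (one k)
      then show ?case using generator by (cases k) (simp add: restrict_scalars_simps)
    next
      case (diff a b)
      then show ?case by (rule tensor_image_diff[OF module_C module_F])
    qed
  qed (simp add: inj_on_def)
  then show ?thesis
    unfolding F_finite_def finitely_generated_iff[OF module_F] using SF S(2) by blast
qed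

end

theorem corollary20:
  fixes p :: nat and B :: "'b ring" and C :: "'c ring" and g :: "'b \<Rightarrow> 'c"
  assumes "Factorial_Ring.prime p"
    and "Fp_algebra p B" and "noetherian_ring B"
    and "Fp_algebra p C" and "noetherian_ring C"
    and "faithfully_flat_hom B C g" and "reduced_hom B C g"
    and "F_finite p C"
  shows "F_finite p B"
proof -
  have "char_p_hom p B C g"
    using assms Fp_algebra_char[of p B] Fp_algebra_char[of p C]
    by (simp add: char_p_hom_def faithfully_flat_hom_def)
  then show ?thesis
    using assms by (intro char_p_hom.F_finite_descends[of p B C g]) (simp_all add: faithfully_flat_hom_def)
qed

end
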